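(* Let $p,q$ be primes and $a,b$ positive integers. Consider the equation $\binom{p^a}{i}-\binom{q^b}{j}=2$, where the binomial coefficients are required to be positive, i.e. $p^a\ge i$ and $q^b\ge j$. (1) For $(i,j)=(2,3)$ the solutions are exactly $(p,q,a,b)=(2,2,2,2),(3,3,1,1)$. (2) For $(i,j)=(3,2)$ there are no solutions. (3) For $(i,j)=(2,4)$ the unique solution is $(p,q,a,b)=(3,2,1,2)$. (4) For $(i,j)=(4,2)$ the unique solution is $(p,q,a,b)=(5,3,1,1)$.
   Context: A figurate prime is a positive binomial coefficient $\binom{p^a}{i}$ with $p$ prime and $a,i\ge 1$ integers. *)

theory Defs
  imports Complex_Main "HOL-Computational_Algebra.Primes"
begin

text \<open>
  The difference is taken in the integers, since subtraction on \<^typ>\<open>nat\<close> truncates.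
\<close>
definition gap_two_solutions :: "nat \<Rightarrow> nat \<Rightarrow> (nat \<times> nat \<times> nat \<times> nat) set" where
  "gap_two_solutions i j =
     {(p, q, a, b). prime p \<and> prime q \<and> a \<ge> 1 \<and> b \<ge> 1 \<and> p ^ a \<ge> i \<and> q ^ b \<ge> j \<and>
        int (p ^ a choose i) - int (q ^ b choose j) = 2}"

end

theory Submission
  imports Defs "HOL-Number_Theory.Number_Theory"
begin

text \<open>
  Write x = p^a and y = q^b. For (4,2) the equation is 12 y (y - 1) = (x^2 - 3 x - 6) (x^2 - 3 x + 8),
  and the prime power y has to divide one of the two almost coprime factors. For (2,4) one is
  led to v^2 - 3 w^2 = -2 with 1 + 4 v = 5 z^2; by a doubling argument in the Pell sequence a quadratic
  character modulo a number congruent to 7 modulo 15 excludes all but the trivial index. For (3,2),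
  every x - c divides a number of the form 3 (Y^2 - D) / 4, and the quadratic characters for D = -15, -7, 105
  are incompatible.

  For (2,3), the numbers X = y - 1 and Y = 2 x - 1 satisfy 3 Y^2 = 4 X^3 - 4 X + 51, an elliptic curve of
  rank 2. An integral point gives a binary quartic form with invariants 36 and -1377 that represents 9.
  Reducing this form by means of a positive definite quadratic factor leaves three Thue equations,
  and a solution of one of them is a unit in an order of a quartic field with two real places
  and one complex place. Three units of such an order are multiplicatively dependent, by the pigeonhole
  principle; but units close to 1 whose p-adic leading terms are linearly independent modulo p are
  multiplicatively independent (Skolem's method with p = 2 or p = 5). What is left is y a power of 2 with odd exponent,
  which is excluded modulo 5, 7 and 13.
\<close>

section \<open>Quadratic characters\<close>

text \<open>The quartic form for (2,3) is 9 m^4 - 18 X m^2 n^2 - 12 Y m n^3 + (4 - 3 X^2) n^4. Its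
  first invariant is 36 for all X and Y, and its second invariant 27 (4 X^3 - 4 X - 3 Y^2) is -1377
  exactly on the curve. It takes the value 9 at (1, 0). Reduction leaves finitely many forms but
  turns (1, 0) into an unknown vector, which is how a Thue equation arises.

  The integral points of the curve are not all determined. It suffices to reach X = 3 or X odd with
  X mod 3 = 1, because y = X + 1 is then even and congruences take over.

  No fundamental units are required. A solution of a Thue equation yields a unit that is p-adically
  close to 1, the closer the higher the power of p in the unknown. Two explicit units are raised to
  a power of p that makes them equally close; this keeps their leading terms modulo p. For a nonzero
  unknown, dependence and independence of the three units then collide. Elements of the orders are
  integer quadruples with a multiplication table, so that numerical claims about units are plain
  calculations.\<close>

lemma square_mod_cases:
  fixes y n :: int
  assumes "n > 0"
  shows "y\<^sup>2 mod n \<in> (\<lambda>r. r\<^sup>2 mod n) ` {0..<n}"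
proof -
  have "y\<^sup>2 mod n = (y mod n)\<^sup>2 mod n" by (simp add: power_mod)
  moreover have "y mod n \<in> {0..<n}" using assms by simp
  ultimately show ?thesis by blast
qed

lemma QuadRes_iff_image:
  fixes a n :: int
  assumes "n > 0"
  shows "QuadRes n a \<longleftrightarrow> a mod n \<in> (\<lambda>r. r\<^sup>2 mod n) ` {0..<n}"
proof
  assume "QuadRes n a"
  then obtain y where "[y\<^sup>2 = a] (mod n)" by (auto simp: QuadRes_def)
  then have "a mod n = y\<^sup>2 mod n" by (simp add: cong_def)
  then show "a mod n \<in> (\<lambda>r. r\<^sup>2 mod n) ` {0..<n}" using square_mod_cases[OF assms] by metis
next
  assume "a mod n \<in> (\<lambda>r. r\<^sup>2 mod n) ` {0..<n}"
  then obtain r where "a mod n = r\<^sup>2 mod n" by auto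
  then show "QuadRes n a" unfolding QuadRes_def cong_def by metis
qed

lemma Legendre_3: "Legendre a 3 = (if a mod 3 = 0 then 0 else if a mod 3 = 1 then 1 else -1)"
proof -
  have "{0..<3} = {0, 1, 2 :: int}" by auto
  then show ?thesis by (auto simp: Legendre_def QuadRes_iff_image cong_def)
qed

lemma Legendre_5: "Legendre a 5 = (if a mod 5 = 0 then 0 else if a mod 5 \<in> {1, 4} then 1 else -1)"
proof -
  have "{0..<5} = {0, 1, 2, 3, 4 :: int}" by auto
  then show ?thesis by (auto simp: Legendre_def QuadRes_iff_image cong_def)
qed

lemma Legendre_7: "Legendre a 7 = (if a mod 7 = 0 then 0 else if a mod 7 \<in> {1, 2, 4} then 1 else -1)"
proof -
  have "{0..<7} = {0, 1, 2, 3, 4, 5, 6 :: int}" by auto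
  then show ?thesis by (auto simp: Legendre_def QuadRes_iff_image cong_def)
qed

lemma Legendre_values: "Legendre a p \<in> {-1, 0, 1}"
  by (simp add: Legendre_def)

text \<open>By Euler's criterion both sides agree modulo p, and they differ by at most 2, which is
  less than p.\<close>

lemma Legendre_mult:
  fixes p :: nat
  assumes "prime p" "2 < p"
  shows "Legendre (a * b) p = Legendre a p * Legendre b p"
proof -
  have "[Legendre (a * b) p = (a * b) ^ ((p - 1) div 2)] (mod int p)"
    using euler_criterion assms by blast
  moreover have "[Legendre a p * Legendre b p = (a * b) ^ ((p - 1) div 2)] (mod int p)"
    unfolding power_mult_distrib using euler_criterion assms cong_mult by blast
  ultimately have "[Legendre (a * b) p = Legendre a p * Legendre b p] (mod int p)"
    using cong_sym cong_trans by blast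
  then have "int p dvd Legendre (a * b) p - Legendre a p * Legendre b p"
    by (simp add: cong_iff_dvd_diff)
  moreover have "\<bar>Legendre (a * b) p - Legendre a p * Legendre b p\<bar> < int p"
    using Legendre_values[of "a * b" p] Legendre_values[of a p] Legendre_values[of b p] assms(2)
    by auto
  ultimately show ?thesis
    using dvd_imp_le_int[of "Legendre (a * b) p - Legendre a p * Legendre b p" "int p"] by linarith
qed

lemma Legendre_minus_one:
  fixes p :: nat
  assumes "prime p" "2 < p"
  shows "Legendre (-1) p = (-1) ^ ((p - 1) div 2)"
proof -
  have "[Legendre (-1) p = (-1) ^ ((p - 1) div 2)] (mod int p)"
    using euler_criterion assms by blast
  then have "int p dvd Legendre (-1) p - (-1) ^ ((p - 1) div 2)"
    by (simp add: cong_iff_dvd_diff)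
  moreover have "\<bar>Legendre (-1) p - (-1) ^ ((p - 1) div 2)\<bar> < int p"
    using Legendre_values[of "-1" p] assms(2) by (cases "even ((p - 1) div 2)") auto
  ultimately show ?thesis
    using dvd_imp_le_int[of "Legendre (-1) p - (-1) ^ ((p - 1) div 2)" "int p"] by linarith
qed

lemma Legendre_nonzero:
  fixes p :: nat
  assumes "\<not> int p dvd a"
  shows "Legendre a p * Legendre a p = 1"
  using assms by (simp add: Legendre_def cong_0_iff)

text \<open>The sign in the reciprocity law for 3 is (-1)^((p - 1) / 2), which is
  \<open>Legendre (-1) p\<close> itself, so it cancels. For 5 there is no sign, and for 7 the
  exponent is three times (p - 1) / 2, which has the same parity.\<close>

lemma Legendre_neg3:
  fixes p :: nat
  assumes "prime p" "2 < p" "p \<noteq> 3"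
  shows "Legendre (-3) p = Legendre p 3"
proof -
  have 3: "prime (3::nat)" by simp
  have "Legendre (-3) p = Legendre (-1) p * Legendre 3 p"
    using Legendre_mult[OF assms(1,2), of "-1" 3] by simp
  also have "Legendre (-1) p = (-1) ^ ((p - 1) div 2)"
    using Legendre_minus_one assms by blast
  also have "\<dots> = Legendre p 3 * Legendre 3 p"
    using Quadratic_Reciprocity[OF assms(1,2), of 3] assms(3) by simp
  also have "\<dots> * Legendre 3 p = Legendre p 3 * (Legendre 3 p * Legendre 3 p)" by simp
  also have "Legendre 3 p * Legendre 3 p = 1"
    using assms primes_dvd_imp_eq[of p 3] by (intro Legendre_nonzero) (metis of_nat_dvd_iff of_nat_numeral 3)
  finally show ?thesis by simp
qed

lemma Legendre_pos5:
  fixes p :: nat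
  assumes "prime p" "2 < p" "p \<noteq> 5"
  shows "Legendre 5 p = Legendre p 5"
proof -
  have "Legendre p 5 * Legendre 5 p = 1"
    using Quadratic_Reciprocity[OF assms(1,2), of 5] assms(3) by simp
  then show ?thesis
    using Legendre_values[of 5 p] Legendre_values[of p 5] by auto
qed

lemma Legendre_neg7:
  fixes p :: nat
  assumes "prime p" "2 < p" "p \<noteq> 7"
  shows "Legendre (-7) p = Legendre p 7"
proof -
  have 7: "prime (7::nat)" by simp
  have "Legendre (-7) p = Legendre (-1) p * Legendre 7 p"
    using Legendre_mult[OF assms(1,2), of "-1" 7] by simp
  also have "Legendre (-1) p = (-1) ^ ((p - 1) div 2)"
    using Legendre_minus_one assms by blast
  also have "\<dots> = (-1) ^ ((p - 1) div 2 * 3)" 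
    by (simp add: power_mult mult.commute[of _ 3])
  also have "\<dots> = Legendre p 7 * Legendre 7 p"
    using Quadratic_Reciprocity[OF assms(1,2) 7] assms(3) by simp
  also have "\<dots> * Legendre 7 p = Legendre p 7 * (Legendre 7 p * Legendre 7 p)" by simp
  also have "Legendre 7 p * Legendre 7 p = 1"
    using assms primes_dvd_imp_eq[of p 7] 7 by (intro Legendre_nonzero) (metis of_nat_dvd_iff of_nat_numeral)
  finally show ?thesis by simp
qed

lemma Legendre_eq_1_if_dvd:
  assumes "int p dvd t\<^sup>2 - d" "\<not> int p dvd d"
  shows "Legendre d p = 1"
proof -
  have "QuadRes p d" unfolding QuadRes_def using assms(1) cong_iff_dvd_diff by blast
  then show ?thesis using assms(2) by (simp add: Legendre_def cong_0_iff)
qed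

lemma multiplicative_from_primes:
  fixes n :: nat
  assumes "n > 0" "P 1" "\<And>a b. P a \<Longrightarrow> P b \<Longrightarrow> P (a * b)" "\<And>p. prime p \<Longrightarrow> p dvd n \<Longrightarrow> P p"
  shows "P n"
  using assms(1,4)
proof (induction n rule: less_induct)
  case (less n)
  show ?case
  proof (cases "n = 1")
    case True then show ?thesis using assms(2) by simp
  next
    case False
    then obtain p where p: "prime p" "p dvd n" using prime_factor_nat by blast
    then obtain k where k: "n = p * k" by blast
    have "k < n" "k > 0" using k less.prems(1) prime_gt_1_nat[OF p(1)] by auto
    then have "P k" using less.IH less.prems(2) k by simp
    then show ?thesis using assms(3) less.prems(2) p k by blast
  qed
qed

text \<open>By reciprocity the product of the two symbols is the quadratic character attached to
  -15. It is 1 at each odd prime modulo which -15 is a nonzero square, and also at 2, where both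
  symbols are -1; hence it is 1 at every product of such primes. Asking for divisibility prime by
  prime lets n divide a multiple of t^2 + 15.\<close>

lemma dvd_square_plus_15:
  fixes n :: nat
  assumes "n > 0" "coprime n 15"
    and "\<And>p. prime p \<Longrightarrow> p dvd n \<Longrightarrow> p = 2 \<or> int p dvd t\<^sup>2 + 15"
  shows "Legendre n 3 * Legendre n 5 = 1"
  using assms(1)
proof (rule multiplicative_from_primes)
  fix a b :: nat
  assume "Legendre a 3 * Legendre a 5 = 1" "Legendre b 3 * Legendre b 5 = 1"
  then show "Legendre (a * b) 3 * Legendre (a * b) 5 = 1"
    using Legendre_mult[of 3 a b] Legendre_mult[of 5 a b] by (simp add: algebra_simps)
next
  fix p :: nat
  assume p: "prime p" "p dvd n"
  have ne: "\<not> p dvd 15" using p assms(2) by (meson coprime_common_divisor not_prime_unit)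
  then have ne2: "p \<noteq> 3" "p \<noteq> 5" by auto
  show "Legendre p 3 * Legendre p 5 = 1"
  proof (cases "p = 2")
    case True then show ?thesis by (simp add: Legendre_3 Legendre_5)
  next
    case False
    then have p2: "2 < p" using p prime_ge_2_nat[of p] by simp
    have "int p dvd t\<^sup>2 - (-15)" using assms(3)[OF p] False by simp
    moreover have "\<not> int p dvd -15" using ne by (metis dvd_minus_iff of_nat_dvd_iff of_nat_numeral)
    ultimately have "Legendre (-15) p = 1" by (rule Legendre_eq_1_if_dvd)
    then show ?thesis
      using Legendre_mult[OF p(1) p2, of "-3" 5] Legendre_neg3[OF p(1) p2] Legendre_pos5[OF p(1) p2] ne2
      by simp
  qed
qed (simp add: Legendre_3 Legendre_5)

lemma dvd_square_plus_7:
  fixes n :: nat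
  assumes "n > 0" "coprime n 7"
    and "\<And>p. prime p \<Longrightarrow> p dvd n \<Longrightarrow> p = 2 \<or> int p dvd t\<^sup>2 + 7"
  shows "Legendre n 7 = 1"
  using assms(1)
proof (rule multiplicative_from_primes)
  fix a b :: nat
  assume "Legendre a 7 = 1" "Legendre b 7 = 1"
  then show "Legendre (a * b) 7 = 1"
    using Legendre_mult[of 7 a b] by simp
next
  fix p :: nat
  assume p: "prime p" "p dvd n"
  have ne: "\<not> p dvd 7" using p assms(2) by (meson coprime_common_divisor not_prime_unit)
  then have ne2: "p \<noteq> 7" by auto
  show "Legendre p 7 = 1"
  proof (cases "p = 2")
    case True then show ?thesis by (simp add: Legendre_7)
  next
    case False
    then have p2: "2 < p" using p prime_ge_2_nat[of p] by simp
    have "int p dvd t\<^sup>2 - (-7)" using assms(3)[OF p] False by simp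
    moreover have "\<not> int p dvd -7" using ne by (metis dvd_minus_iff of_nat_dvd_iff of_nat_numeral)
    ultimately have "Legendre (-7) p = 1" by (rule Legendre_eq_1_if_dvd)
    then show ?thesis using Legendre_neg7[OF p(1) p2] ne2 by simp
  qed
qed (simp add: Legendre_7)

text \<open>Since 945 = 9 * 105, the square factor 9 does not affect the symbol, and 105 = (-3) * 5
  * (-7) reduces to the three known reciprocity statements.\<close>

lemma dvd_square_minus_945:
  fixes n :: nat
  assumes "n > 0" "coprime n 105"
    and "\<And>p. prime p \<Longrightarrow> p dvd n \<Longrightarrow> p = 2 \<or> int p dvd t\<^sup>2 - 945"
  shows "Legendre n 3 * Legendre n 5 * Legendre n 7 = 1"
  using assms(1)
proof (rule multiplicative_from_primes)
  fix a b :: nat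
  assume "Legendre a 3 * Legendre a 5 * Legendre a 7 = 1" "Legendre b 3 * Legendre b 5 * Legendre b 7 = 1"
  then have "(Legendre a 3 * Legendre a 5 * Legendre a 7) * (Legendre b 3 * Legendre b 5 * Legendre b 7) = 1"
    by simp
  then show "Legendre (a * b) 3 * Legendre (a * b) 5 * Legendre (a * b) 7 = 1"
    using Legendre_mult[of 3 a b] Legendre_mult[of 5 a b] Legendre_mult[of 7 a b] by (simp add: algebra_simps)
next
  fix p :: nat
  assume p: "prime p" "p dvd n"
  have ne: "\<not> p dvd 105" using p assms(2) by (meson coprime_common_divisor not_prime_unit)
  then have ne2: "p \<noteq> 3" "p \<noteq> 5" "p \<noteq> 7" by auto
  show "Legendre p 3 * Legendre p 5 * Legendre p 7 = 1"
  proof (cases "p = 2")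
    case True then show ?thesis by (simp add: Legendre_3 Legendre_5 Legendre_7)
  next
    case False
    then have p2: "2 < p" using p prime_ge_2_nat[of p] by simp
    have "int p dvd t\<^sup>2 - 945" using assms(3)[OF p] False by simp
    moreover have ne3: "\<not> int p dvd 105" using ne by (metis of_nat_dvd_iff of_nat_numeral)
    moreover have "\<not> int p dvd 945"
    proof
      assume "int p dvd 945"
      then have "int p dvd 3 * 3 * 105" by simp
      then have "int p dvd 3 \<or> int p dvd 105" using p by (metis prime_dvd_mult_iff prime_nat_int_transfer)
      then have "int p dvd 105" using dvd_mult[of "int p" 3 35] by auto
      then show False using ne3 by simp
    qed
    ultimately have "Legendre 945 p = 1" using Legendre_eq_1_if_dvd by blast
    moreover have "Legendre 9 p = 1"
    proof -
      have "\<not> int p dvd 3" using ne3 dvd_mult[of "int p" 3 35] by auto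
      then show ?thesis using Legendre_mult[OF p(1) p2, of 3 3] Legendre_nonzero[of p 3] by simp
    qed
    ultimately have "Legendre 105 p = 1" using Legendre_mult[OF p(1) p2, of 9 105] by simp
    then show ?thesis
      using Legendre_mult[OF p(1) p2, of "-3" 5] Legendre_mult[OF p(1) p2, of "-15" "-7"]
        Legendre_neg3[OF p(1) p2] Legendre_pos5[OF p(1) p2] Legendre_neg7[OF p(1) p2] ne2
      by simp
  qed
qed (simp add: Legendre_3 Legendre_5 Legendre_7)

section \<open>Binomial coefficients of order two and four\<close>

lemma int_choose_2: "2 * int (n choose 2) = int n * (int n - 1)"
proof -
  have "2 * (n choose 2) = n * (n - 1)"
    using times_binomial_minus1_eq[of 2 n] by simp
  then have "int (2 * (n choose 2)) = int (n * (n - 1))" by simp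
  then show ?thesis by (cases n) (auto simp: algebra_simps)
qed

lemma int_choose_3: "6 * int (n choose 3) = int n * (int n - 1) * (int n - 2)"
proof (cases n)
  case (Suc k)
  have "3 * (n choose 3) = n * (k choose 2)"
    using times_binomial_minus1_eq[of 3 n] Suc by simp
  then have "3 * int (n choose 3) = int n * int (k choose 2)"
    by (metis of_nat_mult of_nat_numeral)
  then have "6 * int (n choose 3) = int n * (2 * int (k choose 2))" by simp
  then show ?thesis using Suc by (simp add: int_choose_2)
qed simp

lemma int_choose_4: "24 * int (n choose 4) = int n * (int n - 1) * (int n - 2) * (int n - 3)"
proof (cases n)
  case (Suc k)
  have "4 * (n choose 4) = n * (k choose 3)"
    using times_binomial_minus1_eq[of 4 n] Suc by simp
  then have "4 * int (n choose 4) = int n * int (k choose 3)"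
    by (metis of_nat_mult of_nat_numeral)
  then have "24 * int (n choose 4) = int n * (6 * int (k choose 3))" by simp
  then show ?thesis using Suc by (simp add: int_choose_3)
qed simp

lemma prime_power_dvd_mult:
  fixes q A B :: int
  assumes "prime q" "q ^ b dvd A * B" "\<not> (q dvd A \<and> q dvd B)"
  shows "q ^ b dvd A \<or> q ^ b dvd B"
proof (cases "q dvd A")
  case True
  then have "coprime (q ^ b) B" using assms by (simp add: prime_imp_coprime)
  then show ?thesis using assms(2) by (simp add: coprime_dvd_mult_left_iff)
next
  case False
  then have "coprime (q ^ b) A" using assms by (simp add: prime_imp_coprime)
  then show ?thesis using assms(2) by (simp add: coprime_dvd_mult_right_iff)
qed

text \<open>With A = x^2 - 3 x - 6 the equation is 12 y (y - 1) = A (A + 14), so a prime dividing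
  both factors is 2 or 7. Once A = y k or A + 14 = y k, cancelling y leaves k^2 y on one side
  against 12 y on the other, with lower terms that are linear in k; this bounds k.\<close>

lemma quartic_minus_quadratic:
  fixes x y q :: int
  assumes q: "prime q" and y: "y = q ^ b" and x: "x \<ge> 4" and y2: "y \<ge> 2"
    and eq: "12 * y * (y - 1) = (x\<^sup>2 - 3 * x - 6) * (x\<^sup>2 - 3 * x + 8)"
  shows "x = 5 \<and> y = 3"
proof -
  define A where "A = x\<^sup>2 - 3 * x - 6"
  have eqA: "12 * y * (y - 1) = A * (A + 14)" using eq by (simp add: A_def algebra_simps)
  have mono: "x\<^sup>2 - 3 * x = (x - 4) * (x + 1) + 4" by (simp add: power2_eq_square algebra_simps)
  have Age: "A \<ge> -2" using mono x by (simp add: A_def)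
  have "12 * y * (y - 1) > 0" using y2 by simp
  then have Apos: "A > 0" using eqA Age by (smt (verit) mult_nonpos_nonneg)
  have evA: "even A" by (simp add: A_def)
  have "y dvd A \<or> y dvd A + 14"
  proof (cases "q dvd A \<and> q dvd A + 14")
    case False
    moreover have "q ^ b dvd A * (A + 14)"
      unfolding eqA[symmetric] y by simp
    ultimately show ?thesis using prime_power_dvd_mult[OF q] y by blast
  next
    case True
    then have "q dvd (A + 14) - A" using dvd_diff by blast
    then have "q dvd 14" by simp
    moreover have "14 = 2 * (7::int)" by simp
    ultimately have "q dvd 2 \<or> q dvd 7" using q by (metis prime_dvd_mult_iff)
    moreover have "prime (2::int)" "prime (7::int)" by simp_all
    ultimately have "q = 2 \<or> q = 7" using q primes_dvd_imp_eq by blast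
    then show ?thesis
    proof
      \<comment> \<open>The polynomial x^2 - 3 x - 6 has no root modulo 7, as its discriminant 33 is
        a nonresidue.\<close>
      assume "q = 7"
      then have "7 dvd A" using True by simp
      then have "(x\<^sup>2 - 3 * x - 6) mod 7 = 0" by (simp add: A_def)
      moreover have "x mod 7 = 0 \<or> x mod 7 = 1 \<or> x mod 7 = 2 \<or> x mod 7 = 3 \<or> x mod 7 = 4 \<or> x mod 7 = 5 \<or> x mod 7 = 6"
        by presburger
      moreover have "[x\<^sup>2 - 3 * x - 6 = (x mod 7)\<^sup>2 - 3 * (x mod 7) - 6] (mod 7)"
        by (intro cong_diff cong_mult cong_pow cong_refl) (simp_all add: cong_def)
      ultimately show ?thesis by (auto simp: cong_def)
    next
      \<comment> \<open>Both factors are even here. Halving each of them uses up the 4 in 12, and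
        the halves C and C + 7 have opposite parity.\<close>
      assume q2: "q = 2"
      obtain C where C: "A = 2 * C" using evA by blast
      have "3 * y * (y - 1) = C * (C + 7)" using eqA unfolding C by (simp add: algebra_simps)
      then have "2 ^ b dvd C * (C + 7)" using y q2 by (metis dvd_mult2 dvd_triv_right)
      moreover have "\<not> (2 dvd C \<and> 2 dvd C + 7)" by presburger
      ultimately have "2 ^ b dvd C \<or> 2 ^ b dvd C + 7" using prime_power_dvd_mult[of 2] by simp
      then have "y dvd 2 * C \<or> y dvd 2 * (C + 7)" using y q2 dvd_mult by blast
      then show ?thesis using C by (simp add: algebra_simps)
    qed
  qed
  then show ?thesis
  proof
    assume "y dvd A"
    then obtain k where k: "A = y * k" by blast
    have kpos: "k > 0" using k Apos y2 by (metis zero_less_mult_pos less_le_trans zero_less_numeral)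
    have "y * (12 * (y - 1)) = y * (k * (y * k + 14))" using eqA k by (simp add: algebra_simps)
    then have e: "12 * (y - 1) = k * (y * k + 14)" using y2 by simp
    have "k < 4"
    proof (rule ccontr)
      assume "\<not> k < 4"
      then have k4: "k \<ge> 4" by simp
      have "k * (y * k + 14) \<ge> 4 * (y * 4 + 14)"
        using k4 y2 by (intro mult_mono add_mono) auto
      then show False using e y2 by simp
    qed
    then have "k = 1 \<or> k = 2 \<or> k = 3" using kpos by auto
    then have "(k = 2 \<and> y = 5) \<or> (k = 3 \<and> y = 18)" using e by (elim disjE) (simp_all, presburger)
    then have "x\<^sup>2 - 3 * x - 6 = 10 \<or> x\<^sup>2 - 3 * x - 6 = 54" using k by (auto simp: A_def)
    then have "(x - 4) * (x + 1) = 12 \<or> (x - 4) * (x + 1) = 56" using mono by auto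
    moreover have "x = 4 \<or> x = 5 \<or> x = 6 \<or> x = 7 \<or> x = 8 \<or> x = 9 \<or> x \<ge> 10" using x by auto
    moreover have "x \<ge> 10 \<Longrightarrow> (x - 4) * (x + 1) \<ge> 6 * 11" by (intro mult_mono) auto
    ultimately show ?thesis by auto
  next
    assume "y dvd A + 14"
    then obtain k where k: "A + 14 = y * k" by blast
    have kpos: "k > 0" using k Apos y2 by (smt (verit) zero_less_mult_pos)
    have "A = y * k - 14" using k by simp
    moreover have "12 * y * (y - 1) = A * (y * k)" using eqA k by simp
    ultimately have "y * (12 * (y - 1)) = y * (k * (y * k - 14))" by (simp add: mult.commute mult.left_commute)
    then have e: "12 * (y - 1) = k * (y * k - 14)" using y2 by simp
    have e2: "(k * k - 12) * y = 14 * k - 12" using e by (simp add: algebra_simps)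
    have "k < 8"
    proof (rule ccontr)
      assume "\<not> k < 8"
      then have k8: "k \<ge> 8" by simp
      have kk: "k * k \<ge> 8 * k" using k8 by (intro mult_right_mono) auto
      then have "k * k - 12 \<ge> 0" using k8 by linarith
      then have "(k * k - 12) * y \<ge> (k * k - 12) * 2" using y2 by (intro mult_left_mono) auto
      then have "(k * k - 12) * 2 \<le> 14 * k - 12" unfolding e2 .
      then show False using k8 kk by (simp add: algebra_simps)
    qed
    then have "k = 1 \<or> k = 2 \<or> k = 3 \<or> k = 4 \<or> k = 5 \<or> k = 6 \<or> k = 7" using kpos by auto
    then have "(k = 4 \<and> y = 11) \<or> (k = 6 \<and> y = 3)" using e2 y2 by (elim disjE) (simp_all, presburger+)
    then have "(x\<^sup>2 - 3 * x - 6 + 14 = 44) \<or> (x\<^sup>2 - 3 * x - 6 + 14 = 18 \<and> y = 3)" using k by (auto simp: A_def)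
    then have "(x - 4) * (x + 1) = 32 \<or> ((x - 4) * (x + 1) = 6 \<and> y = 3)" using mono by auto
    moreover have "x = 4 \<or> x = 5 \<or> x = 6 \<or> x = 7 \<or> x = 8 \<or> x \<ge> 9" using x by auto
    moreover have "x \<ge> 9 \<Longrightarrow> (x - 4) * (x + 1) \<ge> 5 * 10" by (intro mult_mono) auto
    ultimately show ?thesis by auto
  qed
qed

section \<open>The equation v^2 - 3 w^2 = -2 and the pair (2,4)\<close>

text \<open>
  The components of (1 + sqrt 3) (2 + sqrt 3)^n and of (2 + sqrt 3)^n, respectively.
\<close>

primrec pell :: "nat \<Rightarrow> int \<times> int" where
  "pell 0 = (1, 1)"
| "pell (Suc n) = (2 * fst (pell n) + 3 * snd (pell n), fst (pell n) + 2 * snd (pell n))"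

primrec pell_unit :: "nat \<Rightarrow> int \<times> int" where
  "pell_unit 0 = (1, 0)"
| "pell_unit (Suc n) = (2 * fst (pell_unit n) + 3 * snd (pell_unit n), fst (pell_unit n) + 2 * snd (pell_unit n))"

lemma pell_add:
  "pell (n + j) = (fst (pell_unit j) * fst (pell n) + 3 * snd (pell_unit j) * snd (pell n),
                   snd (pell_unit j) * fst (pell n) + fst (pell_unit j) * snd (pell n))"
  by (induction j) (auto simp: algebra_simps)

lemma pell_unit_add:
  "pell_unit (n + j) = (fst (pell_unit j) * fst (pell_unit n) + 3 * snd (pell_unit j) * snd (pell_unit n),
                   snd (pell_unit j) * fst (pell_unit n) + fst (pell_unit j) * snd (pell_unit n))"
  by (induction j) (auto simp: algebra_simps)

lemma pell_unit_norm: "(fst (pell_unit n))\<^sup>2 - 3 * (snd (pell_unit n))\<^sup>2 = 1"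
  by (induction n) (auto simp: algebra_simps power2_eq_square)

lemma pell_unit_double:
  "fst (pell_unit (2 * n)) = 2 * (fst (pell_unit n))\<^sup>2 - 1"
  "snd (pell_unit (2 * n)) = 2 * fst (pell_unit n) * snd (pell_unit n)"
proof -
  have "2 * n = n + n" by simp
  then have "pell_unit (2 * n) = pell_unit (n + n)" by (rule arg_cong)
  then show "fst (pell_unit (2 * n)) = 2 * (fst (pell_unit n))\<^sup>2 - 1"
    "snd (pell_unit (2 * n)) = 2 * fst (pell_unit n) * snd (pell_unit n)"
    unfolding pell_unit_add using pell_unit_norm[of n] by (simp_all add: power2_eq_square)
qed

text \<open>Descent: multiplication by 2 - sqrt 3 takes a positive solution with w >= 2 to a
  positive solution with smaller w.\<close>

lemma pell_exhaust:
  fixes v w :: int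
  assumes "v > 0" "w > 0" "v\<^sup>2 + 2 = 3 * w\<^sup>2"
  shows "\<exists>n. pell n = (v, w)"
  using assms
proof (induction "nat w" arbitrary: v w rule: less_induct)
  case less
  show ?case
  proof (cases "w = 1")
    case True
    then have "v\<^sup>2 = 1" using less.prems(3) by simp
    then have "v = 1" using less.prems(1) by (simp add: power2_eq_1_iff)
    then show ?thesis using True by (intro exI[of _ 0]) simp
  next
    case False
    then have w2: "w \<ge> 2" using less.prems(2) by simp
    define v' w' where "v' = 2 * v - 3 * w" and "w' = 2 * w - v"
    have vw: "v < 2 * w"
    proof (rule power2_less_imp_less)
      have "w\<^sup>2 > 0" using w2 by simp
      then have "v\<^sup>2 < 4 * w\<^sup>2" using less.prems(3) by linarith
      then show "v\<^sup>2 < (2 * w)\<^sup>2" by (simp add: power_mult_distrib)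
    qed (use w2 in auto)
    have "w * w \<ge> 2 * 2" using w2 by (intro mult_mono) auto
    then have w4: "w\<^sup>2 \<ge> 4" by (simp add: power2_eq_square)
    have vw2: "3 * w < 2 * v"
    proof (rule power2_less_imp_less)
      show "(3 * w)\<^sup>2 < (2 * v)\<^sup>2" using less.prems(3) w4 by (simp add: power_mult_distrib)
    qed (use less.prems in auto)
    have "w < v" using vw2 w2 by simp
    then have "nat w' < nat w" using w2 by (simp add: w'_def)
    moreover have "v' > 0" "w' > 0" using vw vw2 by (auto simp: v'_def w'_def)
    moreover have "v'\<^sup>2 + 2 = 3 * w'\<^sup>2"
      using less.prems(3) by (simp add: v'_def w'_def power2_eq_square algebra_simps)
    ultimately obtain n where "pell n = (v', w')" using less.hyps by blast
    then have "pell (Suc n) = (v, w)" by (simp add: v'_def w'_def)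
    then show ?thesis by blast
  qed
qed

text \<open>If U is the rational part of e = (2 + sqrt 3)^j, then e has norm 1 and e^2 = 2 U e - 1,
  so e^2 acts as -1 modulo U.\<close>

lemma pell_double_neg: "fst (pell_unit j) dvd fst (pell (n + 2 * j)) + fst (pell n)"
proof -
  have "fst (pell (n + 2 * j)) + fst (pell n)
    = fst (pell_unit j) * (2 * fst (pell_unit j) * fst (pell n) + 6 * snd (pell_unit j) * snd (pell n))"
    unfolding pell_add fst_conv pell_unit_double by (simp add: power2_eq_square algebra_simps)
  then show ?thesis by simp
qed

lemma pell_odd_multiple: "fst (pell_unit j) dvd fst (pell (2 * j * (2 * k + 1))) + 1"
proof (induction k)
  case 0
  show ?case using pell_double_neg[of j 0] by simp
next
  case (Suc k)
  let ?n = "2 * j * (2 * k + 1)"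
  have "fst (pell_unit j) dvd fst (pell (?n + 2 * j)) + fst (pell ?n)"
       "fst (pell_unit j) dvd fst (pell (?n + 2 * j + 2 * j)) + fst (pell (?n + 2 * j))"
    using pell_double_neg by blast+
  then have "fst (pell_unit j) dvd (fst (pell (?n + 2 * j + 2 * j)) + fst (pell (?n + 2 * j)))
     - (fst (pell (?n + 2 * j)) + fst (pell ?n)) + (fst (pell ?n) + 1)"
    using Suc dvd_add dvd_diff by blast
  moreover have "?n + 2 * j + 2 * j = 2 * j * (2 * Suc k + 1)" by simp
  ultimately show ?case by simp
qed

lemma pell_unit_power_two:
  "fst (pell_unit (2 ^ Suc r)) mod 15 = 7 \<and> fst (pell_unit (2 ^ Suc r)) > 0 \<and> odd (fst (pell_unit (2 ^ Suc r)))"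
proof (induction r)
  case (Suc r)
  define M where "M = fst (pell_unit (2 ^ Suc r))"
  have e: "fst (pell_unit (2 ^ Suc (Suc r))) = 2 * M\<^sup>2 - 1"
    using pell_unit_double(1)[of "2 ^ Suc r"] by (simp add: M_def)
  have "[2 * M\<^sup>2 - 1 = 2 * (M mod 15)\<^sup>2 - 1] (mod 15)"
    by (intro cong_diff cong_mult cong_pow cong_refl) (simp_all add: cong_def)
  moreover have "M\<^sup>2 > 0" using Suc by (simp add: M_def)
  moreover have "M mod 15 = 7" using Suc by (simp add: M_def)
  moreover have "2 * M\<^sup>2 - 1 > 0" using \<open>M\<^sup>2 > 0\<close> by linarith
  ultimately show ?case unfolding e by (simp add: cong_def)
qed (simp add: numeral_eq_Suc)

text \<open>This holds because (2 + sqrt 3)^12 is congruent to 1 modulo 65.\<close>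

lemma pell_period: "fst (pell (n + 12 * k)) mod 65 = fst (pell n) mod 65 \<and> snd (pell (n + 12 * k)) mod 65 = snd (pell n) mod 65"
proof (induction k)
  case (Suc k)
  have "pell_unit 3 = (26, 15)" by (simp add: numeral_3_eq_3)
  then have "pell_unit 6 = (1351, 780)" using pell_unit_double[of 3] by (simp add: prod_eq_iff)
  then have u: "pell_unit 12 = (3650401, 2107560)" using pell_unit_double[of 6] by (simp add: prod_eq_iff)
  define m where "m = n + 12 * k"
  have m: "n + 12 * Suc k = m + 12" by (simp add: m_def)
  have "fst (pell (m + 12)) = fst (pell m) + 65 * (56160 * fst (pell m) + 97272 * snd (pell m))"
       "snd (pell (m + 12)) = snd (pell m) + 65 * (32424 * fst (pell m) + 56160 * snd (pell m))"
    unfolding pell_add u by simp_all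
  then have "fst (pell (m + 12)) mod 65 = fst (pell m) mod 65" "snd (pell (m + 12)) mod 65 = snd (pell m) mod 65"
    by (metis mod_mult_self2)+
  then show ?case using Suc unfolding m m_def[symmetric] by metis
qed simp

lemma pell_values:
  "pell 0 = (1, 1)"
  "pell 1 = (5, 3)"
  "pell 2 = (19, 11)"
  "pell 3 = (71, 41)"
  "pell 4 = (265, 153)"
  "pell 5 = (989, 571)"
  "pell 6 = (3691, 2131)"
  "pell 7 = (13775, 7953)"
  "pell 8 = (51409, 29681)"
  "pell 9 = (191861, 110771)"
  "pell 10 = (716035, 413403)"
  "pell 11 = (2672279, 1542841)"
proof -
  show v0: "pell 0 = (1, 1)" by simp
  show v1: "pell 1 = (5, 3)" using pell.simps(2)[of 0] v0 by (simp del: pell.simps)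
  show v2: "pell 2 = (19, 11)" using pell.simps(2)[of 1] v1 by (simp add: numeral_2_eq_2 del: pell.simps)
  show v3: "pell 3 = (71, 41)" using pell.simps(2)[of 2] v2 by (simp del: pell.simps)
  show v4: "pell 4 = (265, 153)" using pell.simps(2)[of 3] v3 by (simp del: pell.simps)
  show v5: "pell 5 = (989, 571)" using pell.simps(2)[of 4] v4 by (simp del: pell.simps)
  show v6: "pell 6 = (3691, 2131)" using pell.simps(2)[of 5] v5 by (simp del: pell.simps)
  show v7: "pell 7 = (13775, 7953)" using pell.simps(2)[of 6] v6 by (simp del: pell.simps)
  show v8: "pell 8 = (51409, 29681)" using pell.simps(2)[of 7] v7 by (simp del: pell.simps)
  show v9: "pell 9 = (191861, 110771)" using pell.simps(2)[of 8] v8 by (simp del: pell.simps)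
  show v10: "pell 10 = (716035, 413403)" using pell.simps(2)[of 9] v9 by (simp del: pell.simps)
  show v11: "pell 11 = (2672279, 1542841)" using pell.simps(2)[of 10] v10 by (simp del: pell.simps)
qed

text \<open>Modulo 65 the value 5 z^2 is 5 times a square modulo 13, and only indices divisible by
  12 survive. A nonzero such index has the form 2 j (2 k + 1) with j >= 2 a power of 2, so that M =
  \<open>fst (pell_unit j)\<close> divides v + 1. The factor 20 completes the square: 20 (v + 1) =
  (5 z)^2 + 15. But M mod 15 = 7, where the character attached to -15 is -1.\<close>

lemma pell_five_squares:
  assumes z: "5 * z\<^sup>2 = 1 + 4 * fst (pell n)"
  shows "n = 0"
proof (rule ccontr)
  assume n0: "n \<noteq> 0"
  define r where "r = n mod 12"
  have n: "n = r + 12 * (n div 12)" by (simp add: r_def)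
  have vm: "fst (pell n) mod 65 = fst (pell r) mod 65" using pell_period[of r "n div 12"] n by metis
  have "(1 + 4 * fst (pell r)) mod 65 = (1 + 4 * fst (pell n)) mod 65"
    using vm by (metis mod_add_right_eq mod_mult_right_eq)
  also have "\<dots> = (5 * z\<^sup>2) mod 65" using z by simp
  finally have key: "(1 + 4 * fst (pell r)) mod 65 = (5 * z\<^sup>2) mod 65" .
  have "z\<^sup>2 mod 13 \<in> (\<lambda>r. r\<^sup>2 mod 13) ` {0..<13}" by (rule square_mod_cases) simp
  moreover have "{0..<13} = {0,1,2,3,4,5,6,7,8,9,10,11,12::int}" by (auto; presburger)
  ultimately have "z\<^sup>2 mod 13 \<in> {0,1,3,4,9,10,12}" by auto
  moreover have "(5 * z\<^sup>2) mod 65 = 5 * (z\<^sup>2 mod 13)" using mult_mod_right[of 5 "z\<^sup>2" 13] by simp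
  ultimately have sq: "(5 * z\<^sup>2) mod 65 \<in> {0,5,15,20,45,50,60}" by auto
  have "r < 12" by (simp add: r_def)
  then have "r = 0 \<or> r = 1 \<or> r = 2 \<or> r = 3 \<or> r = 4 \<or> r = 5 \<or> r = 6 \<or> r = 7 \<or> r = 8 \<or> r = 9 \<or> r = 10 \<or> r = 11"
    by presburger
  moreover have "(1 + 4 * fst (pell r)) mod 65 \<in> {0,5,15,20,45,50,60}" using sq unfolding key .
  moreover have "pell (Suc 0) = (5, 3)" by simp
  ultimately have "r = 0" by (elim disjE) (simp_all add: pell_values(3-12) del: pell.simps)
  then have "12 dvd n" by (simp add: r_def mod_eq_0_iff_dvd)
  obtain g where "n = 2 ^ multiplicity 2 n * g" "odd g"
    by (rule multiplicity_decompose'[of n 2]) (use n0 in simp_all)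
  then obtain s where sg: "n = 2 ^ s * g" "odd g" by blast
  have "s \<ge> 2"
  proof (rule ccontr)
    assume "\<not> s \<ge> 2"
    then have "s = 0 \<or> s = 1" by auto
    moreover have "4 dvd n" using \<open>12 dvd n\<close> by presburger
    then obtain h where "n = 4 * h" by blast
    ultimately have "g = 2 * (2 * h) \<or> g = 2 * h" using sg(1) by auto
    then show False using sg(2) by (metis dvd_triv_left)
  qed
  then obtain t where t: "s = Suc (Suc t)" by (metis add_2_eq_Suc le_Suc_ex)
  obtain k where k: "g = 2 * k + 1" using sg(2) by (rule oddE)
  define M where "M = fst (pell_unit (2 ^ Suc t))"
  have M: "M mod 15 = 7" "M > 0" "odd M" using pell_unit_power_two[of t] by (auto simp: M_def)
  have "n = 2 * 2 ^ Suc t * (2 * k + 1)" using sg t k by simp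
  then have "M dvd fst (pell n) + 1" using pell_odd_multiple[of "2 ^ Suc t" k] by (simp add: M_def)
  then have "M dvd 20 * (fst (pell n) + 1)" by (rule dvd_mult)
  moreover have "20 * (fst (pell n) + 1) = (5 * z)\<^sup>2 + 15" using z by (simp add: power_mult_distrib)
  ultimately have Md: "M dvd (5 * z)\<^sup>2 + 15" by metis
  have nat: "int (nat M) = M" using M by simp
  have "M mod 3 = M mod 15 mod 3" "M mod 5 = M mod 15 mod 5" by (simp_all add: mod_mod_cancel)
  then have M35: "M mod 3 = 1" "M mod 5 = 2" unfolding M(1) by simp_all
  have "Legendre (nat M) 3 * Legendre (nat M) 5 = 1"
  proof (rule dvd_square_plus_15)
    show "nat M > 0" using M by simp
    have "\<not> 3 dvd M" "\<not> 5 dvd M" using M35 by (simp_all add: dvd_eq_mod_eq_0)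
    then have "coprime M 3" "coprime M 5"
      using prime_imp_coprime[of 3 M] prime_imp_coprime[of 5 M] by (simp_all add: coprime_commute)
    then have "coprime M (3 * 5)" by (simp only: coprime_mult_right_iff)
    then have "coprime (int (nat M)) (int 15)" using nat by simp
    then show "coprime (nat M) 15" by (simp only: coprime_int_iff)
    fix p assume "prime p" "p dvd nat M"
    then show "p = 2 \<or> int p dvd (5 * z)\<^sup>2 + 15" using Md nat by (metis dvd_trans of_nat_dvd_iff)
  qed
  then show False unfolding nat using M35 by (simp add: Legendre_3 Legendre_5)
qed

text \<open>With u = y^2 - 3 y + 1 the product y (y - 1) (y - 2) (y - 3) is u^2 - 1, which gives 3
  (2 x - 1)^2 = u^2 + 50. As 3 is not a square modulo 5, both 2 x - 1 and u are multiples of 5, and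
  division by 25 leaves the Pell equation. That u is a value of this quadratic polynomial in y is
  the second condition, 5 z^2 = 1 + 4 v.\<close>

lemma quadratic_minus_quartic:
  fixes x y :: int
  assumes x: "x \<ge> 2" and y: "y \<ge> 4"
    and eq: "12 * x * (x - 1) - y * (y - 1) * (y - 2) * (y - 3) = 48"
  shows "x = 3 \<and> y = 4"
proof -
  define u where "u = y\<^sup>2 - 3 * y + 1"
  have e1: "3 * (2 * x - 1)\<^sup>2 = u\<^sup>2 + 50"
    using eq by (simp add: u_def power2_eq_square algebra_simps)
  have e2: "(2 * y - 3)\<^sup>2 = 4 * u + 5" by (simp add: u_def power2_eq_square algebra_simps)
  have m5: "t mod 5 = 0 \<or> t mod 5 = 1 \<or> t mod 5 = 2 \<or> t mod 5 = 3 \<or> t mod 5 = 4" for t :: int by presburger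
  have c: "[t = t mod 5] (mod 5)" for t :: int by (simp add: cong_def)
  have "[3 * (2 * x - 1)\<^sup>2 = 3 * ((2 * x - 1) mod 5)\<^sup>2] (mod 5)" by (rule cong_mult[OF cong_refl cong_pow[OF c]])
  moreover have "[u\<^sup>2 + 50 = (u mod 5)\<^sup>2 + 50] (mod 5)" by (rule cong_add[OF cong_pow[OF c] cong_refl])
  ultimately have "[3 * ((2 * x - 1) mod 5)\<^sup>2 = (u mod 5)\<^sup>2 + 50] (mod 5)"
    unfolding e1 using cong_sym cong_trans by blast
  then have "(2 * x - 1) mod 5 = 0 \<and> u mod 5 = 0"
    using m5[of "2 * x - 1"] m5[of u] by (elim disjE) (simp_all add: cong_def)
  then have "5 dvd 2 * x - 1 \<and> 5 dvd u" by (simp only: dvd_eq_mod_eq_0)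
  then obtain w v where wv: "2 * x - 1 = 5 * w" "u = 5 * v" by (auto elim!: dvdE)
  have "5 dvd (2 * y - 3)\<^sup>2" unfolding e2 wv(2) by simp
  then have "5 dvd 2 * y - 3" using prime_dvd_power[of "5::int"] by simp
  then obtain z where z: "2 * y - 3 = 5 * z" by blast
  have "v\<^sup>2 + 2 = 3 * w\<^sup>2" using e1[unfolded wv] by (simp add: power_mult_distrib)
  moreover have "w > 0" using wv(1) x by linarith
  moreover have "v > 0"
  proof -
    have "u = (y - 4) * (y + 1) + 5" by (simp add: u_def power2_eq_square algebra_simps)
    then have "u > 0" using y by (simp add: add_nonneg_pos)
    then show ?thesis using wv(2) by linarith
  qed
  ultimately obtain n where n: "pell n = (v, w)" using pell_exhaust by blast
  have "5 * z\<^sup>2 = 1 + 4 * v" using e2[unfolded z wv(2)] by (simp add: power_mult_distrib)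
  then have "n = 0" using pell_five_squares n by simp
  then have vw: "v = 1" "w = 1" using n by auto
  then have "x = 3" using wv(1) by simp
  moreover have "(y - 4) * (y + 1) = 0" using wv(2) vw by (simp add: u_def power2_eq_square algebra_simps)
  ultimately show ?thesis using y by auto
qed

section \<open>Binomial coefficients of order three minus order two\<close>

lemma int_mod_5_cases: "t mod 5 = 0 \<or> t mod 5 = 1 \<or> t mod 5 = 2 \<or> t mod 5 = 3 \<or> t mod 5 = 4" for t :: int
  by presburger

lemma int_mod_7_cases: "t mod 7 = 0 \<or> t mod 7 = 1 \<or> t mod 7 = 2 \<or> t mod 7 = 3 \<or> t mod 7 = 4 \<or> t mod 7 = 5 \<or> t mod 7 = 6" for t :: int
  by presburger

lemma coprime_15_iff: "coprime n 15 \<longleftrightarrow> n mod 3 \<noteq> 0 \<and> n mod 5 \<noteq> 0" for n :: nat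
proof -
  have "coprime n 15 \<longleftrightarrow> coprime n 3 \<and> coprime n 5"
    using coprime_mult_right_iff[of n 3 5] by simp
  moreover have "coprime n 3 \<longleftrightarrow> \<not> 3 dvd n" "coprime n 5 \<longleftrightarrow> \<not> 5 dvd n"
    using prime_imp_coprime_nat[of 3 n] prime_imp_coprime_nat[of 5 n] coprime_common_divisor_nat[of n 3 3] coprime_common_divisor_nat[of n 5 5]
    by (auto simp: coprime_commute)
  ultimately show ?thesis by (simp add: dvd_eq_mod_eq_0)
qed

lemma coprime_7_iff: "coprime n 7 \<longleftrightarrow> n mod 7 \<noteq> 0" for n :: nat
  using prime_imp_coprime_nat[of 7 n] coprime_common_divisor_nat[of n 7 7]
  by (auto simp: coprime_commute dvd_eq_mod_eq_0)

text \<open>Subtracting from the cubic 4 X (X - 1) (X - 2) its value at c splits off X - c and turns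
  the other side into 3 (Y^2 - D): c = 0, 1, 2 give D = -15, c = 3 gives D = -7 and c = 10 gives D =
  945 = 9 * 105. That x is a prime power is used to show that neither 3 nor 5 divides X, so that the
  characters can be evaluated.\<close>

lemma cubic_minus_quadratic:
  fixes y :: int and x :: nat
  assumes p: "prime p" and xp: "x = p ^ a" and x3: "x \<ge> 3"
    and eq: "int x * (int x - 1) * (int x - 2) = 3 * (y * (y - 1)) + 12"
  shows False
proof -
  define X where "X = int x"
  define Y where "Y = 2 * y - 1"
  have X3: "X \<ge> 3" using x3 by (simp add: X_def)
  have e15: "4 * X * (X - 1) * (X - 2) = 3 * (Y\<^sup>2 + 15)"
    using eq by (simp add: X_def Y_def power2_eq_square algebra_simps)
  have e7: "4 * (X - 3) * (X\<^sup>2 + 2) = 3 * (Y\<^sup>2 + 7)"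
    using e15 by (simp add: power2_eq_square algebra_simps)
  have e945: "4 * (X - 10) * (X\<^sup>2 + 7 * X + 72) = 3 * (Y\<^sup>2 - 945)"
    using e15 by (simp add: power2_eq_square algebra_simps)
  have sq_mod: "[Y\<^sup>2 = (Y mod n)\<^sup>2] (mod n)" for n by (intro cong_pow) (simp add: cong_def)
  have X_mod: "[4 * X * (X - 1) * (X - 2) = 4 * (X mod n) * ((X mod n) - 1) * ((X mod n) - 2)] (mod n)" for n
    by (intro cong_mult cong_diff cong_refl) (simp_all add: cong_def)
  have no25: "\<not> 25 dvd Y\<^sup>2 + 15"
  proof
    assume a: "25 dvd Y\<^sup>2 + 15"
    then have "5 dvd Y\<^sup>2 + 15" by (rule dvd_trans[rotated]) simp
    then have "5 dvd (Y\<^sup>2 + 15) - 15" by (intro dvd_diff) auto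
    then have "5 dvd Y" using prime_dvd_power[of "5::int" Y 2] by simp
    then obtain Z where "Y = 5 * Z" by blast
    then have "Y\<^sup>2 = 25 * Z\<^sup>2" by (simp add: power_mult_distrib)
    then have "25 dvd Y\<^sup>2" by simp
    then have "25 dvd (15::int)" using a by (metis dvd_add_right_iff)
    then show False by simp
  qed
  have no9: "\<not> 9 dvd Y\<^sup>2 + 15"
  proof
    assume a: "9 dvd Y\<^sup>2 + 15"
    then have "3 dvd Y\<^sup>2 + 15" by (rule dvd_trans[rotated]) simp
    then have "3 dvd (Y\<^sup>2 + 15) - 15" by (intro dvd_diff) auto
    then have "3 dvd Y" using prime_dvd_power[of "3::int" Y 2] by simp
    then obtain Z where "Y = 3 * Z" by blast
    then have "Y\<^sup>2 = 9 * Z\<^sup>2" by (simp add: power_mult_distrib)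
    then have "9 dvd (15::int)" using a by (metis dvd_add_right_iff dvd_triv_left)
    then show False by simp
  qed
  have Y3: "Y\<^sup>2 mod 3 \<noteq> 2"
  proof -
    have "Y mod 3 = 0 \<or> Y mod 3 = 1 \<or> Y mod 3 = 2" by presburger
    then show ?thesis using sq_mod[of 3] by (auto simp: cong_def)
  qed
  have Y5: "Y\<^sup>2 mod 5 \<in> {0, 1, 4}"
    using int_mod_5_cases[of Y] sq_mod[of 5] by (auto simp: cong_def)
  have X5: "X mod 5 \<in> {0, 1, 2}"
  proof -
    have "[4 * (X mod 5) * ((X mod 5) - 1) * ((X mod 5) - 2) = 3 * (Y\<^sup>2 + 15)] (mod 5)"
      using X_mod[of 5] e15 by (simp add: cong_def)
    moreover have "[3 * (Y\<^sup>2 + 15) = 3 * (Y\<^sup>2 mod 5 + 15)] (mod 5)"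
      by (intro cong_mult cong_add cong_refl) (simp add: cong_def)
    ultimately have "[4 * (X mod 5) * ((X mod 5) - 1) * ((X mod 5) - 2) = 3 * (Y\<^sup>2 mod 5 + 15)] (mod 5)"
      by (rule cong_trans)
    then show ?thesis using int_mod_5_cases[of X] Y5 by (auto simp: cong_def)
  qed
  have not5: "X mod 5 \<noteq> 0"
  proof
    assume "X mod 5 = 0"
    then have "5 dvd X" by (simp add: dvd_eq_mod_eq_0)
    then have "5 dvd x" unfolding X_def by presburger
    then have "5 dvd p" using prime_dvd_power[of "5::nat" p a] xp by simp
    then have "p = 5" using p primes_dvd_imp_eq[of 5 p] by simp
    show False
    proof (cases "a \<le> 1")
      case True
      then have "a = 0 \<or> a = 1" by auto
      then have "X = 5" using xp \<open>p = 5\<close> x3 by (auto simp: X_def)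
      then have "Y\<^sup>2 = 65" using e15 by simp
      then show False using Y3 by simp
    next
      case False
      then have "5 ^ 2 dvd x" unfolding xp \<open>p = 5\<close> by (intro le_imp_power_dvd) simp
      then have "int (5\<^sup>2) dvd X" unfolding X_def by (simp only: of_nat_dvd_iff)
      then have "25 dvd X" by simp
      then have "25 dvd 3 * (Y\<^sup>2 + 15)" unfolding e15[symmetric] by simp
      moreover have "coprime 25 (3::int)" using prime_imp_coprime[of "3::int" 25] by (simp add: coprime_commute)
      ultimately have "25 dvd Y\<^sup>2 + 15" by (simp only: coprime_dvd_mult_right_iff)
      then show False using no25 by simp
    qed
  qed
  have not3: "X mod 3 \<noteq> 0"
  proof
    assume "X mod 3 = 0"
    then have "3 dvd X" by (simp add: dvd_eq_mod_eq_0)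
    then have "3 dvd x" unfolding X_def by presburger
    then have "3 dvd p" using prime_dvd_power[of "3::nat" p a] xp by simp
    then have "p = 3" using p primes_dvd_imp_eq[of 3 p] by simp
    show False
    proof (cases "a \<le> 2")
      case True
      then have "a = 0 \<or> a = 1 \<or> a = 2" by auto
      then have "X = 3 \<or> X = 9" using xp \<open>p = 3\<close> x3 by (auto simp: X_def)
      then have "Y\<^sup>2 = -7 \<or> Y\<^sup>2 = 657" using e15 by auto
      then show False using Y5 zero_le_power2[of Y] by auto
    next
      case False
      then have "3 ^ 3 dvd x" unfolding xp \<open>p = 3\<close> by (intro le_imp_power_dvd) simp
      then have "int (3 ^ 3) dvd X" unfolding X_def by (simp only: of_nat_dvd_iff)
      then have "27 dvd X" by simp
      then have "27 dvd 3 * (Y\<^sup>2 + 15)" unfolding e15[symmetric] by simp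
      then have "3 * 9 dvd 3 * (Y\<^sup>2 + 15)" by simp
      then have "9 dvd Y\<^sup>2 + 15" by (simp only: dvd_mult_cancel_left) simp
      then show False using no9 by simp
    qed
  qed
  have chi15: "Legendre n 3 * Legendre n 5 = 1"
    if n: "n > 0" "n mod 3 \<noteq> 0" "n mod 5 \<noteq> 0" "int n dvd 3 * (Y\<^sup>2 + 15)" for n :: nat
  proof (rule dvd_square_plus_15)
    show "coprime n 15" using n coprime_15_iff by blast
    fix r assume r: "prime r" "r dvd n"
    have "int r dvd 3 * (Y\<^sup>2 + 15)" using r n(4) by (meson dvd_trans of_nat_dvd_iff)
    moreover have "\<not> int r dvd 3"
    proof
      assume "int r dvd 3"
      then have "r dvd 3" by presburger
      then have "r = 3" using r primes_dvd_imp_eq[of r 3] by simp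
      then show False using r n(2) by (simp add: dvd_eq_mod_eq_0)
    qed
    ultimately show "r = 2 \<or> int r dvd Y\<^sup>2 + 15"
      using r by (metis prime_dvd_mult_iff prime_nat_int_transfer)
  qed (use n in simp)
  have dX: "X dvd 3 * (Y\<^sup>2 + 15)" "X - 2 dvd 3 * (Y\<^sup>2 + 15)"
    unfolding e15[symmetric] by simp_all
  have xX: "int x = X" by (simp add: X_def)
  have "int (x mod 3) \<noteq> 0" "int (x mod 5) \<noteq> 0" unfolding zmod_int using not3 not5 by (simp_all add: X_def)
  then have modx: "x mod 3 \<noteq> 0" "x mod 5 \<noteq> 0" by simp_all
  have L: "Legendre X 3 * Legendre X 5 = 1"
    using chi15[of x] x3 modx dX xX by simp
  \<comment> \<open>The character at X leaves residues (1, 1) and (2, 2) modulo (3, 5). The first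
    would give X - 2 the residues (2, 4), where the character is -1.\<close>
  have X53: "X mod 5 = 2 \<and> X mod 3 = 2"
  proof (rule ccontr)
    assume *: "\<not> (X mod 5 = 2 \<and> X mod 3 = 2)"
    have "X mod 3 = 1 \<or> X mod 3 = 2" using not3 by presburger
    then have "X mod 5 = 1 \<and> X mod 3 = 1"
      using L X5 not5 * by (auto simp: Legendre_3 Legendre_5)
    then have "X mod 5 = 1" "X mod 3 = 1" by auto
    then have m: "(X - 2) mod 3 = 2" "(X - 2) mod 5 = 4" by (simp_all add: mod_diff_left_eq[of X, symmetric])
    have i: "int (x - 2) = X - 2" using x3 by (simp add: X_def)
    have "Legendre (X - 2) 3 * Legendre (X - 2) 5 = 1"
    proof -
      have "int ((x - 2) mod 3) = 2" "int ((x - 2) mod 5) = 4" unfolding zmod_int i using m by simp_all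
      then have "(x - 2) mod 3 \<noteq> 0" "(x - 2) mod 5 \<noteq> 0" by linarith+
      then show ?thesis using chi15[of "x - 2"] x3 dX i by simp
    qed
    then show False using m by (simp add: Legendre_3 Legendre_5)
  qed
  then have X17: "X \<ge> 17" using X3 by presburger
  have X7: "X mod 7 = 3 \<or> X mod 7 = 5"
  proof -
    have "[4 * (X mod 7) * ((X mod 7) - 1) * ((X mod 7) - 2) = 3 * (Y\<^sup>2 + 15)] (mod 7)"
      using X_mod[of 7] e15 by (simp add: cong_def)
    moreover have "[3 * (Y\<^sup>2 + 15) = 3 * ((Y mod 7)\<^sup>2 + 15)] (mod 7)"
      by (intro cong_mult cong_add cong_refl sq_mod)
    ultimately have "[4 * (X mod 7) * ((X mod 7) - 1) * ((X mod 7) - 2) = 3 * ((Y mod 7)\<^sup>2 + 15)] (mod 7)"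
      by (rule cong_trans)
    then show ?thesis using int_mod_7_cases[of X] int_mod_7_cases[of Y]
      by (elim disjE) (simp_all add: cong_def)
  qed
  have "X mod 7 \<noteq> 3"
  proof
    assume "X mod 7 = 3"
    then have "7 dvd X - 3" by presburger
    \<comment> \<open>The number X - 3 is not coprime to 7, so the character attached to -7 is
      evaluated at its cofactor t, which turns out to be 5 modulo 7, a nonresidue.\<close>
    then obtain t where t: "X = 3 + 7 * t" by (metis add.commute diff_add_cancel dvdE)
    have "7 dvd 3 * (Y\<^sup>2 + 7)" unfolding e7[symmetric] t by simp
    then have "7 dvd Y\<^sup>2" by presburger
    then have "7 dvd Y" using prime_dvd_power[of "7::int" Y 2] by simp
    then obtain Z where Z: "Y = 7 * Z" by blast
    have e: "4 * t * (X\<^sup>2 + 2) = 3 * (7 * Z\<^sup>2 + 1)"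
      using e7 unfolding Z t by (simp add: power_mult_distrib)
    have "[4 * t * (X\<^sup>2 + 2) = 4 * (t mod 7) * (3\<^sup>2 + 2)] (mod 7)"
      using \<open>X mod 7 = 3\<close> by (intro cong_mult cong_add cong_pow cong_refl) (simp_all add: cong_def)
    moreover have "[3 * (7 * Z\<^sup>2 + 1) = 3] (mod 7)" by (simp add: cong_iff_dvd_diff)
    ultimately have "[4 * (t mod 7) * (3\<^sup>2 + 2) = 3] (mod 7)"
      using e by (simp add: cong_def)
    then have t7: "t mod 7 = 5" using int_mod_7_cases[of t] by (elim disjE) (simp_all add: cong_def)
    have tpos: "t > 0" using X17 t by simp
    then have it: "int (nat t) = t" by simp
    have "Legendre (nat t) 7 = 1"
    proof (rule dvd_square_plus_7)
      show "nat t > 0" using tpos by simp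
      have "nat t mod 7 = 5" using t7 it by (metis nat_int nat_mod_distrib nat_numeral of_nat_0_le_iff zero_le_numeral)
      then show "coprime (nat t) 7" by (simp add: coprime_7_iff)
      fix r assume r: "prime r" "r dvd nat t"
      then have rt: "int r dvd t" using it by (metis of_nat_dvd_iff)
      then have "int r dvd 3 * (7 * Z\<^sup>2 + 1)" unfolding e[symmetric] by simp
      moreover have "\<not> int r dvd 3"
      proof
        assume "int r dvd 3"
        then have "r dvd 3" by presburger
        then have "r = 3" using r primes_dvd_imp_eq[of r 3] by simp
        then have "3 dvd t" using rt by simp
        then have "X mod 3 = 0" unfolding t by presburger
        then show False using not3 by simp
      qed
      ultimately have "int r dvd 7 * Z\<^sup>2 + 1"
        using r by (metis prime_dvd_mult_iff prime_nat_int_transfer)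
      moreover have "Y\<^sup>2 + 7 = 7 * (7 * Z\<^sup>2 + 1)" by (simp add: Z power_mult_distrib)
      ultimately show "r = 2 \<or> int r dvd Y\<^sup>2 + 7" by (metis dvd_mult)
    qed
    then show False unfolding it using t7 by (simp add: Legendre_7)
  qed
  then have X7: "X mod 7 = 5" using X7 by simp
  \<comment> \<open>At X - 10 the residues modulo 3, 5, 7 are 1, 2, 2, with symbols 1, -1, 1,
    whereas the character attached to 105 must be 1.\<close>
  have i: "int (x - 10) = X - 10" using X17 by (simp add: X_def)
  have "X mod 3 = 2" "X mod 5 = 2" using X53 by auto
  then have m: "(X - 10) mod 3 = 1" "(X - 10) mod 5 = 2" "(X - 10) mod 7 = 2"
    using X7 by (simp_all add: mod_diff_left_eq[of X, symmetric])
  have "int ((x - 10) mod 3) = 1" "int ((x - 10) mod 5) = 2" "int ((x - 10) mod 7) = 2"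
    unfolding zmod_int i using m by simp_all
  then have m': "(x - 10) mod 3 \<noteq> 0" "(x - 10) mod 5 \<noteq> 0" "(x - 10) mod 7 \<noteq> 0" by linarith+
  have "Legendre (x - 10) 3 * Legendre (x - 10) 5 * Legendre (x - 10) 7 = 1"
  proof (rule dvd_square_minus_945)
    show "x - 10 > 0" using X17 by (simp add: X_def)
    have "coprime (x - 10) 15" "coprime (x - 10) 7" using m' coprime_15_iff coprime_7_iff by blast+
    then show "coprime (x - 10) 105" using coprime_mult_right_iff[of "x - 10" 15 7] by simp
    fix r assume r: "prime r" "r dvd x - 10"
    then have "int r dvd X - 10" using i by (metis of_nat_dvd_iff)
    then have "int r dvd 3 * (Y\<^sup>2 - 945)" unfolding e945[symmetric] by (intro dvd_mult2 dvd_mult)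
    moreover have "\<not> int r dvd 3"
    proof
      assume "int r dvd 3"
      then have "r dvd 3" by presburger
      then have "r = 3" using r primes_dvd_imp_eq[of r 3] by simp
      then show False using r m' by (simp add: dvd_eq_mod_eq_0)
    qed
    ultimately show "r = 2 \<or> int r dvd Y\<^sup>2 - 945"
      using r by (metis prime_dvd_mult_iff prime_nat_int_transfer)
  qed
  then show False unfolding i using m by (simp add: Legendre_3 Legendre_5 Legendre_7)
qed

section \<open>Multiplicative independence of p-adically small units\<close>

lemma one_plus_power_cubic:
  fixes x :: "'a :: comm_ring_1"
  shows "\<exists>r. (1 + x) ^ n = 1 + of_nat n * x + of_nat (n choose 2) * x\<^sup>2 + x ^ 3 * r"
proof (induction n)
  case 0
  show ?case by (rule exI[of _ 0]) (simp add: binomial_eq_0)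
next
  case (Suc n)
  then obtain r where r: "(1 + x) ^ n = 1 + of_nat n * x + of_nat (n choose 2) * x\<^sup>2 + x ^ 3 * r" by blast
  have "(1 + x) ^ Suc n = (1 + x) * (1 + of_nat n * x + of_nat (n choose 2) * x\<^sup>2 + x ^ 3 * r)"
    by (simp add: r)
  also have "\<dots> = 1 + of_nat (Suc n) * x + of_nat (Suc n choose 2) * x\<^sup>2 + x ^ 3 * (r + x * r + of_nat (n choose 2))"
    by (simp add: algebra_simps power2_eq_square power3_eq_cube numeral_2_eq_2)
  finally show ?case by blast
qed

lemma one_plus_power_quadratic:
  fixes x :: "'a :: comm_ring_1"
  shows "\<exists>r. (1 + x) ^ n = 1 + of_nat n * x + x\<^sup>2 * r"
proof -
  obtain r where "(1 + x) ^ n = 1 + of_nat n * x + of_nat (n choose 2) * x\<^sup>2 + x ^ 3 * r"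
    using one_plus_power_cubic by blast
  then have "(1 + x) ^ n = 1 + of_nat n * x + x\<^sup>2 * (of_nat (n choose 2) + x * r)"
    by (simp add: algebra_simps power2_eq_square power3_eq_cube)
  then show ?thesis by blast
qed

text \<open>In the binomial expansion the linear term is p^(s + 1) l, and all later terms are
  divisible by p^(s + 2). For odd p the quadratic term gains a factor p from p choose 2; for p = 2
  this coefficient is 1, and 2 s >= s + 2 needs s >= 2.\<close>

lemma prime_power_lift_step:
  fixes l :: "'a :: comm_ring_1"
  assumes p: "prime p" and s: "s \<ge> 1" "p = 2 \<Longrightarrow> s \<ge> 2"
  shows "\<exists>l'. (1 + of_nat (p ^ s) * l) ^ p = 1 + of_nat (p ^ Suc s) * l' \<and> of_nat p dvd l' - l"
proof -
  define P :: 'a where "P = of_nat p"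
  obtain r where r: "(1 + P ^ s * l) ^ p = 1 + of_nat p * (P ^ s * l) + of_nat (p choose 2) * (P ^ s * l)\<^sup>2 + (P ^ s * l) ^ 3 * r"
    using one_plus_power_cubic by blast
  obtain t where t: "s = Suc t" using s(1) by (metis Suc_le_D One_nat_def)
  have "\<exists>c. of_nat (p choose 2) * (P ^ s * l)\<^sup>2 = P ^ Suc (Suc s) * c"
  proof (cases "p = 2")
    case True
    then obtain t where "s = Suc (Suc t)" using s(2) by (metis add_2_eq_Suc le_Suc_ex)
    then have "of_nat (p choose 2) * (P ^ s * l)\<^sup>2 = P ^ Suc (Suc s) * (P ^ t * l\<^sup>2)"
      using True by (simp add: power2_eq_square algebra_simps)
    then show ?thesis by blast
  next
    case False
    then have "p > 2" using p prime_ge_2_nat[of p] by simp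
    then have "p dvd p choose 2" using p by (intro dvd_choose_prime) auto
    then obtain m where "p choose 2 = p * m" by blast
    then have "of_nat (p choose 2) * (P ^ s * l)\<^sup>2 = P ^ Suc (Suc s) * (of_nat m * P ^ t * l\<^sup>2)"
      using t by (simp add: power2_eq_square algebra_simps P_def)
    then show ?thesis by blast
  qed
  then obtain c where c: "of_nat (p choose 2) * (P ^ s * l)\<^sup>2 = P ^ Suc (Suc s) * c" by blast
  have "(P ^ s * l) ^ 3 * r = P ^ Suc (Suc s) * (P ^ t * P ^ t * l ^ 3 * r)"
    using t by (simp add: power3_eq_cube algebra_simps)
  then have "(1 + P ^ s * l) ^ p = 1 + P ^ Suc s * (l + P * (c + P ^ t * P ^ t * l ^ 3 * r))"
    unfolding r c by (simp add: P_def algebra_simps)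
  moreover have "P dvd (l + P * (c + P ^ t * P ^ t * l ^ 3 * r)) - l" by simp
  ultimately show ?thesis unfolding P_def of_nat_power by blast
qed

lemma prime_power_lift:
  fixes l :: "'a :: comm_ring_1"
  assumes p: "prime p" and s: "s \<ge> 1" "p = 2 \<Longrightarrow> s \<ge> 2"
  shows "\<exists>l'. (1 + of_nat (p ^ s) * l) ^ (p ^ k) = 1 + of_nat (p ^ (s + k)) * l' \<and> of_nat p dvd l' - l"
proof (induction k)
  case 0
  show ?case by (rule exI[of _ l]) simp
next
  case (Suc k)
  then obtain l' where l': "(1 + of_nat (p ^ s) * l) ^ (p ^ k) = 1 + of_nat (p ^ (s + k)) * l'" "of_nat p dvd l' - l"
    by blast
  obtain l'' where l'': "(1 + of_nat (p ^ (s + k)) * l') ^ p = 1 + of_nat (p ^ Suc (s + k)) * l''" "of_nat p dvd l'' - l'"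
    using prime_power_lift_step[OF p, of "s + k" l'] s by fastforce
  have "(1 + of_nat (p ^ s) * l) ^ (p ^ Suc k) = ((1 + of_nat (p ^ s) * l) ^ (p ^ k)) ^ p"
    by (simp add: mult.commute flip: power_mult)
  then have "(1 + of_nat (p ^ s) * l) ^ (p ^ Suc k) = 1 + of_nat (p ^ (s + Suc k)) * l''"
    unfolding l'(1) l''(1) by simp
  moreover have "of_nat p dvd (l'' - l') + (l' - l)" using l' l'' by (intro dvd_add)
  ultimately show ?case by auto
qed

text \<open>An integer power of u in a ring without a division operation: w stands for the inverse
  of u and is passed explicitly.\<close>

definition zpow :: "'a :: comm_ring_1 \<Rightarrow> 'a \<Rightarrow> int \<Rightarrow> 'a" where
  "zpow u w n = (if n \<ge> 0 then u ^ nat n else w ^ nat (- n))"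

lemma zpow_diff:
  assumes "u * w = 1"
  shows "zpow u w (int a - int b) * u ^ b = u ^ a"
proof (cases "a \<ge> b")
  case True
  then show ?thesis by (simp add: zpow_def flip: power_add of_nat_diff)
next
  case False
  then have "zpow u w (int a - int b) = w ^ (b - a)" by (simp add: zpow_def nat_diff_distrib' of_nat_diff)
  moreover have "u ^ b = u ^ (b - a) * u ^ a" using False by (simp flip: power_add)
  moreover have "w ^ (b - a) * u ^ (b - a) = 1"
    using assms by (simp add: mult.commute flip: power_mult_distrib)
  ultimately show ?thesis by (simp flip: mult.assoc)
qed

text \<open>To first order the p-adic logarithm of u is p^s l, and it is multiplied by the exponent,
  for either sign of n.\<close>

lemma zpow_lift:
  fixes l :: "'a :: comm_ring_1"
  assumes p: "prime p" and s: "s \<ge> 1" "p = 2 \<Longrightarrow> s \<ge> 2"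
    and u: "u = 1 + of_nat (p ^ s) * l" and w: "u * w = 1"
  shows "\<exists>r. zpow u w (int p ^ k * n) = 1 + of_nat (p ^ (s + k)) * (of_int n * l + of_nat p * r)"
proof -
  have *: "\<exists>r. v ^ (p ^ k * m) = 1 + of_nat (p ^ (s + k)) * (of_nat m * j + of_nat p * r)"
    if v: "v = 1 + of_nat (p ^ s) * j" for v j :: 'a and m
  proof -
    obtain j' where j': "v ^ (p ^ k) = 1 + of_nat (p ^ (s + k)) * j'" "of_nat p dvd j' - j"
      using prime_power_lift[OF p s] v by blast
    then obtain c where c: "j' = j + of_nat p * c" by (metis diff_add_cancel dvdE add.commute)
    obtain r where r: "(1 + of_nat (p ^ (s + k)) * j') ^ m = 1 + of_nat m * (of_nat (p ^ (s + k)) * j') + (of_nat (p ^ (s + k)) * j')\<^sup>2 * r"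
      using one_plus_power_quadratic by blast
    obtain t where t: "s + k = Suc t" using s(1) by (metis Suc_le_D One_nat_def le_add1 le_trans)
    have "v ^ (p ^ k * m) = 1 + of_nat (p ^ (s + k)) * (of_nat m * j + of_nat p * (of_nat m * c + of_nat (p ^ t) * j'\<^sup>2 * r))"
      unfolding power_mult j'(1) r c[symmetric] unfolding c t by (simp add: algebra_simps power2_eq_square)
    then show ?thesis by blast
  qed
  show ?thesis
  proof (cases "n \<ge> 0")
    case True
    then have "zpow u w (int p ^ k * n) = u ^ (p ^ k * nat n)"
      by (simp add: zpow_def nat_mult_distrib nat_power_eq)
    then show ?thesis using *[OF u, of "nat n"] True by (simp add: of_nat_nat)
  next
    case False
    have "w = 1 + of_nat (p ^ s) * (- l * w)"
    proof -
      have "w + of_nat (p ^ s) * l * w = 1" using w u by (simp add: algebra_simps)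
      then show ?thesis by (simp add: algebra_simps)
    qed
    moreover obtain t where t: "s = Suc t" using s(1) by (metis Suc_le_D One_nat_def)
    ultimately have w2: "w = 1 + of_nat (p ^ s) * (- l * w)" by blast
    have neg: "int p ^ k * n < 0" using False p by (simp add: mult_pos_neg prime_gt_0_nat)
    then have "zpow u w (int p ^ k * n) = w ^ nat (- (int p ^ k * n))" by (simp add: zpow_def)
    also have "nat (- (int p ^ k * n)) = p ^ k * nat (- n)"
    proof -
      have "- (int p ^ k * n) = int (p ^ k) * (- n)" by simp
      then show ?thesis by (metis nat_int nat_mult_distrib of_nat_0_le_iff)
    qed
    finally have z: "zpow u w (int p ^ k * n) = w ^ (p ^ k * nat (- n))" .
    obtain r where r: "w ^ (p ^ k * nat (- n)) = 1 + of_nat (p ^ (s + k)) * (of_nat (nat (- n)) * (- l * w) + of_nat p * r)"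
      using *[OF w2, of "nat (- n)"] by blast
    have "(of_nat (nat (- n)) :: 'a) = - of_int n" using False by (simp add: of_nat_nat)
    moreover have "- l * w = - l + of_nat p * (of_nat (p ^ t) * l * l * w)"
      by (subst w2) (simp add: algebra_simps t)
    ultimately have "of_nat (nat (- n)) * (- l * w) + of_nat p * r
        = - of_int n * (- l + of_nat p * (of_nat (p ^ t) * l * l * w)) + of_nat p * r" by simp
    also have "\<dots> = of_int n * l + of_nat p * (r - of_int n * (of_nat (p ^ t) * l * l * w))"
      by (simp add: algebra_simps)
    finally have "of_nat (nat (- n)) * (- l * w) + of_nat p * r = of_int n * l + of_nat p * (r - of_int n * (of_nat (p ^ t) * l * l * w))" .
    then show ?thesis unfolding z r by (intro exI[of _ "r - of_int n * (of_nat (p ^ t) * l * l * w)"]) simp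
  qed
qed

text \<open>Let p^k be the exact power of p that divides all differences of exponents. Each factor
  of the relation is then 1 + p^(s + k) times its leading term; cancelling p^(s + k) leaves a linear
  relation between the \<open>l1\<close>, \<open>l2\<close>, \<open>l3\<close> modulo p. By
  independence p divides the reduced exponents too, against the choice of k.\<close>

theorem multiplicatively_independent:
  fixes u1 u2 u3 :: "'a :: comm_ring_1"
  assumes p: "prime p" and s: "s \<ge> 1" "p = 2 \<Longrightarrow> s \<ge> 2"
    and tf: "\<And>x :: 'a. of_nat p * x = 0 \<Longrightarrow> x = 0"
    and u: "u1 = 1 + of_nat (p ^ s) * l1" "u2 = 1 + of_nat (p ^ s) * l2" "u3 = 1 + of_nat (p ^ s) * l3"
    and w: "u1 * w1 = 1" "u2 * w2 = 1" "u3 * w3 = 1"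
    and indep: "\<And>a b c. of_nat p dvd of_int a * l1 + of_int b * l2 + of_int c * l3
                  \<Longrightarrow> int p dvd a \<and> int p dvd b \<and> int p dvd c"
    and eq: "u1 ^ a1 * u2 ^ b1 * u3 ^ c1 = u1 ^ a2 * u2 ^ b2 * u3 ^ c2"
  shows "a1 = a2 \<and> b1 = b2 \<and> c1 = c2"
proof (rule ccontr)
  assume contra: "\<not> ?thesis"
  define a b c where "a = int a1 - int a2" and "b = int b1 - int b2" and "c = int c1 - int c2"
  define M where "M = u1 ^ a2 * u2 ^ b2 * u3 ^ c2"
  have "zpow u1 w1 a * zpow u2 w2 b * zpow u3 w3 c * M
      = (zpow u1 w1 a * u1 ^ a2) * (zpow u2 w2 b * u2 ^ b2) * (zpow u3 w3 c * u3 ^ c2)"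
    by (simp add: M_def ac_simps)
  also have "\<dots> = u1 ^ a1 * u2 ^ b1 * u3 ^ c1"
    unfolding a_def b_def c_def zpow_diff[OF w(1)] zpow_diff[OF w(2)] zpow_diff[OF w(3)] ..
  finally have "zpow u1 w1 a * zpow u2 w2 b * zpow u3 w3 c * M = M" using eq M_def by simp
  moreover have "M * (w1 ^ a2 * w2 ^ b2 * w3 ^ c2) = 1"
  proof -
    have "M * (w1 ^ a2 * w2 ^ b2 * w3 ^ c2) = (u1 * w1) ^ a2 * (u2 * w2) ^ b2 * (u3 * w3) ^ c2"
      by (simp add: M_def power_mult_distrib ac_simps)
    then show ?thesis using w by simp
  qed
  ultimately have rel: "zpow u1 w1 a * zpow u2 w2 b * zpow u3 w3 c = 1"
    by (metis mult.assoc mult.right_neutral)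
  define g where "g = gcd a (gcd b c)"
  have g0: "g \<noteq> 0" using contra by (auto simp: g_def a_def b_def c_def)
  define k where "k = multiplicity (int p) g"
  have pk: "int p ^ k dvd g" by (simp add: k_def multiplicity_dvd)
  have "int p ^ k dvd a" "int p ^ k dvd b" "int p ^ k dvd c"
    using pk by (auto simp: g_def intro: dvd_trans)
  then obtain a' b' c' where abc: "a = int p ^ k * a'" "b = int p ^ k * b'" "c = int p ^ k * c'"
    by (auto elim!: dvdE)
  define P :: 'a where "P = of_nat (p ^ (s + k))"
  obtain r1 r2 r3 where
    r: "zpow u1 w1 a = 1 + P * (of_int a' * l1 + of_nat p * r1)"
       "zpow u2 w2 b = 1 + P * (of_int b' * l2 + of_nat p * r2)"
       "zpow u3 w3 c = 1 + P * (of_int c' * l3 + of_nat p * r3)"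
    using zpow_lift[OF p s u(1) w(1), of k a'] zpow_lift[OF p s u(2) w(2), of k b'] zpow_lift[OF p s u(3) w(3), of k c']
    unfolding abc P_def by blast
  define A B C where "A = of_int a' * l1 + of_nat p * r1" and "B = of_int b' * l2 + of_nat p * r2"
    and "C = of_int c' * l3 + of_nat p * r3"
  have "(1 + P * A) * (1 + P * B) * (1 + P * C) = 1" using rel r by (simp add: A_def B_def C_def)
  then have PZ: "P * (A + B + C + P * (A * B + A * C + B * C + P * A * B * C)) = 0"
    by (simp add: algebra_simps)
  have tfk: "of_nat (p ^ j) * x = 0 \<Longrightarrow> x = 0" for j and x :: 'a
    by (induction j) (auto simp: mult.assoc dest: tf)
  have "A + B + C + P * (A * B + A * C + B * C + P * A * B * C) = 0"
    using tfk PZ unfolding P_def by blast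
  moreover obtain t where "s + k = Suc t" using s(1) by (metis Suc_le_D One_nat_def le_add1 le_trans)
  then have "P = of_nat p * of_nat (p ^ t)" by (simp add: P_def)
  ultimately have "of_int a' * l1 + of_int b' * l2 + of_int c' * l3 =
     of_nat p * (- r1 - r2 - r3 - of_nat (p ^ t) * (A * B + A * C + B * C + P * A * B * C))"
    by (simp add: A_def B_def C_def algebra_simps eq_neg_iff_add_eq_0)
  then have "of_nat p dvd of_int a' * l1 + of_int b' * l2 + of_int c' * l3" by simp
  then have "int p dvd a' \<and> int p dvd b' \<and> int p dvd c'" by (rule indep)
  then have "int p ^ Suc k dvd g" unfolding g_def abc by (auto intro!: mult_dvd_mono simp: mult.commute[of "int p"])
  moreover have "\<not> is_unit (int p)" using p by (metis not_prime_unit prime_nat_int_transfer)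
  ultimately show False using g0 unfolding k_def by (metis multiplicity_geI not_less_eq_eq order_refl)
qed

section \<open>Multiplicative dependence of three units\<close>

text \<open>Two real places and one complex place of a quartic order, seen only through
  multiplicativity and through the discreteness of the order in its completion.\<close>

locale quartic_embeddings =
  fixes e1 e2 :: "'a :: comm_ring_1 \<Rightarrow> real" and e3 :: "'a \<Rightarrow> complex"
  assumes one: "e1 1 = 1" "e2 1 = 1" "e3 1 = 1"
    and mult: "e1 (x * y) = e1 x * e1 y" "e2 (x * y) = e2 x * e2 y" "e3 (x * y) = e3 x * e3 y"
    and finite_bounded: "finite {x. \<bar>e1 x\<bar> \<le> R \<and> \<bar>e2 x\<bar> \<le> R \<and> cmod (e3 x) \<le> R}"
begin

text \<open>The locale provides no norm, so the product formula is made a condition and verified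
  separately for each unit. The complex absolute value is squared because it stands for two
  conjugate places.\<close>

definition unimodular :: "'a \<Rightarrow> bool" where
  "unimodular u \<longleftrightarrow> u dvd 1 \<and> \<bar>e1 u\<bar> * \<bar>e2 u\<bar> * (cmod (e3 u))\<^sup>2 = 1"

lemma power: "e1 (x ^ n) = e1 x ^ n" "e2 (x ^ n) = e2 x ^ n" "e3 (x ^ n) = e3 x ^ n"
  by (induction n) (simp_all add: one mult)

lemma unimodular_mult: "unimodular u \<Longrightarrow> unimodular v \<Longrightarrow> unimodular (u * v)"
proof -
  assume "unimodular u" "unimodular v"
  then have "\<bar>e1 u\<bar> * \<bar>e2 u\<bar> * (cmod (e3 u))\<^sup>2 * (\<bar>e1 v\<bar> * \<bar>e2 v\<bar> * (cmod (e3 v))\<^sup>2) = 1" "u * v dvd 1"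
    using mult_dvd_mono[of u 1 v 1] by (auto simp: unimodular_def)
  then show ?thesis by (simp add: unimodular_def mult abs_mult norm_mult power_mult_distrib ac_simps)
qed

lemma unimodular_one: "unimodular 1"
  by (simp add: unimodular_def one)

lemma unimodular_power: "unimodular u \<Longrightarrow> unimodular (u ^ n)"
  by (induction n) (auto intro: unimodular_one unimodular_mult)

lemma unimodular_nonzero:
  assumes "unimodular u"
  shows "\<bar>e1 u\<bar> > 0" "\<bar>e2 u\<bar> > 0" "cmod (e3 u) > 0"
  using assms by (auto simp: unimodular_def)

lemma unimodular_inverse:
  assumes "unimodular u" "u * w = 1"
  shows "unimodular w"
proof -
  have *: "e1 u * e1 w = 1" "e2 u * e2 w = 1" "e3 u * e3 w = 1"
    using assms(2) by (simp_all add: one flip: mult)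
  have "(\<bar>e1 u\<bar> * \<bar>e2 u\<bar> * (cmod (e3 u))\<^sup>2) * (\<bar>e1 w\<bar> * \<bar>e2 w\<bar> * (cmod (e3 w))\<^sup>2)
    = \<bar>e1 u * e1 w\<bar> * \<bar>e2 u * e2 w\<bar> * (cmod (e3 u * e3 w))\<^sup>2"
    by (simp add: abs_mult norm_mult power_mult_distrib ac_simps)
  then have "\<bar>e1 w\<bar> * \<bar>e2 w\<bar> * (cmod (e3 w))\<^sup>2 = 1"
    using * assms(1) by (simp add: unimodular_def)
  moreover have "w dvd 1" using assms(2) by (metis dvd_triv_right)
  ultimately show ?thesis by (simp add: unimodular_def)
qed

text \<open>
  The easy half of Dirichlet's unit theorem: the logarithmic embedding has a two-dimensional
  image, so a box of N^3 monomials in three units meets only O(N^2) unit cells, while each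
  cell contains a bounded number of units.
\<close>
theorem three_units_dependent:
  assumes U: "unimodular u1" "unimodular u2" "unimodular u3"
  shows "\<exists>a1 b1 c1 a2 b2 c2. u1 ^ a1 * u2 ^ b1 * u3 ^ c1 = u1 ^ a2 * u2 ^ b2 * u3 ^ c2
           \<and> \<not> (a1 = a2 \<and> b1 = b2 \<and> c1 = (c2 :: nat))"
proof (rule ccontr)
  assume contra: "\<not> ?thesis"
  define mon where "mon = (\<lambda>(a, b, c). u1 ^ a * u2 ^ b * u3 ^ c)"
  have inj: "inj mon"
    using contra by (auto simp: inj_def mon_def)
  have Umon: "unimodular (mon t)" for t
    by (cases t) (auto simp: mon_def intro!: unimodular_mult unimodular_power U)
  define B where "B = {x. \<bar>e1 x\<bar> \<le> exp 1 \<and> \<bar>e2 x\<bar> \<le> exp 1 \<and> cmod (e3 x) \<le> exp 1}"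
  have finB: "finite B" unfolding B_def by (rule finite_bounded)
  define K where "K = card B"
  define L1 L2 where "L1 = (\<lambda>x. ln \<bar>e1 x\<bar>)" and "L2 = (\<lambda>x. ln \<bar>e2 x\<bar>)"
  have L_mult: "L1 (x * y) = L1 x + L1 y" "L2 (x * y) = L2 x + L2 y" if "unimodular x" "unimodular y" for x y
    using unimodular_nonzero[OF that(1)] unimodular_nonzero[OF that(2)]
    by (auto simp: L1_def L2_def mult abs_mult ln_mult)
  have L_power: "L1 (x ^ n) = real n * L1 x" "L2 (x ^ n) = real n * L2 x" if "unimodular x" for x n
    using unimodular_nonzero[OF that] by (auto simp: L1_def L2_def power power_abs ln_realpow)
  define C where "C = nat \<lceil>Max {\<bar>L1 u1\<bar>, \<bar>L1 u2\<bar>, \<bar>L1 u3\<bar>, \<bar>L2 u1\<bar>, \<bar>L2 u2\<bar>, \<bar>L2 u3\<bar>}\<rceil>"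
  have C: "\<bar>L1 u\<bar> \<le> real C \<and> \<bar>L2 u\<bar> \<le> real C" if "u \<in> {u1, u2, u3}" for u
  proof -
    have "x \<le> real C" if "x \<in> {\<bar>L1 u1\<bar>, \<bar>L1 u2\<bar>, \<bar>L1 u3\<bar>, \<bar>L2 u1\<bar>, \<bar>L2 u2\<bar>, \<bar>L2 u3\<bar>}" for x
    proof -
      have "x \<le> Max {\<bar>L1 u1\<bar>, \<bar>L1 u2\<bar>, \<bar>L1 u3\<bar>, \<bar>L2 u1\<bar>, \<bar>L2 u2\<bar>, \<bar>L2 u3\<bar>}"
        by (rule Max_ge) (use that in auto)
      then show ?thesis unfolding C_def by linarith
    qed
    then show ?thesis using that by auto
  qed
  \<comment> \<open>There are at most (6 C N + 1)^2 <= ((6 C + 1) N)^2 cells with at most K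
    monomials each. This N makes K (6 C + 1)^2 equal to N - 1, so all cells together hold at most (N
    - 1) N^2 < N^3 monomials.\<close>
  define N where "N = K * (6 * C + 1)\<^sup>2 + 1"
  have N: "N \<ge> 1" by (simp add: N_def)
  define T where "T = {..<N} \<times> {..<N} \<times> {..<N}"
  have cardT: "card T = N * (N * N)" by (simp add: T_def card_cartesian_product)
  define I where "I = {- int (3 * C * N)..int (3 * C * N)}"
  have cardI: "card I = 6 * C * N + 1"
  proof -
    have "card I = nat (int (3 * C * N) - (- int (3 * C * N)) + 1)"
      unfolding I_def card_atLeastAtMost_int ..
    also have "int (3 * C * N) - (- int (3 * C * N)) + 1 = int (6 * C * N + 1)" by simp
    finally show ?thesis by (simp only: nat_int)
  qed
  define cell where "cell t = (\<lfloor>L1 (mon t)\<rfloor>, \<lfloor>L2 (mon t)\<rfloor>)" for t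
  have bound: "\<bar>real a * x + real b * y + real c * z\<bar> \<le> real (3 * C * N)"
    if "a < N" "b < N" "c < N" "\<bar>x\<bar> \<le> real C" "\<bar>y\<bar> \<le> real C" "\<bar>z\<bar> \<le> real C" for a b c x y z
  proof -
    have "\<bar>real a * x\<bar> \<le> real N * real C" "\<bar>real b * y\<bar> \<le> real N * real C" "\<bar>real c * z\<bar> \<le> real N * real C"
      unfolding abs_mult by (intro mult_mono; use that in simp)+
    then have "\<bar>real a * x + real b * y + real c * z\<bar> \<le> 3 * (real N * real C)" by linarith
    then show ?thesis by (simp add: ac_simps)
  qed
  have cellT: "cell t \<in> I \<times> I" if t: "t \<in> T" for t
  proof -
    obtain a b c where abc: "t = (a, b, c)" "a < N" "b < N" "c < N" using t by (auto simp: T_def)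
    have "L1 (mon t) = real a * L1 u1 + real b * L1 u2 + real c * L1 u3"
         "L2 (mon t) = real a * L2 u1 + real b * L2 u2 + real c * L2 u3"
      using U by (simp_all add: abc mon_def L_mult L_power unimodular_mult unimodular_power)
    then have "\<bar>L1 (mon t)\<bar> \<le> real (3 * C * N)" "\<bar>L2 (mon t)\<bar> \<le> real (3 * C * N)"
      using bound abc C by simp_all
    then have "L1 (mon t) \<ge> of_int (- int (3 * C * N))" "L1 (mon t) \<le> of_int (int (3 * C * N))"
      "L2 (mon t) \<ge> of_int (- int (3 * C * N))" "L2 (mon t) \<le> of_int (int (3 * C * N))"
      by (simp_all add: abs_le_iff)
    then show ?thesis unfolding cell_def I_def by (auto simp: le_floor_iff floor_le_iff)
  qed
  have fibre: "card {t \<in> T. cell t = d} \<le> K" for d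
  proof (cases "\<exists>t0 \<in> T. cell t0 = d")
    case False
    then have "{t \<in> T. cell t = d} = {}" by blast
    then show ?thesis by (simp only: card.empty)
  next
    case True
    then obtain t0 where t0: "cell t0 = d" by blast
    \<comment> \<open>Division by one monomial of the cell maps the whole cell injectively into the
      fixed finite set B.\<close>
    obtain v where v: "mon t0 * v = 1" using Umon[of t0] by (auto simp: unimodular_def elim!: dvdE)
    have Uv: "unimodular v" using unimodular_inverse[OF Umon v] .
    have Lv: "L1 v = - L1 (mon t0)" "L2 v = - L2 (mon t0)"
      using L_mult[OF Umon[of t0] Uv] v by (auto simp: L1_def L2_def one)
    have "inj_on (\<lambda>t. mon t * v) {t \<in> T. cell t = d}"
    proof (rule inj_onI)
      fix t t' assume "mon t * v = mon t' * v"
      then have "mon t * (mon t0 * v) = mon t' * (mon t0 * v)" by (metis mult.assoc mult.commute)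
      then show "t = t'" using v inj by (simp add: inj_eq)
    qed
    moreover have "(\<lambda>t. mon t * v) ` {t \<in> T. cell t = d} \<subseteq> B"
    proof clarify
      fix t assume "t \<in> T" and t: "d = cell t"
      have Ur: "unimodular (mon t * v)" using Umon Uv by (rule unimodular_mult)
      have "\<lfloor>L1 (mon t)\<rfloor> = \<lfloor>L1 (mon t0)\<rfloor>" "\<lfloor>L2 (mon t)\<rfloor> = \<lfloor>L2 (mon t0)\<rfloor>"
        using t t0 by (auto simp: cell_def)
      then have "\<bar>L1 (mon t) - L1 (mon t0)\<bar> < 1" "\<bar>L2 (mon t) - L2 (mon t0)\<bar> < 1" by linarith+
      then have L: "\<bar>L1 (mon t * v)\<bar> < 1" "\<bar>L2 (mon t * v)\<bar> < 1"
        using L_mult[OF Umon[of t] Uv] Lv by simp_all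
      define x where "x = mon t * v"
      note nz = unimodular_nonzero[OF Ur, folded x_def]
      have ex: "\<bar>e1 x\<bar> = exp (L1 x)" "\<bar>e2 x\<bar> = exp (L2 x)"
        using nz by (simp_all add: L1_def L2_def)
      \<comment> \<open>The cell controls only the real places; the complex one is bounded by the
        product formula.\<close>
      have "\<bar>e1 x\<bar> * \<bar>e2 x\<bar> * (cmod (e3 x))\<^sup>2 = 1" using Ur by (simp add: unimodular_def x_def)
      then have "exp (L1 x + L2 x) * (cmod (e3 x))\<^sup>2 = 1" unfolding ex by (simp add: exp_add)
      then have "(cmod (e3 x))\<^sup>2 = exp (- (L1 x + L2 x))"
        unfolding exp_minus by (simp add: field_simps)
      also have "\<dots> \<le> exp 2" using L by (simp add: x_def)
      also have "\<dots> = (exp 1)\<^sup>2" by (simp add: power2_eq_square flip: exp_add)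
      finally have "cmod (e3 x) \<le> exp 1" by (rule power2_le_imp_le) simp
      moreover have "\<bar>e1 x\<bar> \<le> exp 1" "\<bar>e2 x\<bar> \<le> exp 1" unfolding ex using L by (simp_all add: x_def)
      ultimately show "mon t * v \<in> B" by (simp add: B_def x_def)
    qed
    ultimately show ?thesis unfolding K_def using finB by (rule card_inj_on_le)
  qed
  have finT: "finite T" by (simp add: T_def)
  have finI: "finite (I \<times> I)" by (simp add: I_def)
  have "T = (\<Union>d \<in> I \<times> I. {t \<in> T. cell t = d})" using cellT by auto
  then have "card T \<le> (\<Sum>d \<in> I \<times> I. card {t \<in> T. cell t = d})"
    using card_UN_le[OF finI, of "\<lambda>d. {t \<in> T. cell t = d}"] by simp
  also have "\<dots> \<le> card (I \<times> I) * K" using sum_bounded_above[of "I \<times> I" "\<lambda>d. card {t \<in> T. cell t = d}" K] fibre by simp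
  also have "\<dots> = (6 * C * N + 1) * (6 * C * N + 1) * K" by (simp add: card_cartesian_product cardI)
  also have "\<dots> \<le> ((6 * C + 1) * N) * ((6 * C + 1) * N) * K"
    using N by (intro mult_mono) (auto simp: algebra_simps)
  also have "\<dots> = (N - 1) * (N * N)" by (simp add: N_def power2_eq_square algebra_simps)
  also have "\<dots> < N * (N * N)" using N by simp
  finally show False using cardT by simp
qed

end

section \<open>Two quartic orders\<close>

text \<open>
  The element OrdA a b c d is a + b t + c t^2 / 6 + d t^3 / 12, where t is a root of
  t^4 + 36 t^2 + 108 t - 72; the multiplication table below is computed in this basis.
\<close>

datatype ordA = OrdA int int int int
instantiation ordA :: comm_ring_1
begin
definition zero_ordA where "0 = OrdA 0 0 0 0"
definition one_ordA where "1 = OrdA 1 0 0 0"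
fun plus_ordA where "OrdA a b c d + OrdA a' b' c' d' = OrdA (a + a') (b + b') (c + c') (d + d')"
fun minus_ordA where "OrdA a b c d - OrdA a' b' c' d' = OrdA (a - a') (b - b') (c - c') (d - d')"
fun uminus_ordA where "- OrdA a b c d = OrdA (- a) (- b) (- c) (- d)"
fun times_ordA where
  "OrdA a b c d * OrdA a' b' c' d' = OrdA
     (a * a' + 6 * (b * d' + d * b') + 2 * c * c' - 18 * d * d')
     (a * b' + b * a' - 9 * (b * d' + d * b') - 3 * c * c' + 1 * (c * d' + d * c') + 27 * d * d')
     (a * c' + c * a' + 6 * b * b' - 18 * (b * d' + d * b') - 6 * c * c' - 9 * (c * d' + d * c') + 57 * d * d')
     (a * d' + d * a' + 2 * (b * c' + c * b') - 6 * (c * d' + d * c') - 9 * d * d')"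
instance
proof
  fix x y z :: ordA
  show "x * y * z = x * (y * z)" by (cases x; cases y; cases z) (simp add: algebra_simps)
  show "x * y = y * x" by (cases x; cases y) (simp add: algebra_simps)
  show "1 * x = x" by (cases x) (simp add: one_ordA_def)
  show "x + y + z = x + (y + z)" by (cases x; cases y; cases z) simp
  show "x + y = y + x" by (cases x; cases y) simp
  show "0 + x = x" by (cases x) (simp add: zero_ordA_def)
  show "- x + x = 0" by (cases x) (simp add: zero_ordA_def)
  show "x - y = x + - y" by (cases x; cases y) simp
  show "(x + y) * z = x * z + y * z" by (cases x; cases y; cases z) (simp add: algebra_simps)
  show "(0 :: ordA) \<noteq> 1" by (simp add: zero_ordA_def one_ordA_def)
qed

end

lemma of_nat_ordA: "(of_nat n :: ordA) = OrdA (int n) 0 0 0"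
  by (induction n) (simp_all add: zero_ordA_def one_ordA_def)

lemma of_int_ordA: "(of_int n :: ordA) = OrdA n 0 0 0"
  by (cases n rule: int_cases2) (simp_all add: of_nat_ordA)

lemma numeral_ordA: "(numeral n :: ordA) = OrdA (numeral n) 0 0 0"
  using of_int_ordA[of "numeral n"] by simp

lemma of_nat_dvd_ordA: "of_nat p dvd OrdA a b c d \<longleftrightarrow> int p dvd a \<and> int p dvd b \<and> int p dvd c \<and> int p dvd d"
proof
  assume "of_nat p dvd OrdA a b c d"
  then obtain y where "OrdA a b c d = OrdA (int p) 0 0 0 * y" by (auto simp: of_nat_ordA elim!: dvdE)
  then show "int p dvd a \<and> int p dvd b \<and> int p dvd c \<and> int p dvd d" by (cases y) simp
next
  assume "int p dvd a \<and> int p dvd b \<and> int p dvd c \<and> int p dvd d"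
  then obtain a' b' c' d' where "a = int p * a'" "b = int p * b'" "c = int p * c'" "d = int p * d'"
    by (auto elim!: dvdE)
  then have "OrdA a b c d = of_nat p * OrdA a' b' c' d'" by (simp add: of_nat_ordA)
  then show "of_nat p dvd OrdA a b c d" by simp
qed

lemma torsion_free_ordA:
  assumes "p > 0" "of_nat p * x = (0 :: ordA)"
  shows "x = 0"
  using assms by (cases x) (simp add: of_nat_ordA zero_ordA_def)

fun evA :: "'b :: field_char_0 \<Rightarrow> ordA \<Rightarrow> 'b" where
  "evA r (OrdA a b c d) = of_int a + of_int b * r + of_int c * (r\<^sup>2 / 6) + of_int d * (r ^ 3 / 12)"

lemma evA_one: "evA r 1 = 1"
  by (simp add: one_ordA_def)

text \<open>This justifies the multiplication table: each product of two basis elements, cleared of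
  denominators, is a consequence of the quartic equation for r.\<close>

lemma evA_mult:
  fixes r :: "'b :: field_char_0"
  assumes r: "r ^ 4 + 36 * r\<^sup>2 + 108 * r - 72 = 0"
  shows "evA r (x * y) = evA r x * evA r y"
proof -
  define w v where "w = r\<^sup>2 / 6" and "v = r ^ 3 / 12"
  have wv: "6 * w = r\<^sup>2" "12 * v = r ^ 3" by (simp_all add: w_def v_def)
  have t11: "r * r = 6 * w" unfolding wv by (simp add: power2_eq_square)
  have "6 * (r * w) = 6 * (2 * v)" using wv r by Groebner_Basis.algebra
  then have t12: "r * w = 2 * v" unfolding mult_cancel_left by simp
  have "12 * (r * v) = 12 * (6 - 9 * r - 18 * w)" using wv r by Groebner_Basis.algebra
  then have t13: "r * v = 6 - 9 * r - 18 * w" unfolding mult_cancel_left by simp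
  have "36 * (w * w) = 36 * (2 - 3 * r - 6 * w)" using wv r by Groebner_Basis.algebra
  then have t22: "w * w = 2 - 3 * r - 6 * w" unfolding mult_cancel_left by simp
  have "72 * (w * v) = 72 * (1 * r - 9 * w - 6 * v)" using wv r by Groebner_Basis.algebra
  then have t23: "w * v = 1 * r - 9 * w - 6 * v" unfolding mult_cancel_left by simp
  have "144 * (v * v) = 144 * (- 18 + 27 * r + 57 * w - 9 * v)" using wv r by Groebner_Basis.algebra
  then have t33: "v * v = - 18 + 27 * r + 57 * w - 9 * v" unfolding mult_cancel_left by simp
  obtain a b c d a' b' c' d' where xy: "x = OrdA a b c d" "y = OrdA a' b' c' d'"
    by (cases x; cases y) auto
  define A B C D A' B' C' D' :: 'b where ABCD: "A = of_int a" "B = of_int b" "C = of_int c" "D = of_int d"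
    "A' = of_int a'" "B' = of_int b'" "C' = of_int c'" "D' = of_int d'"
  have "evA r x * evA r y = (A + B * r + C * w + D * v) * (A' + B' * r + C' * w + D' * v)"
    by (simp add: xy ABCD w_def v_def)
  also have "\<dots> = A * A' + (A * B' + B * A') * r + (A * C' + C * A') * w + (A * D' + D * A') * v
      + B * B' * (r * r) + (B * C' + C * B') * (r * w) + (B * D' + D * B') * (r * v)
      + C * C' * (w * w) + (C * D' + D * C') * (w * v) + D * D' * (v * v)"
    by (simp add: algebra_simps)
  also have "\<dots> = evA r (x * y)"
    unfolding t11 t12 t13 t22 t23 t33 xy times_ordA.simps evA.simps w_def[symmetric] v_def[symmetric] ABCD
    by (simp add: algebra_simps)
  finally show ?thesis by simp
qed

text \<open>
  The element OrdB a b c d is a + b t + c (t^2 + 3) / 6 + d (t^3 - 3 t^2 + 3 t + 3) / 12, where t is a root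
  of t^4 - 54 t^2 + 252 t - 207.
\<close>

datatype ordB = OrdB int int int int
instantiation ordB :: comm_ring_1
begin
definition zero_ordB where "0 = OrdB 0 0 0 0"
definition one_ordB where "1 = OrdB 1 0 0 0"
fun plus_ordB where "OrdB a b c d + OrdB a' b' c' d' = OrdB (a + a') (b + b') (c + c') (d + d')"
fun minus_ordB where "OrdB a b c d - OrdB a' b' c' d' = OrdB (a - a') (b - b') (c - c') (d - d')"
fun uminus_ordB where "- OrdB a b c d = OrdB (- a) (- b) (- c) (- d)"
fun times_ordB where
  "OrdB a b c d * OrdB a' b' c' d' = OrdB
     (a * a' - 3 * b * b' - 2 * (b * c' + c * b') + 6 * (b * d' + d * b') + 1 * c * c' - 1 * (c * d' + d * c') + 35 * d * d')
     (a * b' + b * a' - 20 * (b * d' + d * b') - 7 * c * c' + 11 * (c * d' + d * c') - 117 * d * d')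
     (a * c' + c * a' + 6 * b * b' + 3 * (b * c' + c * b') + 24 * (b * d' + d * b') + 10 * c * c' - 20 * (c * d' + d * c') + 153 * d * d')
     (a * d' + d * a' + 2 * (b * c' + c * b') - 3 * (b * d' + d * b') + 10 * (c * d' + d * c') - 49 * d * d')"
instance
proof
  fix x y z :: ordB
  show "x * y * z = x * (y * z)" by (cases x; cases y; cases z) (simp add: algebra_simps)
  show "x * y = y * x" by (cases x; cases y) (simp add: algebra_simps)
  show "1 * x = x" by (cases x) (simp add: one_ordB_def)
  show "x + y + z = x + (y + z)" by (cases x; cases y; cases z) simp
  show "x + y = y + x" by (cases x; cases y) simp
  show "0 + x = x" by (cases x) (simp add: zero_ordB_def)
  show "- x + x = 0" by (cases x) (simp add: zero_ordB_def)
  show "x - y = x + - y" by (cases x; cases y) simp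
  show "(x + y) * z = x * z + y * z" by (cases x; cases y; cases z) (simp add: algebra_simps)
  show "(0 :: ordB) \<noteq> 1" by (simp add: zero_ordB_def one_ordB_def)
qed

end

lemma of_nat_ordB: "(of_nat n :: ordB) = OrdB (int n) 0 0 0"
  by (induction n) (simp_all add: zero_ordB_def one_ordB_def)

lemma of_int_ordB: "(of_int n :: ordB) = OrdB n 0 0 0"
  by (cases n rule: int_cases2) (simp_all add: of_nat_ordB)

lemma numeral_ordB: "(numeral n :: ordB) = OrdB (numeral n) 0 0 0"
  using of_int_ordB[of "numeral n"] by simp

lemma of_nat_dvd_ordB: "of_nat p dvd OrdB a b c d \<longleftrightarrow> int p dvd a \<and> int p dvd b \<and> int p dvd c \<and> int p dvd d"
proof
  assume "of_nat p dvd OrdB a b c d"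
  then obtain y where "OrdB a b c d = OrdB (int p) 0 0 0 * y" by (auto simp: of_nat_ordB elim!: dvdE)
  then show "int p dvd a \<and> int p dvd b \<and> int p dvd c \<and> int p dvd d" by (cases y) simp
next
  assume "int p dvd a \<and> int p dvd b \<and> int p dvd c \<and> int p dvd d"
  then obtain a' b' c' d' where "a = int p * a'" "b = int p * b'" "c = int p * c'" "d = int p * d'"
    by (auto elim!: dvdE)
  then have "OrdB a b c d = of_nat p * OrdB a' b' c' d'" by (simp add: of_nat_ordB)
  then show "of_nat p dvd OrdB a b c d" by simp
qed

lemma torsion_free_ordB:
  assumes "p > 0" "of_nat p * x = (0 :: ordB)"
  shows "x = 0"
  using assms by (cases x) (simp add: of_nat_ordB zero_ordB_def)

fun evB :: "'b :: field_char_0 \<Rightarrow> ordB \<Rightarrow> 'b" where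
  "evB r (OrdB a b c d) = of_int a + of_int b * r + of_int c * ((r\<^sup>2 + 3) / 6) + of_int d * ((r ^ 3 - 3 * r\<^sup>2 + 3 * r + 3) / 12)"

lemma evB_one: "evB r 1 = 1"
  by (simp add: one_ordB_def)

lemma evB_mult:
  fixes r :: "'b :: field_char_0"
  assumes r: "r ^ 4 - 54 * r\<^sup>2 + 252 * r - 207 = 0"
  shows "evB r (x * y) = evB r x * evB r y"
proof -
  define w v where "w = (r\<^sup>2 + 3) / 6" and "v = (r ^ 3 - 3 * r\<^sup>2 + 3 * r + 3) / 12"
  have wv: "6 * w = r\<^sup>2 + 3" "12 * v = r ^ 3 - 3 * r\<^sup>2 + 3 * r + 3" by (simp_all add: w_def v_def)
  have t11: "r * r = - 3 + 6 * w" unfolding wv by (simp add: power2_eq_square)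
  have "6 * (r * w) = 6 * (- 2 + 3 * w + 2 * v)" using wv r by Groebner_Basis.algebra
  then have t12: "r * w = - 2 + 3 * w + 2 * v" unfolding mult_cancel_left by simp
  have "12 * (r * v) = 12 * (6 - 20 * r + 24 * w - 3 * v)" using wv r by Groebner_Basis.algebra
  then have t13: "r * v = 6 - 20 * r + 24 * w - 3 * v" unfolding mult_cancel_left by simp
  have "36 * (w * w) = 36 * (1 - 7 * r + 10 * w)" using wv r by Groebner_Basis.algebra
  then have t22: "w * w = 1 - 7 * r + 10 * w" unfolding mult_cancel_left by simp
  have "72 * (w * v) = 72 * (- 1 + 11 * r - 20 * w + 10 * v)" using wv r by Groebner_Basis.algebra
  then have t23: "w * v = - 1 + 11 * r - 20 * w + 10 * v" unfolding mult_cancel_left by simp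
  have "144 * (v * v) = 144 * (35 - 117 * r + 153 * w - 49 * v)" using wv r by Groebner_Basis.algebra
  then have t33: "v * v = 35 - 117 * r + 153 * w - 49 * v" unfolding mult_cancel_left by simp
  obtain a b c d a' b' c' d' where xy: "x = OrdB a b c d" "y = OrdB a' b' c' d'"
    by (cases x; cases y) auto
  define A B C D A' B' C' D' :: 'b where ABCD: "A = of_int a" "B = of_int b" "C = of_int c" "D = of_int d"
    "A' = of_int a'" "B' = of_int b'" "C' = of_int c'" "D' = of_int d'"
  have "evB r x * evB r y = (A + B * r + C * w + D * v) * (A' + B' * r + C' * w + D' * v)"
    by (simp add: xy ABCD w_def v_def)
  also have "\<dots> = A * A' + (A * B' + B * A') * r + (A * C' + C * A') * w + (A * D' + D * A') * v
      + B * B' * (r * r) + (B * C' + C * B') * (r * w) + (B * D' + D * B') * (r * v)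
      + C * C' * (w * w) + (C * D' + D * C') * (w * v) + D * D' * (v * v)"
    by (simp add: algebra_simps)
  also have "\<dots> = evB r (x * y)"
    unfolding t11 t12 t13 t22 t23 t33 xy times_ordB.simps evB.simps w_def[symmetric] v_def[symmetric] ABCD
    by (simp add: algebra_simps)
  finally show ?thesis by simp
qed

text \<open>The form in which Skolem's method is applied. The level s of \<open>u3\<close> is
  unknown, so \<open>v1\<close> and \<open>v2\<close>, of fixed level t, are raised to the power
  p^(s - t); this brings them to level s and preserves their leading terms modulo p. The
  \<open>g1\<close>, \<open>g2\<close>, \<open>g3\<close> are simple representatives of these
  leading terms.\<close>

theorem (in quartic_embeddings) no_third_unit:
  assumes U: "unimodular v1" "unimodular v2" "unimodular u3"
    and p: "prime p" and s: "t \<ge> 1" "p = 2 \<Longrightarrow> t \<ge> 2" "s \<ge> t"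
    and tf: "\<And>x :: 'a. of_nat p * x = 0 \<Longrightarrow> x = 0"
    and v: "v1 = 1 + of_nat (p ^ t) * l1" "v2 = 1 + of_nat (p ^ t) * l2" "u3 = 1 + of_nat (p ^ s) * l3"
    and lead: "of_nat p dvd l1 - g1" "of_nat p dvd l2 - g2" "of_nat p dvd l3 - g3"
    and indep: "\<And>a b c. of_nat p dvd of_int a * g1 + of_int b * g2 + of_int c * g3
                  \<Longrightarrow> int p dvd a \<and> int p dvd b \<and> int p dvd c"
  shows False
proof -
  define k where "k = s - t"
  have sk: "s = t + k" using s by (simp add: k_def)
  obtain j1 where j1: "v1 ^ (p ^ k) = 1 + of_nat (p ^ s) * j1" "of_nat p dvd j1 - l1"
    using prime_power_lift[OF p s(1,2)] v(1) sk by metis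
  obtain j2 where j2: "v2 ^ (p ^ k) = 1 + of_nat (p ^ s) * j2" "of_nat p dvd j2 - l2"
    using prime_power_lift[OF p s(1,2)] v(2) sk by metis
  define u1 u2 where "u1 = v1 ^ (p ^ k)" and "u2 = v2 ^ (p ^ k)"
  have U12: "unimodular u1" "unimodular u2" using U by (auto simp: u1_def u2_def intro: unimodular_power)
  obtain w1 w2 w3 where w: "u1 * w1 = 1" "u2 * w2 = 1" "u3 * w3 = 1"
    using U12 U(3) unfolding unimodular_def by (metis dvdE)
  obtain a1 b1 c1 a2 b2 c2 where rel: "u1 ^ a1 * u2 ^ b1 * u3 ^ c1 = u1 ^ a2 * u2 ^ b2 * u3 ^ c2"
    and ne: "\<not> (a1 = a2 \<and> b1 = b2 \<and> c1 = (c2 :: nat))"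
    using three_units_dependent[OF U12 U(3)] by blast
  have s': "s \<ge> 1" "p = 2 \<Longrightarrow> s \<ge> 2" using s by linarith+
  have "a1 = a2 \<and> b1 = b2 \<and> c1 = c2"
  proof (rule multiplicatively_independent[OF p s' tf j1(1)[folded u1_def] j2(1)[folded u2_def] v(3) w])
    fix a b c
    assume d: "of_nat p dvd of_int a * j1 + of_int b * j2 + of_int c * l3"
    have "of_nat p dvd of_int a * ((j1 - l1) + (l1 - g1)) + of_int b * ((j2 - l2) + (l2 - g2)) + of_int c * (l3 - g3)"
      using j1(2) j2(2) lead by (intro dvd_add dvd_mult)
    with d have "of_nat p dvd (of_int a * j1 + of_int b * j2 + of_int c * l3)
        - (of_int a * ((j1 - l1) + (l1 - g1)) + of_int b * ((j2 - l2) + (l2 - g2)) + of_int c * (l3 - g3))"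
      by (rule dvd_diff)
    moreover have "(of_int a * j1 + of_int b * j2 + of_int c * l3)
        - (of_int a * ((j1 - l1) + (l1 - g1)) + of_int b * ((j2 - l2) + (l2 - g2)) + of_int c * (l3 - g3))
        = of_int a * g1 + of_int b * g2 + of_int c * g3" by (simp add: algebra_simps)
    ultimately show "int p dvd a \<and> int p dvd b \<and> int p dvd c" using indep by simp
  qed (use rel in simp_all)
  then show False using ne by simp
qed

section \<open>Interpolation bounds, complex roots and products of conjugates\<close>

lemma cmod_le_of_mult:
  assumes "x * t = y" "cmod y \<le> M" "cmod t \<ge> \<delta>" "\<delta> > 0"
  shows "cmod x \<le> M / \<delta>"
proof -
  have "cmod x * \<delta> \<le> cmod x * cmod t" using assms by (intro mult_left_mono) auto
  also have "\<dots> = cmod y" using assms(1) by (simp flip: norm_mult)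
  finally show ?thesis using assms by (simp add: pos_le_divide_eq)
qed

text \<open>Newton interpolation at the nodes r1, r2, z and the conjugate of z, where the last bound
  follows since the coefficients are real. In the proof S and E are first and second divided
  differences and A3 is the third; each step divides by a distance of nodes, which is at least
  \<delta>. The other coefficients follow backwards.\<close>

lemma cubic_coeffs_bounded:
  fixes r1 r2 :: real and z :: complex
  assumes "r1 \<noteq> r2" "Im z \<noteq> 0"
  obtains K where "K \<ge> 0" "\<And>A0 A1 A2 A3 R :: real. \<bar>A0 + A1 * r1 + A2 * r1\<^sup>2 + A3 * r1 ^ 3\<bar> \<le> R \<Longrightarrow>
      \<bar>A0 + A1 * r2 + A2 * r2\<^sup>2 + A3 * r2 ^ 3\<bar> \<le> R \<Longrightarrow>
      cmod (of_real A0 + of_real A1 * z + of_real A2 * z\<^sup>2 + of_real A3 * z ^ 3) \<le> R \<Longrightarrow>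
      \<bar>A0\<bar> \<le> K * R \<and> \<bar>A1\<bar> \<le> K * R \<and> \<bar>A2\<bar> \<le> K * R \<and> \<bar>A3\<bar> \<le> K * R"
proof -
  define t0 t1 t2 t3 where t: "t0 = complex_of_real r1" "t1 = complex_of_real r2" "t2 = z" "t3 = cnj z"
  have ne: "t0 \<noteq> t1" "t1 \<noteq> t2" "t2 \<noteq> t3" "t0 \<noteq> t2" "t1 \<noteq> t3" "t0 \<noteq> t3"
    using assms by (auto simp: t complex_eq_iff)
  define \<delta> where "\<delta> = Min {cmod (t0 - t1), cmod (t1 - t2), cmod (t2 - t3), cmod (t0 - t2), cmod (t1 - t3), cmod (t0 - t3)}"
  have \<delta>0: "\<delta> > 0" using ne by (simp add: \<delta>_def)
  have \<delta>: "cmod (t0 - t1) \<ge> \<delta>" "cmod (t1 - t2) \<ge> \<delta>" "cmod (t2 - t3) \<ge> \<delta>" "cmod (t0 - t2) \<ge> \<delta>"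
    "cmod (t1 - t3) \<ge> \<delta>" "cmod (t0 - t3) \<ge> \<delta>" by (auto simp: \<delta>_def)
  define T where "T = cmod t0 + cmod t1 + cmod t2"
  have T0: "T \<ge> 0" "cmod t0 \<le> T" "cmod t1 \<le> T" "cmod (t0 + t1 + t2) \<le> T" "cmod (t0 + t1) \<le> T"
    using norm_triangle_ineq[of t0 t1] norm_triangle_ineq[of "t0 + t1" t2]
    by (auto simp: T_def intro: order_trans add_nonneg_nonneg)
  define K3 where "K3 = 8 / \<delta> ^ 3"
  define K2 where "K2 = 4 / \<delta>\<^sup>2 + K3 * T"
  define K1 where "K1 = 2 / \<delta> + K2 * T + K3 * (3 * T\<^sup>2)"
  define K0 where "K0 = 1 + K1 * T + K2 * T\<^sup>2 + K3 * T ^ 3"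
  have K_nonneg: "K3 \<ge> 0" "K2 \<ge> 0" "K1 \<ge> 0" "K0 \<ge> 0"
    using \<delta>0 T0 by (simp_all add: K3_def K2_def K1_def K0_def)
  have "\<bar>A0\<bar> \<le> K0 * R \<and> \<bar>A1\<bar> \<le> K1 * R \<and> \<bar>A2\<bar> \<le> K2 * R \<and> \<bar>A3\<bar> \<le> K3 * R"
    if b: "\<bar>A0 + A1 * r1 + A2 * r1\<^sup>2 + A3 * r1 ^ 3\<bar> \<le> R" "\<bar>A0 + A1 * r2 + A2 * r2\<^sup>2 + A3 * r2 ^ 3\<bar> \<le> R"
      "cmod (of_real A0 + of_real A1 * z + of_real A2 * z\<^sup>2 + of_real A3 * z ^ 3) \<le> R" for A0 A1 A2 A3 R :: real
  proof -
    define f where "f x = complex_of_real A0 + of_real A1 * x + of_real A2 * x\<^sup>2 + of_real A3 * x ^ 3" for x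
    have "f t0 = of_real (A0 + A1 * r1 + A2 * r1\<^sup>2 + A3 * r1 ^ 3)" "f t1 = of_real (A0 + A1 * r2 + A2 * r2\<^sup>2 + A3 * r2 ^ 3)"
      by (simp_all add: f_def t)
    then have f01: "cmod (f t0) \<le> R" "cmod (f t1) \<le> R" using b by (simp_all only: norm_of_real)
    have f2: "cmod (f t2) \<le> R" using b by (simp add: f_def t)
    have "f t3 = cnj (f t2)" by (simp add: f_def t)
    then have f3: "cmod (f t3) \<le> R" using f2 by simp
    have R0: "R \<ge> 0" using f2 norm_ge_zero order_trans by blast
    define S where "S x y = of_real A1 + of_real A2 * (x + y) + of_real A3 * (x\<^sup>2 + x * y + y\<^sup>2)" for x y :: complex
    have S: "S x y * (x - y) = f x - f y" for x y
      by (simp add: S_def f_def algebra_simps power2_eq_square power3_eq_cube)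
    have diff: "cmod (x - y) \<le> a + b" if "cmod x \<le> a" "cmod y \<le> b" for x y :: complex and a b
      using norm_triangle_ineq4[of x y] that by linarith
    have Sb: "cmod (S t0 t1) \<le> (R + R) / \<delta>" "cmod (S t1 t2) \<le> (R + R) / \<delta>" "cmod (S t2 t3) \<le> (R + R) / \<delta>"
      using cmod_le_of_mult[OF S diff] f01 f2 f3 \<delta> \<delta>0 by blast+
    define E where "E x y w = of_real A2 + of_real A3 * (x + y + w)" for x y w :: complex
    have E: "E x y w * (x - w) = S x y - S y w" for x y w
      by (simp add: E_def S_def algebra_simps power2_eq_square)
    have Eb: "cmod (E t0 t1 t2) \<le> ((R + R) / \<delta> + (R + R) / \<delta>) / \<delta>" "cmod (E t1 t2 t3) \<le> ((R + R) / \<delta> + (R + R) / \<delta>) / \<delta>"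
      using cmod_le_of_mult[OF E diff] Sb \<delta> \<delta>0 by blast+
    have "of_real A3 * (t0 - t3) = E t0 t1 t2 - E t1 t2 t3" by (simp add: E_def algebra_simps)
    then have "cmod (of_real A3) \<le> (((R + R) / \<delta> + (R + R) / \<delta>) / \<delta> + ((R + R) / \<delta> + (R + R) / \<delta>) / \<delta>) / \<delta>"
      using cmod_le_of_mult diff[OF Eb] \<delta> \<delta>0 by blast
    then have A3: "\<bar>A3\<bar> \<le> K3 * R" using \<delta>0 by (simp add: K3_def field_simps power3_eq_cube)
    have tri: "cmod (x - y * w) \<le> a + b * c" if "cmod x \<le> a" "cmod y \<le> b" "cmod w \<le> c" for x y w :: complex and a b c
    proof -
      have "cmod (y * w) \<le> b * c" unfolding norm_mult using that norm_ge_zero order_trans by (intro mult_mono) blast+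
      then show ?thesis using norm_triangle_ineq4[of x "y * w"] that by linarith
    qed
    have cA3: "cmod (of_real A3) \<le> K3 * R" using A3 by simp
    have "of_real A2 = E t0 t1 t2 - of_real A3 * (t0 + t1 + t2)" by (simp add: E_def)
    then have "cmod (of_real A2) \<le> ((R + R) / \<delta> + (R + R) / \<delta>) / \<delta> + K3 * R * T"
      using tri[OF Eb(1) cA3 T0(4)] by simp
    also have "\<dots> = K2 * R" using \<delta>0 by (simp add: K2_def field_simps power2_eq_square)
    finally have cA2: "cmod (of_real A2) \<le> K2 * R" .
    have sq: "cmod (t0\<^sup>2 + t0 * t1 + t1\<^sup>2) \<le> 3 * T\<^sup>2"
    proof -
      have "cmod (t0\<^sup>2) \<le> T\<^sup>2" "cmod (t1\<^sup>2) \<le> T\<^sup>2" "cmod (t0 * t1) \<le> T\<^sup>2"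
        using T0 by (auto simp: norm_power norm_mult power2_eq_square intro!: mult_mono)
      then show ?thesis using norm_triangle_ineq[of "t0\<^sup>2 + t0 * t1" "t1\<^sup>2"] norm_triangle_ineq[of "t0\<^sup>2" "t0 * t1"] by linarith
    qed
    have "of_real A1 = (S t0 t1 - of_real A2 * (t0 + t1)) - of_real A3 * (t0\<^sup>2 + t0 * t1 + t1\<^sup>2)" by (simp add: S_def)
    then have "cmod (of_real A1) \<le> (R + R) / \<delta> + K2 * R * T + K3 * R * (3 * T\<^sup>2)"
      using tri[OF tri[OF Sb(1) cA2 T0(5)] cA3 sq] by simp
    also have "\<dots> = K1 * R" using \<delta>0 by (simp add: K1_def field_simps)
    finally have cA1: "cmod (of_real A1) \<le> K1 * R" .
    have p2: "cmod (t0\<^sup>2) \<le> T\<^sup>2" "cmod (t0 ^ 3) \<le> T ^ 3"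
      using T0 by (auto simp: norm_power intro!: power_mono)
    have "of_real A0 = ((f t0 - of_real A1 * t0) - of_real A2 * t0\<^sup>2) - of_real A3 * t0 ^ 3" by (simp add: f_def)
    then have "cmod (of_real A0) \<le> R + K1 * R * T + K2 * R * T\<^sup>2 + K3 * R * T ^ 3"
      using tri[OF tri[OF tri[OF f01(1) cA1 T0(2)] cA2 p2(1)] cA3 p2(2)] by simp
    also have "\<dots> = K0 * R" by (simp add: K0_def algebra_simps)
    finally have cA0: "cmod (of_real A0) \<le> K0 * R" .
    show ?thesis using cA0 cA1 cA2 A3 by simp
  qed
  note key = this
  define K where "K = K0 + K1 + K2 + K3"
  show thesis
  proof (rule that[of K])
    show "K \<ge> 0" using K_nonneg by (simp add: K_def)
    fix A0 A1 A2 A3 R :: real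
    assume b: "\<bar>A0 + A1 * r1 + A2 * r1\<^sup>2 + A3 * r1 ^ 3\<bar> \<le> R" "\<bar>A0 + A1 * r2 + A2 * r2\<^sup>2 + A3 * r2 ^ 3\<bar> \<le> R"
      "cmod (of_real A0 + of_real A1 * z + of_real A2 * z\<^sup>2 + of_real A3 * z ^ 3) \<le> R"
    have "R \<ge> 0" using b(1) by linarith
    then have "K0 * R \<le> K * R" "K1 * R \<le> K * R" "K2 * R \<le> K * R" "K3 * R \<le> K * R"
      using K_nonneg by (auto simp: K_def intro!: mult_right_mono)
    then show "\<bar>A0\<bar> \<le> K * R \<and> \<bar>A1\<bar> \<le> K * R \<and> \<bar>A2\<bar> \<le> K * R \<and> \<bar>A3\<bar> \<le> K * R"
      using key[OF b] by linarith
  qed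
qed

text \<open>Dividing by the quadratic with roots r1 and r2 leaves a linear remainder with two
  distinct zeros, hence zero. As there is no cubic term, the cofactor is x^2 + s x + P, and
  \<open>disc\<close> says that its discriminant is negative. The last claim is the norm of m - k t,
  read off from the factorisation.\<close>

lemma quartic_complex_root:
  fixes c0 c1 c2 r1 r2 :: real
  assumes "r1 \<noteq> r2" and g: "r1 ^ 4 + c2 * r1\<^sup>2 + c1 * r1 + c0 = 0" "r2 ^ 4 + c2 * r2\<^sup>2 + c1 * r2 + c0 = 0"
    and disc: "(r1 + r2)\<^sup>2 < 4 * (c2 + (r1 + r2)\<^sup>2 - r1 * r2)"
  obtains z where "Im z \<noteq> 0" "z ^ 4 + of_real c2 * z\<^sup>2 + of_real c1 * z + of_real c0 = 0"
    "\<And>m k :: real. (m - k * r1) * (m - k * r2) * (cmod (of_real m - of_real k * z))\<^sup>2 = m ^ 4 + c2 * m\<^sup>2 * k\<^sup>2 + c1 * m * k ^ 3 + c0 * k ^ 4"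
proof -
  define s q P where "s = r1 + r2" and "q = r1 * r2" and "P = c2 + s\<^sup>2 - q"
  have c2: "c2 = P + q - s\<^sup>2" by (simp add: P_def)
  have lin: "(c1 - s * (q - P)) * r + (c0 - q * P) = 0" if r: "r = r1 \<or> r = r2" for r
  proof -
    have "r\<^sup>2 - s * r + q = 0" using r by (auto simp: s_def q_def power2_eq_square algebra_simps)
    moreover have "r ^ 4 + c2 * r\<^sup>2 + c1 * r + c0 = (r\<^sup>2 - s * r + q) * (r\<^sup>2 + s * r + P) + ((c1 - s * (q - P)) * r + (c0 - q * P))"
      by (simp add: c2 algebra_simps power2_eq_square power4_eq_xxxx)
    ultimately show ?thesis using g r by auto
  qed
  have "(c1 - s * (q - P)) * (r1 - r2) = 0" using lin[of r1] lin[of r2] by (simp add: algebra_simps)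
  then have c1: "c1 = s * (q - P)" using assms(1) by simp
  then have c0: "c0 = q * P" using lin[of r1] by simp
  have pos: "P - s\<^sup>2 / 4 > 0" using disc by (simp add: P_def s_def q_def)
  define z where "z = Complex (- s / 2) (sqrt (P - s\<^sup>2 / 4))"
  have zz: "z\<^sup>2 + of_real s * z + of_real P = 0"
    using pos by (simp add: z_def complex_eq_iff power2_eq_square field_simps)
  show thesis
  proof (rule that[of z])
    show "Im z \<noteq> 0" using pos by (simp add: z_def)
    have "z ^ 4 + of_real c2 * z\<^sup>2 + of_real c1 * z + of_real c0 = (z\<^sup>2 - of_real s * z + of_real q) * (z\<^sup>2 + of_real s * z + of_real P)"
      unfolding c0 c1 c2 by (simp add: algebra_simps power2_eq_square power4_eq_xxxx)
    then show "z ^ 4 + of_real c2 * z\<^sup>2 + of_real c1 * z + of_real c0 = 0" using zz by simp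
    fix m k :: real
    have "(cmod (of_real m - of_real k * z))\<^sup>2 = (m + k * s / 2)\<^sup>2 + k\<^sup>2 * (P - s\<^sup>2 / 4)"
      using pos by (simp add: cmod_power2 z_def power_mult_distrib)
    also have "\<dots> = m\<^sup>2 + s * m * k + P * k\<^sup>2" by (simp add: power2_eq_square field_simps)
    finally have "(cmod (of_real m - of_real k * z))\<^sup>2 = m\<^sup>2 + s * m * k + P * k\<^sup>2" .
    then show "(m - k * r1) * (m - k * r2) * (cmod (of_real m - of_real k * z))\<^sup>2 = m ^ 4 + c2 * m\<^sup>2 * k\<^sup>2 + c1 * m * k ^ 3 + c0 * k ^ 4"
      unfolding c0 c1 c2 by (simp add: s_def q_def algebra_simps power2_eq_square power3_eq_cube power4_eq_xxxx)
  qed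
qed

text \<open>Vieta's formula by divided differences: S and E vanish on distinct roots, which
  determines c, b and a in terms of the roots, and then d.\<close>

lemma quartic_roots_product:
  fixes x1 x2 x3 x4 a b c d :: complex
  assumes ne: "x1 \<noteq> x2" "x1 \<noteq> x3" "x1 \<noteq> x4" "x2 \<noteq> x3" "x2 \<noteq> x4" "x3 \<noteq> x4"
    and r: "\<And>x. x \<in> {x1, x2, x3, x4} \<Longrightarrow> x ^ 4 + a * x ^ 3 + b * x\<^sup>2 + c * x + d = 0"
  shows "x1 * x2 * x3 * x4 = d"
proof -
  define S where "S x y = x ^ 3 + x\<^sup>2 * y + x * y\<^sup>2 + y ^ 3 + a * (x\<^sup>2 + x * y + y\<^sup>2) + b * (x + y) + c" for x y :: complex
  have S: "S x y = 0" if "x \<in> {x1, x2, x3, x4}" "y \<in> {x1, x2, x3, x4}" "x \<noteq> y" for x y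
  proof -
    have "(x - y) * S x y = (x ^ 4 + a * x ^ 3 + b * x\<^sup>2 + c * x + d) - (y ^ 4 + a * y ^ 3 + b * y\<^sup>2 + c * y + d)"
      by (simp add: S_def algebra_simps power2_eq_square power3_eq_cube power4_eq_xxxx)
    then have "(x - y) * S x y = 0" unfolding r[OF that(1)] r[OF that(2)] by simp
    then show ?thesis using that(3) by simp
  qed
  define E where "E x y z = x\<^sup>2 + y\<^sup>2 + z\<^sup>2 + x * y + y * z + x * z + a * (x + y + z) + b" for x y z :: complex
  have E: "E x y z = 0" if "x \<in> {x1, x2, x3, x4}" "y \<in> {x1, x2, x3, x4}" "z \<in> {x1, x2, x3, x4}" "x \<noteq> y" "y \<noteq> z" "x \<noteq> z" for x y z
  proof -
    have "(x - z) * E x y z = S x y - S y z"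
      by (simp add: S_def E_def algebra_simps power2_eq_square power3_eq_cube)
    then show ?thesis using S that by simp
  qed
  have "(x1 - x4) * (x1 + x2 + x3 + x4 + a) = E x1 x2 x3 - E x2 x3 x4"
    by (simp add: E_def algebra_simps power2_eq_square)
  then have a: "a = - (x1 + x2 + x3 + x4)" using E ne by (simp add: add_eq_0_iff)
  have b: "b = E x1 x2 x3 - (x1\<^sup>2 + x2\<^sup>2 + x3\<^sup>2 + x1 * x2 + x2 * x3 + x1 * x3 + a * (x1 + x2 + x3))" by (simp add: E_def)
  have c: "c = S x1 x2 - (x1 ^ 3 + x1\<^sup>2 * x2 + x1 * x2\<^sup>2 + x2 ^ 3 + a * (x1\<^sup>2 + x1 * x2 + x2\<^sup>2) + b * (x1 + x2))" by (simp add: S_def)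
  have d: "d = (x1 ^ 4 + a * x1 ^ 3 + b * x1\<^sup>2 + c * x1 + d) - (x1 ^ 4 + a * x1 ^ 3 + b * x1\<^sup>2 + c * x1)" by simp
  have E0: "E x1 x2 x3 = 0" "S x1 x2 = 0" "x1 ^ 4 + a * x1 ^ 3 + b * x1\<^sup>2 + c * x1 + d = 0"
    using E S r ne by auto
  have b': "b = - (x1\<^sup>2 + x2\<^sup>2 + x3\<^sup>2 + x1 * x2 + x2 * x3 + x1 * x3 + a * (x1 + x2 + x3))" using b E0 by simp
  have c': "c = - (x1 ^ 3 + x1\<^sup>2 * x2 + x1 * x2\<^sup>2 + x2 ^ 3 + a * (x1\<^sup>2 + x1 * x2 + x2\<^sup>2) + b * (x1 + x2))" using c E0 by simp
  have d': "d = - (x1 ^ 4 + a * x1 ^ 3 + b * x1\<^sup>2 + c * x1)" using d E0 by simp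
  show ?thesis unfolding d' c' b' a by (simp add: algebra_simps power2_eq_square power3_eq_cube power4_eq_xxxx)
qed

section \<open>Places and explicit units of the first order\<close>

lemma evA_add: "evA r (x + y) = evA r x + evA r y"
  by (cases x; cases y) (simp add: field_simps)

lemma evA_of_int: "evA r (of_int n) = of_int n"
  by (simp add: of_int_ordA)

lemma evA_of_real: "evA (complex_of_real r) x = of_real (evA r x)"
  by (cases x) simp

lemma evA_cnj: "evA (cnj z) x = cnj (evA z x)"
  by (cases x) simp

lemma evA_power:
  fixes r :: "'b :: field_char_0"
  assumes "r ^ 4 + 36 * r\<^sup>2 + 108 * r - 72 = 0"
  shows "evA r (x ^ n) = evA r x ^ n"
  by (induction n) (simp_all add: evA_one evA_mult[OF assms])

text \<open>The field \<open>norm_linear\<close> records the one consequence of the real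
  factorisation that is used later, so that the construction of the roots can be forgotten.\<close>

locale ringA =
  fixes r1 r2 :: real and z :: complex
  assumes ne: "r1 \<noteq> r2" "Im z \<noteq> 0"
    and roots: "r1 ^ 4 + 36 * r1\<^sup>2 + 108 * r1 - 72 = 0" "r2 ^ 4 + 36 * r2\<^sup>2 + 108 * r2 - 72 = 0" "z ^ 4 + 36 * z\<^sup>2 + 108 * z - 72 = 0"
    and norm_linear: "(m - k * r1) * (m - k * r2) * (cmod (of_real m - of_real k * z))\<^sup>2
          = m ^ 4 + 36 * m\<^sup>2 * k\<^sup>2 + 108 * m * k ^ 3 + (-72) * k ^ 4"
begin

sublocale quartic_embeddings "evA r1" "evA r2" "evA z"
proof
  show "finite {x. \<bar>evA r1 x\<bar> \<le> R \<and> \<bar>evA r2 x\<bar> \<le> R \<and> cmod (evA z x) \<le> R}" for R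
  proof -
    obtain K where K: "K \<ge> 0" "\<And>A0 A1 A2 A3 R :: real. \<bar>A0 + A1 * r1 + A2 * r1\<^sup>2 + A3 * r1 ^ 3\<bar> \<le> R \<Longrightarrow>
      \<bar>A0 + A1 * r2 + A2 * r2\<^sup>2 + A3 * r2 ^ 3\<bar> \<le> R \<Longrightarrow>
      cmod (of_real A0 + of_real A1 * z + of_real A2 * z\<^sup>2 + of_real A3 * z ^ 3) \<le> R \<Longrightarrow>
      \<bar>A0\<bar> \<le> K * R \<and> \<bar>A1\<bar> \<le> K * R \<and> \<bar>A2\<bar> \<le> K * R \<and> \<bar>A3\<bar> \<le> K * R"
      using cubic_coeffs_bounded[OF ne] by metis
    define B where "B = \<lceil>12 * (K * R)\<rceil>"
    have "{x. \<bar>evA r1 x\<bar> \<le> R \<and> \<bar>evA r2 x\<bar> \<le> R \<and> cmod (evA z x) \<le> R}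
        \<subseteq> (\<lambda>(a, b, c, d). OrdA a b c d) ` ({-B..B} \<times> {-B..B} \<times> {-B..B} \<times> {-B..B})"
    proof
      fix x assume x: "x \<in> {x. \<bar>evA r1 x\<bar> \<le> R \<and> \<bar>evA r2 x\<bar> \<le> R \<and> cmod (evA z x) \<le> R}"
      obtain a b c d where abcd: "x = OrdA a b c d" by (cases x)
      define A0 A1 A2 A3 :: real where A: "A0 = of_int a" "A1 = of_int b" "A2 = of_int c / 6" "A3 = of_int d / 12"
      have e: "evA r1 x = A0 + A1 * r1 + A2 * r1\<^sup>2 + A3 * r1 ^ 3" "evA r2 x = A0 + A1 * r2 + A2 * r2\<^sup>2 + A3 * r2 ^ 3"
        "evA z x = of_real A0 + of_real A1 * z + of_real A2 * z\<^sup>2 + of_real A3 * z ^ 3"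
        by (simp_all add: abcd A field_simps)
      have "\<bar>A0\<bar> \<le> K * R \<and> \<bar>A1\<bar> \<le> K * R \<and> \<bar>A2\<bar> \<le> K * R \<and> \<bar>A3\<bar> \<le> K * R"
        by (rule K(2)) (use x in \<open>simp_all add: e\<close>)
      then have "\<bar>real_of_int a\<bar> \<le> 12 * (K * R)" "\<bar>real_of_int b\<bar> \<le> 12 * (K * R)"
        "\<bar>real_of_int c\<bar> \<le> 12 * (K * R)" "\<bar>real_of_int d\<bar> \<le> 12 * (K * R)"
        unfolding A by linarith+
      then have "a \<in> {-B..B}" "b \<in> {-B..B}" "c \<in> {-B..B}" "d \<in> {-B..B}"
        unfolding B_def atLeastAtMost_iff by linarith+
      then show "x \<in> (\<lambda>(a, b, c, d). OrdA a b c d) ` ({-B..B} \<times> {-B..B} \<times> {-B..B} \<times> {-B..B})"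
        unfolding abcd by force
    qed
    then show ?thesis by (rule finite_subset) simp
  qed
qed (simp_all add: evA_one evA_mult roots)

text \<open>The relation \<open>h\<close> recovers the generator t of the field from x, so the four
  conjugates of x are distinct. They are roots of the monic quartic \<open>chi\<close>, and their
  product is its constant term 1. All hypotheses are ring identities that can be checked by
  calculation.\<close>

lemma unit_norm:
  assumes w: "x * w = 1" and N: "N \<noteq> 0"
    and chi: "x ^ 4 + of_int a * x ^ 3 + of_int b * x\<^sup>2 + of_int c * x + 1 = 0"
    and h: "of_int h0 + of_int h1 * x + of_int h2 * x\<^sup>2 + of_int h3 * x ^ 3 = of_int N * OrdA 0 1 0 0"
  shows "unimodular x"
proof -
  define F where "F t = evA t x" for t :: complex
  define t1 t2 where "t1 = complex_of_real r1" and "t2 = complex_of_real r2"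
  have "t1 ^ 4 + 36 * t1\<^sup>2 + 108 * t1 + (-72) = of_real (r1 ^ 4 + 36 * r1\<^sup>2 + 108 * r1 + (-72))"
    "t2 ^ 4 + 36 * t2\<^sup>2 + 108 * t2 + (-72) = of_real (r2 ^ 4 + 36 * r2\<^sup>2 + 108 * r2 + (-72))"
    "(cnj z) ^ 4 + 36 * (cnj z)\<^sup>2 + 108 * cnj z + (-72) = cnj (z ^ 4 + 36 * z\<^sup>2 + 108 * z + (-72))"
    by (simp_all add: t1_def t2_def)
  then have root: "t ^ 4 + 36 * t\<^sup>2 + 108 * t - 72 = 0" if "t \<in> {t1, t2, z, cnj z}" for t
    using that roots by auto
  have chiF: "F t ^ 4 + of_int a * F t ^ 3 + of_int b * (F t)\<^sup>2 + of_int c * F t + 1 = 0"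
    if "t \<in> {t1, t2, z, cnj z}" for t
  proof -
    note r = root[OF that]
    have "evA t (x ^ 4 + of_int a * x ^ 3 + of_int b * x\<^sup>2 + of_int c * x + 1) = evA t 0" using chi by simp
    then show ?thesis
      using evA_of_int[of t 0]
      by (simp add: F_def evA_add evA_mult[OF r] evA_power[OF r] evA_of_int evA_one del: evA.simps)
  qed
  have hF: "of_int h0 + of_int h1 * F t + of_int h2 * (F t)\<^sup>2 + of_int h3 * F t ^ 3 = of_int N * t"
    if "t \<in> {t1, t2, z, cnj z}" for t
  proof -
    note r = root[OF that]
    have "evA t (of_int h0 + of_int h1 * x + of_int h2 * x\<^sup>2 + of_int h3 * x ^ 3) = evA t (of_int N * OrdA 0 1 0 0)" using h by simp
    then show ?thesis
      by (simp add: F_def evA_add evA_mult[OF r] evA_power[OF r] evA_of_int)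
  qed
  have inj: "s = t" if "s \<in> {t1, t2, z, cnj z}" "t \<in> {t1, t2, z, cnj z}" "F s = F t" for s t
  proof -
    have "of_int N * t = of_int N * s" using hF[OF that(1)] unfolding that(3) hF[OF that(2)] .
    then show ?thesis using N by simp
  qed
  have d: "t1 \<noteq> t2" "t1 \<noteq> z" "t1 \<noteq> cnj z" "t2 \<noteq> z" "t2 \<noteq> cnj z" "z \<noteq> cnj z"
    using ne by (auto simp: t1_def t2_def complex_eq_iff)
  have "F t1 * F t2 * F z * F (cnj z) = 1"
  proof (rule quartic_roots_product)
    show "F t1 \<noteq> F t2" "F t1 \<noteq> F z" "F t1 \<noteq> F (cnj z)" "F t2 \<noteq> F z" "F t2 \<noteq> F (cnj z)" "F z \<noteq> F (cnj z)"
      using inj d by blast+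
  qed (use chiF in auto)
  moreover have "F z * F (cnj z) = of_real ((cmod (evA z x))\<^sup>2)"
    unfolding F_def evA_cnj complex_norm_square ..
  ultimately have "complex_of_real (evA r1 x * evA r2 x * (cmod (evA z x))\<^sup>2) = 1"
    by (simp add: F_def t1_def t2_def evA_of_real mult.assoc)
  then have "evA r1 x * evA r2 x * (cmod (evA z x))\<^sup>2 = 1" by (simp only: of_real_eq_1_iff)
  then have "\<bar>evA r1 x * evA r2 x * (cmod (evA z x))\<^sup>2\<bar> = 1" by simp
  then have "\<bar>evA r1 x\<bar> * \<bar>evA r2 x\<bar> * (cmod (evA z x))\<^sup>2 = 1" by (simp add: abs_mult)
  moreover have "x dvd 1" using w by (metis dvd_triv_left)
  ultimately show ?thesis by (simp add: unimodular_def)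
qed

text \<open>The unit 3 + 2 t + t^2 / 3, given with its inverse, its quartic equation and an
  expression for 572 t as a cubic polynomial in it.\<close>

lemma unimodular_eps1: "unimodular (OrdA 3 2 2 0)"
  by (rule unit_norm[where w = "OrdA 195 (-358) 142 (-96)" and N = 572 and a = "12" and b = "326" and c = "-1668"
        and ?h0.0 = "-1692" and ?h1.0 = "433" and ?h2.0 = "6" and ?h3.0 = "1"])
    (simp_all add: of_int_ordA numeral_ordA one_ordA_def zero_ordA_def power2_eq_square power3_eq_cube power4_eq_xxxx)

text \<open>A unit outside Z[t]: 405 is not divisible by 6, nor 112 by 12. It lives in the order
  with the denominators 6 and 12.\<close>

lemma unimodular_eps2: "unimodular (OrdA (-47) 43 405 112)"
  by (rule unit_norm[where w = "OrdA 2694990211 762395690 70652097 251930354" and N = 4029989865434559 and a = "8072" and b = "16464096" and c = "-3130016122"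
        and ?h0.0 = "2260364663181803" and ?h1.0 = "-74165043938268" and ?h2.0 = "-38806151811" and ?h3.0 = "-5455274"])
    (simp_all add: of_int_ordA numeral_ordA one_ordA_def zero_ordA_def power2_eq_square power3_eq_cube power4_eq_xxxx)

end

section \<open>Places and explicit units of the second order\<close>

lemma evB_add: "evB r (x + y) = evB r x + evB r y"
  by (cases x; cases y) (simp add: field_simps)

lemma evB_of_int: "evB r (of_int n) = of_int n"
  by (simp add: of_int_ordB)

lemma evB_of_real: "evB (complex_of_real r) x = of_real (evB r x)"
  by (cases x) simp

lemma evB_cnj: "evB (cnj z) x = cnj (evB z x)"
  by (cases x) simp

lemma evB_power:
  fixes r :: "'b :: field_char_0"
  assumes "r ^ 4 - 54 * r\<^sup>2 + 252 * r - 207 = 0"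
  shows "evB r (x ^ n) = evB r x ^ n"
  by (induction n) (simp_all add: evB_one evB_mult[OF assms])

locale ringB =
  fixes r1 r2 :: real and z :: complex
  assumes ne: "r1 \<noteq> r2" "Im z \<noteq> 0"
    and roots: "r1 ^ 4 - 54 * r1\<^sup>2 + 252 * r1 - 207 = 0" "r2 ^ 4 - 54 * r2\<^sup>2 + 252 * r2 - 207 = 0" "z ^ 4 - 54 * z\<^sup>2 + 252 * z - 207 = 0"
    and norm_linear: "(m - k * r1) * (m - k * r2) * (cmod (of_real m - of_real k * z))\<^sup>2
          = m ^ 4 + (-54) * m\<^sup>2 * k\<^sup>2 + 252 * m * k ^ 3 + (-207) * k ^ 4"
begin

sublocale quartic_embeddings "evB r1" "evB r2" "evB z"
proof
  show "finite {x. \<bar>evB r1 x\<bar> \<le> R \<and> \<bar>evB r2 x\<bar> \<le> R \<and> cmod (evB z x) \<le> R}" for R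
  proof -
    obtain K where K: "K \<ge> 0" "\<And>A0 A1 A2 A3 R :: real. \<bar>A0 + A1 * r1 + A2 * r1\<^sup>2 + A3 * r1 ^ 3\<bar> \<le> R \<Longrightarrow>
      \<bar>A0 + A1 * r2 + A2 * r2\<^sup>2 + A3 * r2 ^ 3\<bar> \<le> R \<Longrightarrow>
      cmod (of_real A0 + of_real A1 * z + of_real A2 * z\<^sup>2 + of_real A3 * z ^ 3) \<le> R \<Longrightarrow>
      \<bar>A0\<bar> \<le> K * R \<and> \<bar>A1\<bar> \<le> K * R \<and> \<bar>A2\<bar> \<le> K * R \<and> \<bar>A3\<bar> \<le> K * R"
      using cubic_coeffs_bounded[OF ne] by metis
    define B where "B = \<lceil>24 * (K * R)\<rceil>"
    have "{x. \<bar>evB r1 x\<bar> \<le> R \<and> \<bar>evB r2 x\<bar> \<le> R \<and> cmod (evB z x) \<le> R}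
        \<subseteq> (\<lambda>(a, b, c, d). OrdB a b c d) ` ({-B..B} \<times> {-B..B} \<times> {-B..B} \<times> {-B..B})"
    proof
      fix x assume x: "x \<in> {x. \<bar>evB r1 x\<bar> \<le> R \<and> \<bar>evB r2 x\<bar> \<le> R \<and> cmod (evB z x) \<le> R}"
      obtain a b c d where abcd: "x = OrdB a b c d" by (cases x)
      define A0 A1 A2 A3 :: real where A: "A0 = of_int a + of_int c / 2 + of_int d / 4" "A1 = of_int b + of_int d / 4" "A2 = of_int c / 6 - of_int d / 4" "A3 = of_int d / 12"
      have e: "evB r1 x = A0 + A1 * r1 + A2 * r1\<^sup>2 + A3 * r1 ^ 3" "evB r2 x = A0 + A1 * r2 + A2 * r2\<^sup>2 + A3 * r2 ^ 3"
        "evB z x = of_real A0 + of_real A1 * z + of_real A2 * z\<^sup>2 + of_real A3 * z ^ 3"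
        by (simp_all add: abcd A field_simps)
      have "\<bar>A0\<bar> \<le> K * R \<and> \<bar>A1\<bar> \<le> K * R \<and> \<bar>A2\<bar> \<le> K * R \<and> \<bar>A3\<bar> \<le> K * R"
        by (rule K(2)) (use x in \<open>simp_all add: e\<close>)
      then have "\<bar>real_of_int a\<bar> \<le> 24 * (K * R)" "\<bar>real_of_int b\<bar> \<le> 24 * (K * R)"
        "\<bar>real_of_int c\<bar> \<le> 24 * (K * R)" "\<bar>real_of_int d\<bar> \<le> 24 * (K * R)"
        unfolding A by linarith+
      then have "a \<in> {-B..B}" "b \<in> {-B..B}" "c \<in> {-B..B}" "d \<in> {-B..B}"
        unfolding B_def atLeastAtMost_iff by linarith+
      then show "x \<in> (\<lambda>(a, b, c, d). OrdB a b c d) ` ({-B..B} \<times> {-B..B} \<times> {-B..B} \<times> {-B..B})"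
        unfolding abcd by force
    qed
    then show ?thesis by (rule finite_subset) simp
  qed
qed (simp_all add: evB_one evB_mult roots)

lemma unit_norm:
  assumes w: "x * w = 1" and N: "N \<noteq> 0"
    and chi: "x ^ 4 + of_int a * x ^ 3 + of_int b * x\<^sup>2 + of_int c * x + 1 = 0"
    and h: "of_int h0 + of_int h1 * x + of_int h2 * x\<^sup>2 + of_int h3 * x ^ 3 = of_int N * OrdB 0 1 0 0"
  shows "unimodular x"
proof -
  define F where "F t = evB t x" for t :: complex
  define t1 t2 where "t1 = complex_of_real r1" and "t2 = complex_of_real r2"
  have "t1 ^ 4 + (-54) * t1\<^sup>2 + 252 * t1 + (-207) = of_real (r1 ^ 4 + (-54) * r1\<^sup>2 + 252 * r1 + (-207))"
    "t2 ^ 4 + (-54) * t2\<^sup>2 + 252 * t2 + (-207) = of_real (r2 ^ 4 + (-54) * r2\<^sup>2 + 252 * r2 + (-207))"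
    "(cnj z) ^ 4 + (-54) * (cnj z)\<^sup>2 + 252 * cnj z + (-207) = cnj (z ^ 4 + (-54) * z\<^sup>2 + 252 * z + (-207))"
    by (simp_all add: t1_def t2_def)
  then have root: "t ^ 4 - 54 * t\<^sup>2 + 252 * t - 207 = 0" if "t \<in> {t1, t2, z, cnj z}" for t
    using that roots by auto
  have chiF: "F t ^ 4 + of_int a * F t ^ 3 + of_int b * (F t)\<^sup>2 + of_int c * F t + 1 = 0"
    if "t \<in> {t1, t2, z, cnj z}" for t
  proof -
    note r = root[OF that]
    have "evB t (x ^ 4 + of_int a * x ^ 3 + of_int b * x\<^sup>2 + of_int c * x + 1) = evB t 0" using chi by simp
    then show ?thesis
      using evB_of_int[of t 0]
      by (simp add: F_def evB_add evB_mult[OF r] evB_power[OF r] evB_of_int evB_one del: evB.simps)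
  qed
  have hF: "of_int h0 + of_int h1 * F t + of_int h2 * (F t)\<^sup>2 + of_int h3 * F t ^ 3 = of_int N * t"
    if "t \<in> {t1, t2, z, cnj z}" for t
  proof -
    note r = root[OF that]
    have "evB t (of_int h0 + of_int h1 * x + of_int h2 * x\<^sup>2 + of_int h3 * x ^ 3) = evB t (of_int N * OrdB 0 1 0 0)" using h by simp
    then show ?thesis
      by (simp add: F_def evB_add evB_mult[OF r] evB_power[OF r] evB_of_int)
  qed
  have inj: "s = t" if "s \<in> {t1, t2, z, cnj z}" "t \<in> {t1, t2, z, cnj z}" "F s = F t" for s t
  proof -
    have "of_int N * t = of_int N * s" using hF[OF that(1)] unfolding that(3) hF[OF that(2)] .
    then show ?thesis using N by simp
  qed
  have d: "t1 \<noteq> t2" "t1 \<noteq> z" "t1 \<noteq> cnj z" "t2 \<noteq> z" "t2 \<noteq> cnj z" "z \<noteq> cnj z"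
    using ne by (auto simp: t1_def t2_def complex_eq_iff)
  have "F t1 * F t2 * F z * F (cnj z) = 1"
  proof (rule quartic_roots_product)
    show "F t1 \<noteq> F t2" "F t1 \<noteq> F z" "F t1 \<noteq> F (cnj z)" "F t2 \<noteq> F z" "F t2 \<noteq> F (cnj z)" "F z \<noteq> F (cnj z)"
      using inj d by blast+
  qed (use chiF in auto)
  moreover have "F z * F (cnj z) = of_real ((cmod (evB z x))\<^sup>2)"
    unfolding F_def evB_cnj complex_norm_square ..
  ultimately have "complex_of_real (evB r1 x * evB r2 x * (cmod (evB z x))\<^sup>2) = 1"
    by (simp add: F_def t1_def t2_def evB_of_real mult.assoc)
  then have "evB r1 x * evB r2 x * (cmod (evB z x))\<^sup>2 = 1" by (simp only: of_real_eq_1_iff)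
  then have "\<bar>evB r1 x * evB r2 x * (cmod (evB z x))\<^sup>2\<bar> = 1" by simp
  then have "\<bar>evB r1 x\<bar> * \<bar>evB r2 x\<bar> * (cmod (evB z x))\<^sup>2 = 1" by (simp add: abs_mult)
  moreover have "x dvd 1" using w by (metis dvd_triv_left)
  ultimately show ?thesis by (simp add: unimodular_def)
qed

lemma unimodular_eta1: "unimodular (OrdB (-58) 73 (-22) (-12))"
  by (rule unit_norm[where w = "OrdB (-30) 45 (-56) 16" and N = 772799 and a = "-396" and b = "41234" and c = "2664"
        and ?h0.0 = "-7128094" and ?h1.0 = "-123673322" and ?h2.0 = "1187732" and ?h3.0 = "-2999"])
    (simp_all add: of_int_ordB numeral_ordB one_ordB_def zero_ordB_def power2_eq_square power3_eq_cube power4_eq_xxxx)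

lemma unimodular_eta2: "unimodular (OrdB 75 (-286) 393 (-128))"
  by (rule unit_norm[where w = "OrdB 157352 (-48575) 21147 10430" and N = 7139215893 and a = "-19552" and b = "94416" and c = "-124078"
        and ?h0.0 = "7531818074" and ?h1.0 = "34866582912" and ?h2.0 = "-11812262307" and ?h3.0 = "604204"])
    (simp_all add: of_int_ordB numeral_ordB one_ordB_def zero_ordB_def power2_eq_square power3_eq_cube power4_eq_xxxx)

end

section \<open>Real roots of the two quartics, and units arising from values of the norm
  forms\<close>

lemma ringA_exists: obtains r1 r2 z where "ringA r1 r2 z"
proof -
  define g where "g t = t ^ 4 + 36 * t\<^sup>2 + 108 * t + (-72 :: real)" for t
  have cont: "continuous_on S g" for S unfolding g_def by (intro continuous_intros)
  obtain r1 where r1: "-3 \<le> r1" "r1 \<le> 0" "g r1 = 0"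
    using IVT2'[of g 0 0 "-3"] cont by (auto simp: g_def)
  obtain r2 where r2: "0 \<le> r2" "r2 \<le> 1" "g r2 = 0"
    using IVT'[of g 0 0 1] cont by (auto simp: g_def)
  have "g 0 \<noteq> 0" by (simp add: g_def)
  then have ne: "r1 \<noteq> r2" using r1 r2 by (metis order_antisym)
  have "r1 * r2 \<le> 0" using r1 r2 by (simp add: mult_nonpos_nonneg)
  then have disc: "(r1 + r2)\<^sup>2 < 4 * (36 + (r1 + r2)\<^sup>2 - r1 * r2)"
  proof -
    define S q where "S = (r1 + r2)\<^sup>2" and "q = r1 * r2"
    have "S \<ge> 0" by (simp add: S_def)
    with \<open>r1 * r2 \<le> 0\<close> show ?thesis unfolding S_def[symmetric] q_def[symmetric] right_diff_distrib distrib_left by linarith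
  qed
  obtain z where z: "Im z \<noteq> 0" "z ^ 4 + of_real 36 * z\<^sup>2 + of_real 108 * z + of_real (-72) = 0"
    "\<And>m k :: real. (m - k * r1) * (m - k * r2) * (cmod (of_real m - of_real k * z))\<^sup>2 = m ^ 4 + 36 * m\<^sup>2 * k\<^sup>2 + 108 * m * k ^ 3 + (-72) * k ^ 4"
    using quartic_complex_root[OF ne _ _ disc] r1(3) r2(3) unfolding g_def by metis
  show thesis
    by (rule that[of r1 r2 z], unfold_locales) (use ne z r1 r2 in \<open>simp_all add: g_def\<close>)
qed

text \<open>The discriminant condition amounts to 3 (r1 + r2)^2 > 216 + 4 r1 r2. Signs of the roots
  do not decide it, so both roots are enclosed in intervals of length 1/10.\<close>

lemma ringB_exists: obtains r1 r2 z where "ringB r1 r2 z"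
proof -
  define g where "g t = t ^ 4 + (-54) * t\<^sup>2 + 252 * t + (-207 :: real)" for t
  have cont: "continuous_on S g" for S unfolding g_def by (intro continuous_intros)
  have v: "g (-92/10) \<ge> 0" "g (-91/10) \<le> 0" "g 1 \<le> 0" "g (11/10) \<ge> 0"
    by (simp_all add: g_def power2_eq_square power4_eq_xxxx)
  obtain r1 where r1: "-92/10 \<le> r1" "r1 \<le> -91/10" "g r1 = 0"
    using IVT2'[of g "-91/10" 0 "-92/10"] cont v by auto
  obtain r2 where r2: "1 \<le> r2" "r2 \<le> 11/10" "g r2 = 0"
    using IVT'[of g 1 0 "11/10"] cont v by auto
  have ne: "r1 \<noteq> r2" using r1 r2 by linarith
  have "91/10 * 1 \<le> (- r1) * r2" using r1 r2 by (intro mult_mono) auto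
  then have q: "r1 * r2 \<le> -91/10" by simp
  have "8\<^sup>2 \<le> (- (r1 + r2))\<^sup>2" using r1 r2 by (intro power_mono) auto
  then have sq: "(r1 + r2)\<^sup>2 \<ge> 64" unfolding power2_minus by simp
  have disc: "(r1 + r2)\<^sup>2 < 4 * (-54 + (r1 + r2)\<^sup>2 - r1 * r2)"
  proof -
    define S P where "S = (r1 + r2)\<^sup>2" and "P = r1 * r2"
    show ?thesis using q sq unfolding S_def[symmetric] P_def[symmetric] right_diff_distrib distrib_left by linarith
  qed
  obtain z where z: "Im z \<noteq> 0" "z ^ 4 + of_real (-54) * z\<^sup>2 + of_real 252 * z + of_real (-207) = 0"
    "\<And>m k :: real. (m - k * r1) * (m - k * r2) * (cmod (of_real m - of_real k * z))\<^sup>2 = m ^ 4 + (-54) * m\<^sup>2 * k\<^sup>2 + 252 * m * k ^ 3 + (-207) * k ^ 4"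
    using quartic_complex_root[OF ne _ _ disc] r1(3) r2(3) unfolding g_def by metis
  show thesis
    by (rule that[of r1 r2 z], unfold_locales) (use ne z r1 r2 in \<open>simp_all add: g_def\<close>)
qed

text \<open>The Thue form is the norm of m - k t. The explicit inverse is the quotient of the form
  by m - k t, written in the basis of the order.\<close>

lemma (in ringA) unimodular_linear:
  fixes m k :: int
  assumes "m ^ 4 + 36 * m\<^sup>2 * k\<^sup>2 + 108 * m * k ^ 3 - 72 * k ^ 4 = 1"
  shows "unimodular (OrdA m (- k) 0 0)"
proof -
  define x where "x = OrdA m (- k) 0 0"
  have "x * OrdA (m ^ 3 + 36 * k\<^sup>2 * m + 108 * k ^ 3) (m\<^sup>2 * k + 36 * k ^ 3) (6 * m * k\<^sup>2) (12 * k ^ 3) = 1"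
    using assms by (simp add: x_def one_ordA_def algebra_simps power2_eq_square power3_eq_cube power4_eq_xxxx)
  then have "x dvd 1" by (metis dvd_triv_left)
  moreover have "\<bar>evA r1 x\<bar> * \<bar>evA r2 x\<bar> * (cmod (evA z x))\<^sup>2 = 1"
  proof -
    have "evA r1 x = of_int m - of_int k * r1" "evA r2 x = of_int m - of_int k * r2"
      "evA z x = of_real (of_int m) - of_real (of_int k) * z" by (simp_all add: x_def)
    moreover have "(of_int m - of_int k * r1) * (of_int m - of_int k * r2) * (cmod (of_real (of_int m) - of_real (of_int k) * z))\<^sup>2
        = real_of_int (m ^ 4 + 36 * m\<^sup>2 * k\<^sup>2 + 108 * m * k ^ 3 - 72 * k ^ 4)"
      unfolding norm_linear by simp
    ultimately have "evA r1 x * evA r2 x * (cmod (evA z x))\<^sup>2 = 1" using assms by simp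
    then have "\<bar>evA r1 x * evA r2 x * (cmod (evA z x))\<^sup>2\<bar> = 1" by simp
    then show ?thesis by (simp add: abs_mult)
  qed
  ultimately show ?thesis by (simp add: unimodular_def x_def)
qed

lemma (in ringB) norm_linear_int:
  fixes m k :: int
  shows "\<bar>evB r1 (OrdB m (- k) 0 0)\<bar> * \<bar>evB r2 (OrdB m (- k) 0 0)\<bar> * (cmod (evB z (OrdB m (- k) 0 0)))\<^sup>2
    = \<bar>real_of_int (m ^ 4 - 54 * m\<^sup>2 * k\<^sup>2 + 252 * m * k ^ 3 - 207 * k ^ 4)\<bar>"
proof -
  define x where "x = OrdB m (- k) 0 0"
  have "evB r1 x = of_int m - of_int k * r1" "evB r2 x = of_int m - of_int k * r2"
    "evB z x = of_real (of_int m) - of_real (of_int k) * z" by (simp_all add: x_def)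
  moreover have "(of_int m - of_int k * r1) * (of_int m - of_int k * r2) * (cmod (of_real (of_int m) - of_real (of_int k) * z))\<^sup>2
      = real_of_int (m ^ 4 - 54 * m\<^sup>2 * k\<^sup>2 + 252 * m * k ^ 3 - 207 * k ^ 4)"
    unfolding norm_linear by simp
  ultimately have "evB r1 x * evB r2 x * (cmod (evB z x))\<^sup>2 = real_of_int (m ^ 4 - 54 * m\<^sup>2 * k\<^sup>2 + 252 * m * k ^ 3 - 207 * k ^ 4)" by simp
  then have "\<bar>evB r1 x * evB r2 x * (cmod (evB z x))\<^sup>2\<bar> = \<bar>real_of_int (m ^ 4 - 54 * m\<^sup>2 * k\<^sup>2 + 252 * m * k ^ 3 - 207 * k ^ 4)\<bar>" by simp
  then show ?thesis by (simp add: abs_mult x_def)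
qed

lemma (in ringB) unimodular_linear:
  fixes m k :: int
  assumes "m ^ 4 - 54 * m\<^sup>2 * k\<^sup>2 + 252 * m * k ^ 3 - 207 * k ^ 4 = 1"
  shows "unimodular (OrdB m (- k) 0 0)"
proof -
  have "OrdB m (- k) 0 0 * OrdB (m ^ 3 - 54 * k\<^sup>2 * m + 252 * k ^ 3 - 3 * m * k\<^sup>2 - 12 * k ^ 3) (m\<^sup>2 * k - 54 * k ^ 3 - 3 * k ^ 3) (6 * m * k\<^sup>2 + 18 * k ^ 3) (12 * k ^ 3) = 1"
    using assms by (simp add: one_ordB_def algebra_simps power2_eq_square power3_eq_cube power4_eq_xxxx)
  then have "OrdB m (- k) 0 0 dvd 1" by (metis dvd_triv_left)
  then show ?thesis using norm_linear_int[of m k] assms by (simp add: unimodular_def)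
qed

text \<open>
  With r the root of the defining polynomial, the element is -(3 m - n r)^2 / 3.
\<close>

lemma (in ringB) unimodular_gamma:
  fixes m n t :: int
  assumes eq: "9 * m ^ 4 - 54 * m\<^sup>2 * n\<^sup>2 + 84 * m * n ^ 3 - 23 * n ^ 4 = 1" and n: "n = 2 * t"
  shows "unimodular (OrdB (4 * t\<^sup>2 - 3 * m\<^sup>2) (4 * m * t) (- 8 * t\<^sup>2) 0)"
proof -
  define x where "x = OrdB (4 * t\<^sup>2 - 3 * m\<^sup>2) (4 * m * t) (- 8 * t\<^sup>2) 0"
  define y where "y = OrdB (3 * m) (- n) 0 0"
  define u where "u = OrdB (n\<^sup>2 - 3 * m\<^sup>2) (2 * m * n) (- 2 * n\<^sup>2) 0"
  have xu: "x = u" by (simp add: x_def u_def n power2_eq_square)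
  \<comment> \<open>The second factor is the polynomial cofactor of u in the square of the quartic
    form.\<close>
  have "u * - OrdB
     (27 * m ^ 6 - 351 * m ^ 4 * n ^ 2 + 456 * m ^ 3 * n ^ 3 + 1233 * m ^ 2 * n ^ 4 - 2880 * m * n ^ 5 + 1803 * n ^ 6)
     (18 * m ^ 5 * n - 228 * m ^ 3 * n ^ 3 - 84 * m ^ 2 * n ^ 4 + 730 * m * n ^ 5 - 532 * n ^ 6)
     (54 * m ^ 4 * n ^ 2 + 72 * m ^ 3 * n ^ 3 - 108 * m ^ 2 * n ^ 4 - 216 * m * n ^ 5 + 214 * n ^ 6)
     (48 * m ^ 3 * n ^ 3 - 144 * m * n ^ 5 + 112 * n ^ 6)
     = OrdB ((9 * m ^ 4 - 54 * m\<^sup>2 * n\<^sup>2 + 84 * m * n ^ 3 - 23 * n ^ 4)\<^sup>2) 0 0 0"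
    by (simp add: u_def) (simp add: algebra_simps power2_eq_square power3_eq_cube power_numeral_reduce)
  also have "\<dots> = 1" unfolding eq by (simp add: one_ordB_def)
  finally have "x dvd 1" unfolding xu by (metis dvd_triv_left)
  have yy: "- of_int 3 * x = y * y" unfolding xu by (simp add: u_def y_def of_int_ordB power2_eq_square algebra_simps numeral_ordB)
  have "evB r1 (- of_int 3) = -3" "evB r2 (- of_int 3) = -3" "evB z (- of_int 3) = -3"
    by (simp_all add: of_int_ordB numeral_ordB)
  then have e: "-3 * evB r1 x = evB r1 y * evB r1 y" "-3 * evB r2 x = evB r2 y * evB r2 y" "-3 * evB z x = evB z y * evB z y"
    using arg_cong[OF yy, of "evB r1"] arg_cong[OF yy, of "evB r2"] arg_cong[OF yy, of "evB z"] unfolding mult by simp_all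
  have e': "3 * \<bar>evB r1 x\<bar> = \<bar>evB r1 y\<bar>\<^sup>2" "3 * \<bar>evB r2 x\<bar> = \<bar>evB r2 y\<bar>\<^sup>2" "3 * cmod (evB z x) = (cmod (evB z y))\<^sup>2"
    using arg_cong[OF e(1), of abs] arg_cong[OF e(2), of abs] arg_cong[OF e(3), of cmod]
    by (simp_all add: abs_mult norm_mult power2_eq_square)
  \<comment> \<open>The element y = 3 m - n r has norm 9, so its square has norm 81. This is also
    the norm of -3, and the quotient has norm 1.\<close>
  have "\<bar>evB r1 y\<bar> * \<bar>evB r2 y\<bar> * (cmod (evB z y))\<^sup>2 = \<bar>real_of_int ((3 * m) ^ 4 - 54 * (3 * m)\<^sup>2 * n\<^sup>2 + 252 * (3 * m) * n ^ 3 - 207 * n ^ 4)\<bar>"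
    unfolding y_def by (rule norm_linear_int)
  also have "(3 * m) ^ 4 - 54 * (3 * m)\<^sup>2 * n\<^sup>2 + 252 * (3 * m) * n ^ 3 - 207 * n ^ 4 = 9 * (9 * m ^ 4 - 54 * m\<^sup>2 * n\<^sup>2 + 84 * m * n ^ 3 - 23 * n ^ 4)"
    by (simp add: power_mult_distrib)
  finally have "\<bar>evB r1 y\<bar> * \<bar>evB r2 y\<bar> * (cmod (evB z y))\<^sup>2 = 9" unfolding eq by simp
  then have "(\<bar>evB r1 y\<bar> * \<bar>evB r2 y\<bar> * (cmod (evB z y))\<^sup>2)\<^sup>2 = 81" by simp
  then have "\<bar>evB r1 y\<bar>\<^sup>2 * \<bar>evB r2 y\<bar>\<^sup>2 * ((cmod (evB z y))\<^sup>2)\<^sup>2 = 81" by (simp only: power_mult_distrib)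
  then have "(3 * \<bar>evB r1 x\<bar>) * (3 * \<bar>evB r2 x\<bar>) * (3 * cmod (evB z x))\<^sup>2 = 81" unfolding e' .
  then have "\<bar>evB r1 x\<bar> * \<bar>evB r2 x\<bar> * (cmod (evB z x))\<^sup>2 = 1" by (simp add: power_mult_distrib)
  then show ?thesis using \<open>x dvd 1\<close> by (simp add: unimodular_def x_def)
qed

section \<open>Three Thue equations\<close>

lemma prime_power_split:
  fixes k :: int and p :: nat
  assumes "k \<noteq> 0" "prime p"
  obtains j k' where "k = int p ^ j * k'" "\<not> int p dvd k'"
proof -
  have "\<not> is_unit (int p)" using assms by (metis not_prime_unit prime_nat_int_transfer)
  then show thesis using multiplicity_decompose'[of k "int p"] assms(1) that by metis
qed

text \<open>Skolem's method with p = 2. Write k = 2^j k' with k' odd. Squaring m - k t removes the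
  sign of m and gives a unit 1 + 2^(j + 1) l with l congruent to t modulo 2. The two explicit units
  are 1 modulo 4 and have the leading terms t^2 / 6 and 1. As k is even, j + 1 >= 2, the least level
  allowed for p = 2.\<close>

theorem thue_A:
  fixes m k :: int
  assumes eq: "m ^ 4 + 36 * m\<^sup>2 * k\<^sup>2 + 108 * m * k ^ 3 - 72 * k ^ 4 = 1" and "even k"
  shows "k = 0"
proof (rule ccontr)
  assume "k \<noteq> 0"
  obtain r1 r2 z where "ringA r1 r2 z" by (rule ringA_exists)
  then interpret ringA r1 r2 z .
  obtain j k' where k: "k = 2 ^ j * k'" "odd k'"
    using prime_power_split[OF \<open>k \<noteq> 0\<close>, of 2] by auto
  have j: "j \<ge> 1" using k \<open>even k\<close> by (cases j) auto
  have "odd m"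
  proof
    assume "even m"
    then have "even (m ^ 4 + 36 * m\<^sup>2 * k\<^sup>2 + 108 * m * k ^ 3 - 72 * k ^ 4)" by simp
    then show False unfolding eq by simp
  qed
  then obtain a where a: "m = 2 * a + 1" by (rule oddE)
  \<comment> \<open>The equation reads (m^2 - 1) (m^2 + 1) = 4 k^2 Q, and m^2 + 1 is twice an odd
    number, so the powers of 2 go to m^2 - 1. This makes the constant coordinate of the leading term
    even.\<close>
  define D Q where "D = m\<^sup>2 - 1" and "Q = - (9 * m\<^sup>2 + 27 * m * k - 18 * k\<^sup>2)"
  define h where "h = 2 * a\<^sup>2 + 2 * a + 1"
  have "D * (m\<^sup>2 + 1) = 4 * k\<^sup>2 * Q"
    using eq by (simp add: D_def Q_def algebra_simps power2_eq_square power3_eq_cube power4_eq_xxxx)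
  moreover have "m\<^sup>2 + 1 = 2 * h" by (simp add: h_def a power2_eq_square algebra_simps)
  ultimately have "D * h = 2 * k\<^sup>2 * Q" by simp
  also have "2 * k\<^sup>2 = 2 ^ (2 * j + 1) * k'\<^sup>2" by (simp add: k power_mult_distrib power_mult mult.commute)
  finally have "2 ^ (2 * j + 1) dvd D * h" by (metis dvd_triv_left mult.assoc)
  moreover have "coprime (2 ^ (2 * j + 1)) h" by (simp add: h_def)
  ultimately have "2 ^ (2 * j + 1) dvd m\<^sup>2 - 1" unfolding D_def[symmetric] by (simp only: coprime_dvd_mult_left_iff)
  moreover have "(2 :: int) ^ (j + 2) dvd 2 ^ (2 * j + 1)" using j by (intro le_imp_power_dvd) simp
  ultimately have "2 ^ (j + 2) dvd m\<^sup>2 - 1" using dvd_trans by blast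
  then obtain e where e: "m\<^sup>2 = 1 + 2 ^ (j + 2) * e" by (metis add.commute diff_add_cancel dvdE)
  obtain i where i: "j = Suc i" using j by (metis Suc_le_D One_nat_def)
  define l3 where "l3 = OrdA (2 * e) (- m * k') (3 * 2 ^ j * k'\<^sup>2) 0"
  show False
  proof (rule no_third_unit[where p = 2 and t = 2 and s = "j + 1" and ?l3.0 = l3])
    show "unimodular (OrdA 3 2 2 0 ^ 2)" by (intro unimodular_power unimodular_eps1)
    \<comment> \<open>Sign and exponents are such that the product is 1 modulo 4 with leading term
      1.\<close>
    have "unimodular (-1 * OrdA 3 2 2 0 * OrdA (-47) 43 405 112 ^ 4)"
    proof (intro unimodular_mult unimodular_power unimodular_eps1 unimodular_eps2)
      have "(- 1 :: ordA) dvd 1" by simp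
      then show "unimodular (- 1)" unfolding unimodular_def by (simp add: one_ordA_def)
    qed
    then show "unimodular (-1 * OrdA 3 2 2 0 * OrdA (-47) 43 405 112 ^ 4)" .
    show "unimodular (OrdA m (- k) 0 0 ^ 2)" using unimodular_linear[OF eq] by (rule unimodular_power)
    show "OrdA 3 2 2 0 ^ 2 = 1 + of_nat (2 ^ 2) * OrdA 4 0 3 4"
      by (simp add: power2_eq_square one_ordA_def numeral_ordA)
    show "-1 * OrdA 3 2 2 0 * OrdA (-47) 43 405 112 ^ 4 = 1 + of_nat (2 ^ 2) * OrdA 44020743071045 (-60248189494276) (-188277957210620) (-24248663787964)"
      by (simp add: power4_eq_xxxx one_ordA_def numeral_ordA)
    show "OrdA m (- k) 0 0 ^ 2 = 1 + of_nat (2 ^ (j + 1)) * l3"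
      using e by (simp add: power2_eq_square one_ordA_def of_nat_ordA l3_def k algebra_simps power_add)
    show "of_nat 2 dvd OrdA 4 0 3 4 - OrdA 0 0 1 0"
      "of_nat 2 dvd OrdA 44020743071045 (-60248189494276) (-188277957210620) (-24248663787964) - OrdA 1 0 0 0"
      by (simp_all only: minus_ordA.simps of_nat_dvd_ordA) simp_all
    show "of_nat 2 dvd l3 - OrdA 0 (m * k') 0 0"
      unfolding l3_def minus_ordA.simps of_nat_dvd_ordA by (simp add: i)
    show "int 2 dvd a \<and> int 2 dvd b \<and> int 2 dvd c"
      if d: "of_nat 2 dvd of_int a * OrdA 0 0 1 0 + of_int b * OrdA 1 0 0 0 + of_int c * OrdA 0 (m * k') 0 0" for a b c
    proof -
      have *: "of_int a * OrdA 0 0 1 0 + of_int b * OrdA 1 0 0 0 + of_int c * OrdA 0 (m * k') 0 0 = OrdA b (c * (m * k')) a 0"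
        by (simp add: of_int_ordA)
      have "even b" "even (c * (m * k'))" "even a" using d unfolding * of_nat_dvd_ordA by auto
      then show ?thesis using \<open>odd m\<close> \<open>odd k'\<close> by simp
    qed
    show "x = 0" if "of_nat 2 * x = (0 :: ordA)" for x using that by (rule torsion_free_ordA[of 2, rotated]) simp
  qed (use j in simp_all)
qed

text \<open>Skolem's method with p = 5. Modulo 5 the equation forces 5 to divide k but not m.
  Substituting the equation for m^4 gives (m - k t)^4 = 1 - 4 m^3 k t + k^2 (...), so for k = 5^j k'
  the leading term at level j is -4 m^3 k' t, a multiple of t by a 5-adic unit.\<close>

theorem thue_B:
  fixes m k :: int
  assumes eq: "m ^ 4 - 54 * m\<^sup>2 * k\<^sup>2 + 252 * m * k ^ 3 - 207 * k ^ 4 = 1"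
  shows "k = 0"
proof (rule ccontr)
  assume "k \<noteq> 0"
  obtain r1 r2 z where "ringB r1 r2 z" by (rule ringB_exists)
  then interpret ringB r1 r2 z .
  obtain j k' where k: "k = 5 ^ j * k'" "\<not> 5 dvd k'"
    using prime_power_split[OF \<open>k \<noteq> 0\<close>, of 5] by auto
  have m5: "t mod 5 = 0 \<or> t mod 5 = 1 \<or> t mod 5 = 2 \<or> t mod 5 = 3 \<or> t mod 5 = 4" for t :: int by presburger
  have "[m ^ 4 - 54 * m\<^sup>2 * k\<^sup>2 + 252 * m * k ^ 3 - 207 * k ^ 4 =
      (m mod 5) ^ 4 - 54 * (m mod 5)\<^sup>2 * (k mod 5)\<^sup>2 + 252 * (m mod 5) * (k mod 5) ^ 3 - 207 * (k mod 5) ^ 4] (mod 5)"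
    by (intro cong_add cong_diff cong_mult cong_pow cong_refl) (simp_all add: cong_def)
  then have "[1 = (m mod 5) ^ 4 - 54 * (m mod 5)\<^sup>2 * (k mod 5)\<^sup>2 + 252 * (m mod 5) * (k mod 5) ^ 3 - 207 * (k mod 5) ^ 4] (mod 5)"
    unfolding eq .
  then have "k mod 5 = 0 \<and> m mod 5 \<noteq> 0"
    using m5[of m] m5[of k] by (elim disjE) (simp_all add: cong_def)
  then have "5 dvd k" and nm: "\<not> 5 dvd m" by (auto simp: dvd_eq_mod_eq_0)
  then have j: "j \<ge> 1" using k by (cases j) auto
  obtain i where i: "j = Suc i" using j by (metis Suc_le_D One_nat_def)
  define Phi where "Phi = OrdB 0 1 0 0"
  define Psi where "Psi = of_int (6 * m\<^sup>2) * Phi\<^sup>2 - of_int (4 * m * k) * Phi ^ 3 + of_int (k\<^sup>2) * Phi ^ 4"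
  define c0 where "c0 = 54 * m\<^sup>2 - 252 * m * k + 207 * k\<^sup>2"
  have m4: "m ^ 4 = 1 + k\<^sup>2 * c0"
    using eq by (simp add: c0_def algebra_simps power2_eq_square power3_eq_cube power4_eq_xxxx)
  have lin: "OrdB m (- k) 0 0 = of_int m - of_int k * Phi" by (simp add: of_int_ordB Phi_def)
  define l3 where "l3 = of_int (- 4 * m ^ 3 * k') * Phi + of_nat (5 ^ j) * (of_int (k'\<^sup>2) * (of_int c0 + Psi))"
  have p4: "OrdB m (- k) 0 0 ^ 4 = of_int (m ^ 4) + of_int (- 4 * m ^ 3 * k) * Phi + of_int (k\<^sup>2) * Psi"
    unfolding lin Psi_def by (simp add: algebra_simps power2_eq_square power3_eq_cube power4_eq_xxxx)
  have "of_int k = of_nat (5 ^ j) * (of_int k' :: ordB)" by (simp add: k)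
  then have p4': "OrdB m (- k) 0 0 ^ 4 = 1 + of_nat (5 ^ j) * l3"
    unfolding p4 m4 l3_def by (simp add: algebra_simps power2_eq_square)
  have u4: "\<not> 5 dvd - 4 * m ^ 3 * k'"
    using nm k(2) prime_dvd_mult_iff[of "5::int"] prime_dvd_power[of "5::int" m 3] by auto
  show False
  proof (rule no_third_unit[where p = 5 and t = 1 and s = j and ?l3.0 = l3])
    show "unimodular (OrdB (-58) 73 (-22) (-12) ^ 3 * OrdB 75 (-286) 393 (-128) ^ 2)"
      by (intro unimodular_mult unimodular_power unimodular_eta1 unimodular_eta2)
    have "unimodular (-1 * OrdB (-58) 73 (-22) (-12) ^ 13)"
    proof (intro unimodular_mult unimodular_power unimodular_eta1)
      have "(- 1 :: ordB) dvd 1" by simp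
      then show "unimodular (- 1)" unfolding unimodular_def by (simp add: one_ordB_def)
    qed
    then show "unimodular (-1 * OrdB (-58) 73 (-22) (-12) ^ 13)" .
    show "unimodular (OrdB m (- k) 0 0 ^ 4)" using unimodular_linear[OF eq] by (rule unimodular_power)
    show "OrdB (-58) 73 (-22) (-12) ^ 3 * OrdB 75 (-286) 393 (-128) ^ 2 = 1 + of_nat (5 ^ 1) * OrdB (-2971756) 4135380 (-1666618) (-746096)"
      by (simp add: power2_eq_square power3_eq_cube one_ordB_def numeral_ordB)
    show "-1 * OrdB (-58) 73 (-22) (-12) ^ 13 = 1 + of_nat (5 ^ 1) * OrdB (-49160936074615162312025291919) 86729951972926057570723316647 (-52788578968839061373556605806) (-18462830555526866603807509404)"
      by (simp add: power_numeral_reduce one_ordB_def numeral_ordB)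
    show "OrdB m (- k) 0 0 ^ 4 = 1 + of_nat (5 ^ j) * l3" by (rule p4')
    show "of_nat 5 dvd OrdB (-2971756) 4135380 (-1666618) (-746096) - OrdB 4 0 2 4" "of_nat 5 dvd OrdB (-49160936074615162312025291919) 86729951972926057570723316647 (-52788578968839061373556605806) (-18462830555526866603807509404) - OrdB 1 2 4 1"
      by (simp_all only: minus_ordB.simps of_nat_dvd_ordB) simp_all
    show "of_nat 5 dvd l3 - of_int (- 4 * m ^ 3 * k') * Phi" unfolding l3_def i by simp
    show "int 5 dvd a \<and> int 5 dvd b \<and> int 5 dvd c"
      if d: "of_nat 5 dvd of_int a * OrdB 4 0 2 4 + of_int b * OrdB 1 2 4 1 + of_int c * (of_int (- 4 * m ^ 3 * k') * Phi)" for a b c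
    proof -
      define q where "q = - 4 * m ^ 3 * k'"
      have *: "of_int a * OrdB 4 0 2 4 + of_int b * OrdB 1 2 4 1 + of_int c * (of_int q * Phi)
          = OrdB (4 * a + b) (2 * b + c * q) (2 * a + 4 * b) (4 * a + b)"
        by (simp add: of_int_ordB Phi_def)
      have "5 dvd 4 * a + b" "5 dvd 2 * b + c * q" "5 dvd 2 * a + 4 * b"
        using d unfolding q_def[symmetric] * of_nat_dvd_ordB by auto
      then have "5 dvd a" "5 dvd b" by presburger+
      moreover have "5 dvd c * q" using \<open>5 dvd 2 * b + c * q\<close> \<open>5 dvd b\<close> by (simp add: dvd_add_right_iff)
      then have "5 dvd c" using u4 prime_dvd_mult_iff[of "5::int"] by (simp add: q_def)
      ultimately show ?thesis by simp
    qed
    show "x = 0" if "of_nat 5 * x = (0 :: ordB)" for x using that by (rule torsion_free_ordB[of 5, rotated]) simp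
  qed (use j in simp_all)
qed

text \<open>The leading coefficient 9 means that 3 m - n r has norm 9 and is no unit; the third unit
  is minus a third of its square. A search modulo 16 shows that m is odd and n is twice an odd
  number, which makes this unit 1 modulo 4 with leading term r modulo 2. The level is fixed and n =
  0 is excluded from the start, so there is no exceptional solution.\<close>

theorem thue_C:
  fixes m n :: int
  assumes eq: "9 * m ^ 4 - 54 * m\<^sup>2 * n\<^sup>2 + 84 * m * n ^ 3 - 23 * n ^ 4 = 1"
  shows False
proof -
  obtain r1 r2 z where "ringB r1 r2 z" by (rule ringB_exists)
  then interpret ringB r1 r2 z .
  have mn: "odd m \<and> n mod 4 = 2"
  proof -
    define M N where "M = m mod 16" and "N = n mod 16"
    have "[9 * m ^ 4 - 54 * m\<^sup>2 * n\<^sup>2 + 84 * m * n ^ 3 - 23 * n ^ 4 =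
        9 * M ^ 4 - 54 * M\<^sup>2 * N\<^sup>2 + 84 * M * N ^ 3 - 23 * N ^ 4] (mod 16)"
      unfolding M_def N_def
      by (intro cong_add cong_diff cong_mult cong_pow cong_refl) (simp_all add: cong_def)
    then have c: "[1 = 9 * M ^ 4 - 54 * M\<^sup>2 * N\<^sup>2 + 84 * M * N ^ 3 - 23 * N ^ 4] (mod 16)" unfolding eq .
    have r: "t mod 16 \<in> {0,1,2,3,4,5,6,7,8,9,10,11,12,13,14,15}" for t :: int by (simp, presburger)
    have "M mod 2 = 1 \<and> N mod 4 = 2"
      using r[of m] r[of n] c unfolding M_def[symmetric] N_def[symmetric] insert_iff empty_iff
      by (elim disjE) (simp_all add: cong_def)
    moreover have "M mod 2 = m mod 2" "N mod 4 = n mod 4" by (simp_all add: M_def N_def mod_mod_cancel)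
    ultimately show ?thesis by (simp add: odd_iff_mod_2_eq_one)
  qed
  define t where "t = n div 2"
  have t: "n = 2 * t" "odd t" using mn unfolding t_def by presburger+
  have "odd m" using mn by simp
  then obtain a where a: "m = 2 * a + 1" by (rule oddE)
  have "even (a * (a + 1))" by simp
  then obtain b where b: "a * (a + 1) = 2 * b" by blast
  have m2: "m\<^sup>2 = 1 + 8 * b" using b by (simp add: a power2_eq_square algebra_simps)
  \<comment> \<open>From m^2 = 1 + 8 b one has 4 t^2 - 3 m^2 = 1 + 4 (t^2 - 1 - 6 b), and the
    bracket is even because t is odd.\<close>
  define l3 where "l3 = OrdB (t\<^sup>2 - 1 - 6 * b) (m * t) (- 2 * t\<^sup>2) 0"
  show False
  proof (rule no_third_unit[where p = 2 and t = 2 and s = 2 and ?l3.0 = l3])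
    show "unimodular (OrdB (-58) 73 (-22) (-12) * OrdB 75 (-286) 393 (-128) ^ 2)"
      by (intro unimodular_mult unimodular_power unimodular_eta1 unimodular_eta2)
    show "unimodular (OrdB (-58) 73 (-22) (-12) ^ 4)"
      by (intro unimodular_power unimodular_eta1)
    show "unimodular (OrdB (4 * t\<^sup>2 - 3 * m\<^sup>2) (4 * m * t) (- 8 * t\<^sup>2) 0)" using eq t(1) by (rule unimodular_gamma)
    show "OrdB (-58) 73 (-22) (-12) * OrdB 75 (-286) 393 (-128) ^ 2 = 1 + of_nat (2 ^ 2) * OrdB (-212) 671 (-823) 204"
      by (simp add: power2_eq_square one_ordB_def numeral_ordB)
    show "OrdB (-58) 73 (-22) (-12) ^ 4 = 1 + of_nat (2 ^ 2) * OrdB (-101967293) 52855761 65382255 4146584"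
      by (simp add: power4_eq_xxxx one_ordB_def numeral_ordB)
    show "OrdB (4 * t\<^sup>2 - 3 * m\<^sup>2) (4 * m * t) (- 8 * t\<^sup>2) 0 = 1 + of_nat (2 ^ 2) * l3"
      by (simp add: one_ordB_def numeral_ordB l3_def m2)
    show "of_nat 2 dvd OrdB (-212) 671 (-823) 204 - OrdB 0 1 1 0" "of_nat 2 dvd OrdB (-101967293) 52855761 65382255 4146584 - OrdB 1 1 1 0"
      by (simp_all only: minus_ordB.simps of_nat_dvd_ordB) simp_all
    show "of_nat 2 dvd l3 - OrdB 0 (m * t) 0 0"
      unfolding l3_def minus_ordB.simps of_nat_dvd_ordB using t(2) by simp
    show "int 2 dvd a \<and> int 2 dvd b \<and> int 2 dvd c"
      if d: "of_nat 2 dvd of_int a * OrdB 0 1 1 0 + of_int b * OrdB 1 1 1 0 + of_int c * OrdB 0 (m * t) 0 0" for a b c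
    proof -
      have *: "of_int a * OrdB 0 1 1 0 + of_int b * OrdB 1 1 1 0 + of_int c * OrdB 0 (m * t) 0 0 = OrdB b (a + b + c * (m * t)) (a + b) 0"
        by (simp add: of_int_ordB)
      have "even b" "even (a + b + c * (m * t))" "even (a + b)" using d unfolding * of_nat_dvd_ordB by auto
      then show ?thesis using \<open>odd m\<close> t(2) by simp
    qed
    show "x = 0" if "of_nat 2 * x = (0 :: ordB)" for x using that by (rule torsion_free_ordB[of 2, rotated]) simp
  qed simp_all
qed

section \<open>Reduction of binary quartic forms\<close>

text \<open>Gauss reduction. A nonzero vector of least value q is primitive, Bezout completes it to
  a basis, and a shift of the second vector makes the middle coefficient b' at most q in absolute
  value. With q' >= q the value at the second vector, 4 q q' - b'^2 = 4 D yields 3 q^2 <= 4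
  D.\<close>

lemma reduced_basis:
  fixes A B C :: real
  assumes A: "A > 0" and D: "A * C - B\<^sup>2 / 4 > 0"
  defines "Q \<equiv> \<lambda>(m :: int) (n :: int). A * (of_int m)\<^sup>2 + B * of_int m * of_int n + C * (of_int n)\<^sup>2"
  obtains m n k l :: int where "m * l - n * k = 1" "3 * (Q m n)\<^sup>2 \<le> 4 * (A * C - B\<^sup>2 / 4)"
proof -
  define D where "D = A * C - B\<^sup>2 / 4"
  have D0: "D > 0" using D by (simp add: D_def)
  have comp: "4 * A * Q m n = (2 * A * of_int m + B * of_int n)\<^sup>2 + 4 * D * (of_int n)\<^sup>2" for m n
    by (simp add: Q_def D_def power2_eq_square algebra_simps)
  have pos: "Q m n > 0" if "(m, n) \<noteq> (0, 0)" for m n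
  proof -
    have "(2 * A * of_int m + B * of_int n)\<^sup>2 + 4 * D * (of_int n)\<^sup>2 > 0"
    proof (cases "n = 0")
      case True
      then have "m \<noteq> 0" using that by simp
      then show ?thesis using True A by simp
    next
      case False
      then have "4 * D * (real_of_int n)\<^sup>2 > 0" using D0 by simp
      then show ?thesis by (meson add_nonneg_pos zero_le_power2)
    qed
    then have "4 * A * Q m n > 0" unfolding comp .
    then show ?thesis using A by (simp add: zero_less_mult_iff)
  qed
  \<comment> \<open>The bound A is the value at (1, 0), so the set of candidates is nonempty as well
    as finite.\<close>
  define S where "S = {(m, n). (m, n) \<noteq> (0, 0) \<and> Q m n \<le> A}"
  have "finite S"
  proof -
    define N where "N = \<lceil>sqrt (A\<^sup>2 / D)\<rceil>"
    define M where "M = \<lceil>(2 * A + \<bar>B\<bar> * of_int N) / (2 * A)\<rceil>"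
    have "S \<subseteq> {-M..M} \<times> {-N..N}"
    proof clarify
      fix m n assume "(m, n) \<in> S"
      then have q: "Q m n \<le> A" by (simp add: S_def)
      have "(2 * A * of_int m + B * of_int n)\<^sup>2 + 4 * D * (of_int n)\<^sup>2 \<le> 4 * A * A"
        unfolding comp[symmetric] using q A by simp
      moreover have "(2 * A * of_int m + B * of_int n)\<^sup>2 \<ge> 0" "4 * D * (real_of_int n)\<^sup>2 \<ge> 0" using D0 by simp_all
      ultimately have 1: "(2 * A * of_int m + B * of_int n)\<^sup>2 \<le> 4 * A * A" and 2: "4 * D * (of_int n)\<^sup>2 \<le> 4 * A * A"
        by linarith+
      have A2: "4 * A * A = (2 * A)\<^sup>2" by (simp add: power2_eq_square)
      have "(real_of_int n)\<^sup>2 \<le> A\<^sup>2 / D" using 2 D0 by (simp add: field_simps power2_eq_square)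
      then have "\<bar>real_of_int n\<bar> \<le> sqrt (A\<^sup>2 / D)" using real_le_rsqrt by (metis power2_abs)
      then have n: "\<bar>real_of_int n\<bar> \<le> of_int N" unfolding N_def by linarith
      have "\<bar>2 * A * of_int m + B * of_int n\<bar> \<le> \<bar>2 * A\<bar>" using 1 unfolding A2 abs_le_square_iff .
      then have "\<bar>2 * A * of_int m + B * of_int n\<bar> \<le> 2 * A" using A by simp
      moreover have "\<bar>B * of_int n\<bar> \<le> \<bar>B\<bar> * of_int N" unfolding abs_mult using n by (intro mult_left_mono) auto
      ultimately have "\<bar>2 * A * of_int m\<bar> \<le> 2 * A + \<bar>B\<bar> * of_int N" by linarith
      then have "\<bar>real_of_int m\<bar> \<le> (2 * A + \<bar>B\<bar> * of_int N) / (2 * A)" using A by (simp add: abs_mult field_simps)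
      then have "\<bar>real_of_int m\<bar> \<le> of_int M" unfolding M_def by linarith
      then show "m \<in> {-M..M} \<and> n \<in> {-N..N}" using n by (auto simp: abs_le_iff)
    qed
    then show ?thesis by (rule finite_subset) simp
  qed
  moreover have "(1, 0) \<in> S" by (simp add: S_def Q_def)
  ultimately obtain v where v: "is_arg_min (\<lambda>(m, n). Q m n) (\<lambda>v. v \<in> S) v"
    using ex_is_arg_min_if_finite by blast
  obtain m n where mn: "v = (m, n)" by (cases v)
  have vS: "(m, n) \<noteq> (0, 0)" "Q m n \<le> A" using v mn by (auto simp: is_arg_min_def S_def)
  have min: "Q m n \<le> Q m' n'" if "(m', n') \<noteq> (0, 0)" for m' n'
  proof (rule ccontr)
    assume less: "\<not> ?thesis"
    then have "(m', n') \<in> S" using that vS by (simp add: S_def)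
    then show False using v mn less unfolding is_arg_min_def by (metis (mono_tags, lifting) case_prod_conv not_le)
  qed
  define g where "g = gcd m n"
  have g0: "g > 0" using vS by (simp add: g_def)
  obtain m1 n1 where mn1: "m = g * m1" "n = g * n1" unfolding g_def by (meson dvdE gcd_dvd1 gcd_dvd2)
  have "(m1, n1) \<noteq> (0, 0)" using vS mn1 by auto
  then have "Q m n \<le> Q m1 n1" and q1: "Q m1 n1 > 0" using min pos by auto
  moreover have "Q m n = (of_int g)\<^sup>2 * Q m1 n1" by (simp add: Q_def mn1 power2_eq_square algebra_simps)
  ultimately have "(of_int g)\<^sup>2 * Q m1 n1 \<le> 1 * Q m1 n1" by simp
  then have "(real_of_int g)\<^sup>2 \<le> 1" using q1 by simp
  then have "g\<^sup>2 \<le> 1" by (simp flip: of_int_power)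
  then have "g = 1" using g0 by (smt (verit) power2_eq_square mult_le_cancel_left1)
  then obtain l k where lk: "m * l - n * k = 1"
    using bezout_int[of m n] unfolding g_def by (metis mult.commute mult_minus_right diff_minus_eq_add)
  define b where "b = 2 * A * of_int m * of_int k + B * (of_int m * of_int l + of_int n * of_int k) + 2 * C * of_int n * of_int l"
  define q where "q = Q m n"
  have q0: "q > 0" using pos vS by (simp add: q_def)
  define r where "r = round (b / (2 * q))"
  define k' l' where "k' = k - r * m" and "l' = l - r * n"
  define b' where "b' = b - 2 * of_int r * q"
  have "\<bar>b / (2 * q) - of_int r\<bar> \<le> 1 / 2"
    using of_int_round_abs_le[of "b / (2 * q)"] by (simp add: r_def abs_minus_commute)
  then have "\<bar>b'\<bar> \<le> q"
  proof -
    have "b' = 2 * q * (b / (2 * q) - of_int r)" using q0 by (simp add: b'_def field_simps)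
    then have "\<bar>b'\<bar> = 2 * q * \<bar>b / (2 * q) - of_int r\<bar>" using q0 by (simp add: abs_mult)
    also have "\<dots> \<le> 2 * q * (1 / 2)" using q0 \<open>\<bar>b / (2 * q) - of_int r\<bar> \<le> 1 / 2\<close> by (intro mult_left_mono) auto
    finally show ?thesis by simp
  qed
  then have "\<bar>b'\<bar> \<le> \<bar>q\<bar>" using q0 by simp
  then have b2: "b'\<^sup>2 \<le> q\<^sup>2" unfolding abs_le_square_iff .
  have det: "m * l' - n * k' = 1" using lk by (simp add: k'_def l'_def algebra_simps)
  then have "(k', l') \<noteq> (0, 0)" by auto
  then have "q \<le> Q k' l'" using min by (simp add: q_def)
  then have "q * q \<le> q * Q k' l'" using q0 by simp
  have detr: "(of_int m * of_int l' - of_int n * of_int k' :: real) = 1"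
    using det by (metis of_int_1 of_int_diff of_int_mult)
  have "b' = 2 * A * of_int m * of_int k' + B * (of_int m * of_int l' + of_int n * of_int k') + 2 * C * of_int n * of_int l'"
    by (simp add: b'_def b_def q_def Q_def k'_def l'_def power2_eq_square algebra_simps)
  then have "4 * (q * Q k' l') - b'\<^sup>2 = 4 * D * (of_int m * of_int l' - of_int n * of_int k')\<^sup>2"
    by (simp add: q_def Q_def D_def power2_eq_square algebra_simps)
  then have "4 * (q * Q k' l') - b'\<^sup>2 = 4 * D" unfolding detr by simp
  then have "3 * q\<^sup>2 \<le> 4 * D" using b2 \<open>q * q \<le> q * Q k' l'\<close> by (simp add: power2_eq_square)
  then show thesis using that[OF det] by (simp add: q_def D_def)
qed

text \<open>Classical formulas for a quartic that is a product of two quadratics with determinants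
  d1, d2 and mixed invariant t: its two invariants, then the leading coefficient of its Hessian in
  terms of the Jacobian of the two quadratics, and finally the syzygy for the square of that
  Jacobian.\<close>

lemma product_invariants:
  fixes al1 be1 ga1 al2 be2 ga2 a b c d e d1 d2 t :: real
  assumes "a = al1 * al2" "4 * b = al1 * be2 + be1 * al2" "6 * c = al1 * ga2 + ga1 * al2 + be1 * be2"
    "4 * d = be1 * ga2 + ga1 * be2" "e = ga1 * ga2"
    "d1 = al1 * ga1 - be1\<^sup>2 / 4" "d2 = al2 * ga2 - be2\<^sup>2 / 4" "t = al1 * ga2 + ga1 * al2 - be1 * be2 / 2"
  shows "a * e - 4 * b * d + 3 * c\<^sup>2 = d1 * d2 + t\<^sup>2 / 12"
    and "a * c * e + 2 * b * c * d - a * d\<^sup>2 - e * b\<^sup>2 - c ^ 3 = t * d1 * d2 / 6 - t ^ 3 / 216"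
    and "a * c - b\<^sup>2 = t / 6 * a - (al1 * be2 - be1 * al2)\<^sup>2 / 16"
    and "(al1 * be2 - be1 * al2)\<^sup>2 / 4 = - d2 * al1\<^sup>2 + t * al1 * al2 - d1 * al2\<^sup>2"
proof -
  have bcd: "b = (al1 * be2 + be1 * al2) / 4" "c = (al1 * ga2 + ga1 * al2 + be1 * be2) / 6" "d = (be1 * ga2 + ga1 * be2) / 4"
    using assms by simp_all
  show "a * e - 4 * b * d + 3 * c\<^sup>2 = d1 * d2 + t\<^sup>2 / 12"
    unfolding bcd assms(1,5-8) by (simp add: field_simps power2_eq_square)
  show "a * c * e + 2 * b * c * d - a * d\<^sup>2 - e * b\<^sup>2 - c ^ 3 = t * d1 * d2 / 6 - t ^ 3 / 216"
    unfolding bcd assms(1,5-8) by (simp add: field_simps power2_eq_square power3_eq_cube)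
  show "a * c - b\<^sup>2 = t / 6 * a - (al1 * be2 - be1 * al2)\<^sup>2 / 16"
    unfolding bcd assms(1,5-8) by (simp add: field_simps power2_eq_square)
  show "(al1 * be2 - be1 * al2)\<^sup>2 / 4 = - d2 * al1\<^sup>2 + t * al1 * al2 - d1 * al2\<^sup>2"
    unfolding bcd assms(1,5-8) by (simp add: field_simps power2_eq_square)
qed

text \<open>The quadratics 3 x^2 - s x y + u y^2 and 3 x^2 + s x y + t y^2 and their product undergo
  the substitution with columns (m, n) and (k, l). Determinants and mixed invariant are multiplied
  by the square of the determinant of the substitution, which is 1.\<close>

lemma transformed_coefficients:
  fixes m n k l s t u g h f :: real
  assumes g: "6 * g = 3 * (t + u) - s\<^sup>2" and h: "4 * h = s * (u - t)" and f: "f = t * u"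
    and det: "m * l - n * k = 1"
  defines "al1 \<equiv> 3 * m\<^sup>2 - s * m * n + u * n\<^sup>2" and "be1 \<equiv> 6 * m * k - s * (m * l + n * k) + 2 * u * n * l"
    and "ga1 \<equiv> 3 * k\<^sup>2 - s * k * l + u * l\<^sup>2"
    and "al2 \<equiv> 3 * m\<^sup>2 + s * m * n + t * n\<^sup>2" and "be2 \<equiv> 6 * m * k + s * (m * l + n * k) + 2 * t * n * l"
    and "ga2 \<equiv> 3 * k\<^sup>2 + s * k * l + t * l\<^sup>2"
  shows "9 * m ^ 4 + 6 * g * m\<^sup>2 * n\<^sup>2 + 4 * h * m * n ^ 3 + f * n ^ 4 = al1 * al2"
    and "4 * (9 * m ^ 3 * k + 3 * g * (m\<^sup>2 * n * l + m * n\<^sup>2 * k) + h * (3 * m * n\<^sup>2 * l + n ^ 3 * k) + f * n ^ 3 * l) = al1 * be2 + be1 * al2"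
    and "6 * (9 * m\<^sup>2 * k\<^sup>2 + g * (m\<^sup>2 * l\<^sup>2 + 4 * m * n * k * l + n\<^sup>2 * k\<^sup>2) + 2 * h * (m * n * l\<^sup>2 + n\<^sup>2 * k * l) + f * n\<^sup>2 * l\<^sup>2)
           = al1 * ga2 + ga1 * al2 + be1 * be2"
    and "4 * (9 * m * k ^ 3 + 3 * g * (n * k\<^sup>2 * l + m * k * l\<^sup>2) + h * (3 * n * k * l\<^sup>2 + m * l ^ 3) + f * n * l ^ 3) = be1 * ga2 + ga1 * be2"
    and "9 * k ^ 4 + 6 * g * k\<^sup>2 * l\<^sup>2 + 4 * h * k * l ^ 3 + f * l ^ 4 = ga1 * ga2"
    and "al1 * ga1 - be1\<^sup>2 / 4 = 3 * u - s\<^sup>2 / 4" and "al2 * ga2 - be2\<^sup>2 / 4 = 3 * t - s\<^sup>2 / 4"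
    and "al1 * ga2 + ga1 * al2 - be1 * be2 / 2 = 3 * (t + u) + s\<^sup>2 / 2"
proof -
  have gh: "g = (3 * (t + u) - s\<^sup>2) / 6" "h = s * (u - t) / 4" using g h by simp_all
  show "9 * m ^ 4 + 6 * g * m\<^sup>2 * n\<^sup>2 + 4 * h * m * n ^ 3 + f * n ^ 4 = al1 * al2"
    "9 * k ^ 4 + 6 * g * k\<^sup>2 * l\<^sup>2 + 4 * h * k * l ^ 3 + f * l ^ 4 = ga1 * ga2"
    "4 * (9 * m ^ 3 * k + 3 * g * (m\<^sup>2 * n * l + m * n\<^sup>2 * k) + h * (3 * m * n\<^sup>2 * l + n ^ 3 * k) + f * n ^ 3 * l) = al1 * be2 + be1 * al2"
    "6 * (9 * m\<^sup>2 * k\<^sup>2 + g * (m\<^sup>2 * l\<^sup>2 + 4 * m * n * k * l + n\<^sup>2 * k\<^sup>2) + 2 * h * (m * n * l\<^sup>2 + n\<^sup>2 * k * l) + f * n\<^sup>2 * l\<^sup>2)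
           = al1 * ga2 + ga1 * al2 + be1 * be2"
    "4 * (9 * m * k ^ 3 + 3 * g * (n * k\<^sup>2 * l + m * k * l\<^sup>2) + h * (3 * n * k * l\<^sup>2 + m * l ^ 3) + f * n * l ^ 3) = be1 * ga2 + ga1 * be2"
    unfolding gh f al1_def be1_def ga1_def al2_def be2_def ga2_def
    by (simp_all add: field_simps power2_eq_square power3_eq_cube power4_eq_xxxx)
  have "al1 * ga1 - be1\<^sup>2 / 4 = (3 * u - s\<^sup>2 / 4) * (m * l - n * k)\<^sup>2"
    unfolding al1_def be1_def ga1_def by (simp add: field_simps power2_eq_square)
  then show "al1 * ga1 - be1\<^sup>2 / 4 = 3 * u - s\<^sup>2 / 4" unfolding det by simp
  have "al2 * ga2 - be2\<^sup>2 / 4 = (3 * t - s\<^sup>2 / 4) * (m * l - n * k)\<^sup>2"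
    unfolding al2_def be2_def ga2_def by (simp add: field_simps power2_eq_square)
  then show "al2 * ga2 - be2\<^sup>2 / 4 = 3 * t - s\<^sup>2 / 4" unfolding det by simp
  have "al1 * ga2 + ga1 * al2 - be1 * be2 / 2 = (3 * (t + u) + s\<^sup>2 / 2) * (m * l - n * k)\<^sup>2"
    unfolding al1_def be1_def ga1_def al2_def be2_def ga2_def by (simp add: field_simps power2_eq_square)
  then show "al1 * ga2 + ga1 * al2 - be1 * be2 / 2 = 3 * (t + u) + s\<^sup>2 / 2" unfolding det by simp
qed

text \<open>This is the resolvent cubic that governs the splitting into two real quadratics. It
  depends only on the invariants 36 and -1377, hence not on the point of the curve.\<close>

lemma resolvent_root:
  obtains \<rho> :: real where "\<rho> ^ 3 - 16 * \<rho> = 816" "991 / 100 < \<rho>" "\<rho> < 992 / 100"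
proof -
  define g where "g x = x ^ 3 - 16 * x" for x :: real
  have v: "g (991 / 100) < 816" "g (992 / 100) > 816" by (simp_all add: g_def power3_eq_cube)
  have cont: "continuous_on {991 / 100..992 / 100} g" unfolding g_def by (intro continuous_intros)
  obtain \<rho> where r: "991 / 100 \<le> \<rho>" "\<rho> \<le> 992 / 100" "g \<rho> = 816"
    using IVT'[of g "991 / 100" 816 "992 / 100", OF _ _ _ cont] v by auto
  have "\<rho> \<noteq> 991 / 100" "\<rho> \<noteq> 992 / 100" using v r(3) by (metis less_irrefl)+
  then show thesis using that[of \<rho>] r by (simp add: g_def)
qed

text \<open>Comparison of coefficients with (3 x^2 - s x + u) (3 x^2 + s x + t) prescribes 3 (t + u)
  - s^2, s (u - t) and t u. With s^2 = 3 (4 X + \<rho>) the first two give t and u, and the third is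
  the curve equation combined with the resolvent cubic.\<close>

lemma quartic_factorisation:
  fixes X Y :: real
  assumes curve: "3 * Y\<^sup>2 = 4 * X ^ 3 - 4 * X + 51" and X: "X \<ge> 0" and r: "\<rho> ^ 3 - 16 * \<rho> = 816" "\<rho> > 0"
  obtains s t u where "s > 0" "s\<^sup>2 = 3 * (4 * X + \<rho>)" "t + u = \<rho> - 2 * X" "s * (u - t) = - 12 * Y" "t * u = 4 - 3 * X\<^sup>2"
proof -
  define s where "s = sqrt (3 * (4 * X + \<rho>))"
  have s0: "s > 0" using X r by (simp add: s_def)
  have s2: "s\<^sup>2 = 3 * (4 * X + \<rho>)" using X r by (simp add: s_def)
  define t u where "t = (\<rho> - 2 * X + 12 * Y / s) / 2" and "u = (\<rho> - 2 * X - 12 * Y / s) / 2"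
  have "t + u = \<rho> - 2 * X" by (simp add: t_def u_def field_simps)
  moreover have "s * (u - t) = - 12 * Y" using s0 by (simp add: t_def u_def field_simps)
  moreover have "t * u = 4 - 3 * X\<^sup>2"
  proof -
    have "144 * Y\<^sup>2 = s\<^sup>2 * (\<rho>\<^sup>2 - 4 * X * \<rho> + 16 * X\<^sup>2 - 16)"
    proof -
      have "144 * Y\<^sup>2 = 48 * (4 * X ^ 3 - 4 * X + 51)" using curve by simp
      also have "\<dots> = 3 * (64 * X ^ 3 - 64 * X + (\<rho> ^ 3 - 16 * \<rho>))" unfolding r by simp
      also have "\<dots> = 3 * (4 * X + \<rho>) * (\<rho>\<^sup>2 - 4 * X * \<rho> + 16 * X\<^sup>2 - 16)"
        by (simp add: algebra_simps power2_eq_square power3_eq_cube)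
      finally show ?thesis unfolding s2 .
    qed
    then have Ys: "(12 * Y / s)\<^sup>2 = \<rho>\<^sup>2 - 4 * X * \<rho> + 16 * X\<^sup>2 - 16"
      using s0 by (simp add: power_divide power_mult_distrib)
    have "t * u = ((\<rho> - 2 * X)\<^sup>2 - (12 * Y / s)\<^sup>2) / 4" by (simp add: t_def u_def power2_eq_square algebra_simps)
    then show ?thesis unfolding Ys by (simp add: power2_eq_square algebra_simps)
  qed
  ultimately show thesis using that s0 s2 by blast
qed

text \<open>
  Fa is the form a m^4 + 4 b m^3 n + 6 c m^2 n^2 + 4 d m n^3 + e n^4 with (a, b, c, d, e) = (9, 0, -3 X, -3 Y, 4 - 3 X^2).
  After the substitution with columns (m, n) and (k, l) the new coefficients a, b, c are Fa, Fb, Fc,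
  while d and e are Fb and Fa with the columns exchanged. Fh is the Hessian a c - b^2.
\<close>

definition Fa :: "int \<Rightarrow> int \<Rightarrow> int \<Rightarrow> int \<Rightarrow> int" where
  "Fa X Y m n = 9 * m ^ 4 - 18 * X * m\<^sup>2 * n\<^sup>2 - 12 * Y * m * n ^ 3 + (4 - 3 * X\<^sup>2) * n ^ 4"

definition Fb :: "int \<Rightarrow> int \<Rightarrow> int \<Rightarrow> int \<Rightarrow> int \<Rightarrow> int \<Rightarrow> int" where
  "Fb X Y m n k l = 9 * m ^ 3 * k - 9 * X * (m\<^sup>2 * n * l + m * n\<^sup>2 * k)
     - 3 * Y * (3 * m * n\<^sup>2 * l + n ^ 3 * k) + (4 - 3 * X\<^sup>2) * n ^ 3 * l"

definition Fc :: "int \<Rightarrow> int \<Rightarrow> int \<Rightarrow> int \<Rightarrow> int \<Rightarrow> int \<Rightarrow> int" where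
  "Fc X Y m n k l = 9 * m\<^sup>2 * k\<^sup>2 - 3 * X * (m\<^sup>2 * l\<^sup>2 + 4 * m * n * k * l + n\<^sup>2 * k\<^sup>2)
     - 6 * Y * (m * n * l\<^sup>2 + n\<^sup>2 * k * l) + (4 - 3 * X\<^sup>2) * n\<^sup>2 * l\<^sup>2"

definition Fh :: "int \<Rightarrow> int \<Rightarrow> int \<Rightarrow> int \<Rightarrow> int" where
  "Fh X Y m n = - 27 * X * m ^ 4 - 54 * Y * m ^ 3 * n + (36 - 54 * X\<^sup>2) * m\<^sup>2 * n\<^sup>2
     - 18 * X * Y * m * n ^ 3 + (9 * X ^ 3 - 12 * X - 9 * Y\<^sup>2) * n ^ 4"

lemma Fd_symmetric: "Fb X Y k l m n = 9 * m * k ^ 3 - 9 * X * (n * k\<^sup>2 * l + m * k * l\<^sup>2)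
     - 3 * Y * (3 * n * k * l\<^sup>2 + m * l ^ 3) + (4 - 3 * X\<^sup>2) * n * l ^ 3"
  by (simp add: Fb_def algebra_simps)

text \<open>The Hessian is a covariant of weight two, so for determinant 1 the number a c - b^2
  depends only on the first column.\<close>

lemma Fh_eq: "Fa X Y m n * Fc X Y m n k l - (Fb X Y m n k l)\<^sup>2 = Fh X Y m n * (m * l - n * k)\<^sup>2"
  unfolding Fa_def Fb_def Fc_def Fh_def
  by (simp add: algebra_simps power2_eq_square power3_eq_cube power4_eq_xxxx)

text \<open>As (1, 0) = l (m, n) - n (k, l), the transformed form takes at (l, -n) the value 9 of
  the original one at (1, 0). Every Thue equation below is an instance of this.\<close>

lemma Fa_recovers: "m * l - n * k = 1 \<Longrightarrow>
  Fa X Y m n * l ^ 4 - 4 * Fb X Y m n k l * l ^ 3 * n + 6 * Fc X Y m n k l * l\<^sup>2 * n\<^sup>2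
    - 4 * Fb X Y k l m n * l * n ^ 3 + Fa X Y k l * n ^ 4 = 9"
proof -
  assume det: "m * l - n * k = 1"
  have "Fa X Y m n * l ^ 4 - 4 * Fb X Y m n k l * l ^ 3 * n + 6 * Fc X Y m n k l * l\<^sup>2 * n\<^sup>2
    - 4 * Fb X Y k l m n * l * n ^ 3 + Fa X Y k l * n ^ 4 = 9 * (m * l - n * k) ^ 4"
    unfolding Fa_def Fb_def Fc_def
    by (simp add: algebra_simps power2_eq_square power3_eq_cube power4_eq_xxxx)
  then show ?thesis unfolding det by simp
qed

lemma real_coefficients:
  fixes X Y m n k l :: int and s t u \<rho> :: real
  assumes s: "s\<^sup>2 = 3 * (4 * of_int X + \<rho>)" "t + u = \<rho> - 2 * of_int X" "s * (u - t) = - 12 * of_int Y" "t * u = 4 - 3 * (of_int X)\<^sup>2"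
    and det: "m * l - n * k = 1"
  defines "al1 \<equiv> 3 * (of_int m)\<^sup>2 - s * of_int m * of_int n + u * (of_int n)\<^sup>2" and "be1 \<equiv> 6 * of_int m * of_int k - s * (of_int m * of_int l + of_int n * of_int k) + 2 * u * of_int n * of_int l"
    and "ga1 \<equiv> 3 * (of_int k)\<^sup>2 - s * of_int k * of_int l + u * (of_int l)\<^sup>2"
    and "al2 \<equiv> 3 * (of_int m)\<^sup>2 + s * of_int m * of_int n + t * (of_int n)\<^sup>2" and "be2 \<equiv> 6 * of_int m * of_int k + s * (of_int m * of_int l + of_int n * of_int k) + 2 * t * of_int n * of_int l"
    and "ga2 \<equiv> 3 * (of_int k)\<^sup>2 + s * of_int k * of_int l + t * (of_int l)\<^sup>2"
  shows "of_int (Fa X Y m n) = al1 * al2" "4 * of_int (Fb X Y m n k l) = al1 * be2 + be1 * al2"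
    "6 * of_int (Fc X Y m n k l) = al1 * ga2 + ga1 * al2 + be1 * be2"
    "4 * of_int (Fb X Y k l m n) = be1 * ga2 + ga1 * be2" "of_int (Fa X Y k l) = ga1 * ga2"
    "al1 * ga1 - be1\<^sup>2 / 4 = 3 * u - s\<^sup>2 / 4" "al2 * ga2 - be2\<^sup>2 / 4 = 3 * t - s\<^sup>2 / 4"
    "al1 * ga2 + ga1 * al2 - be1 * be2 / 2 = 9 / 2 * \<rho>"
proof -
  have detr: "(of_int m :: real) * of_int l - of_int n * of_int k = 1"
    using det by (metis of_int_1 of_int_diff of_int_mult)
  have g: "6 * (- 3 * of_int X) = 3 * (t + u) - s\<^sup>2" using s(1,2) by simp
  have h: "4 * (- 3 * of_int Y) = s * (u - t)" using s(3) by simp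
  note T = transformed_coefficients[OF g h s(4)[symmetric] detr, folded al1_def be1_def ga1_def al2_def be2_def ga2_def]
  show "of_int (Fa X Y m n) = al1 * al2" "of_int (Fa X Y k l) = ga1 * ga2"
    using T(1,5) by (simp_all add: Fa_def)
  show "4 * of_int (Fb X Y m n k l) = al1 * be2 + be1 * al2" unfolding T(2)[symmetric] by (simp add: Fb_def algebra_simps)
  show "4 * of_int (Fb X Y k l m n) = be1 * ga2 + ga1 * be2" unfolding T(4)[symmetric] Fd_symmetric by (simp add: algebra_simps)
  show "6 * of_int (Fc X Y m n k l) = al1 * ga2 + ga1 * al2 + be1 * be2" unfolding T(3)[symmetric] by (simp add: Fc_def algebra_simps)
  show "al1 * ga1 - be1\<^sup>2 / 4 = 3 * u - s\<^sup>2 / 4" "al2 * ga2 - be2\<^sup>2 / 4 = 3 * t - s\<^sup>2 / 4" by (rule T)+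
  have "3 * (t + u) + s\<^sup>2 / 2 = 9 / 2 * \<rho>" unfolding s(1,2) by (simp add: field_simps)
  then show "al1 * ga2 + ga1 * al2 - be1 * be2 / 2 = 9 / 2 * \<rho>" using T(8) by simp
qed

text \<open>For \<rho> near 9.91 this is negative, so exactly one of the two quadratic factors is
  definite.\<close>

lemma det_product:
  fixes s t u \<rho> X :: real
  assumes "s\<^sup>2 = 3 * (4 * X + \<rho>)" "t + u = \<rho> - 2 * X" "t * u = 4 - 3 * X\<^sup>2"
  shows "(3 * u - s\<^sup>2 / 4) * (3 * t - s\<^sup>2 / 4) = - (27 * \<rho>\<^sup>2 - 576) / 16"
proof -
  have "(3 * u - s\<^sup>2 / 4) * (3 * t - s\<^sup>2 / 4) = 9 * (t * u) - 3 / 4 * s\<^sup>2 * (t + u) + (s\<^sup>2)\<^sup>2 / 16"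
    by (simp add: field_simps power2_eq_square)
  then show ?thesis unfolding assms by (simp add: field_simps power2_eq_square)
qed

text \<open>Invariance under the substitution is obtained from the two real quadratic factors, which
  avoids expanding an identity of degree three in the coefficients with all six variables.\<close>

lemma F_invariants:
  fixes X Y m n k l :: int
  assumes curve: "3 * Y\<^sup>2 = 4 * X ^ 3 - 4 * X + 51" and X: "X \<ge> 0" and det: "m * l - n * k = 1"
  defines "a \<equiv> Fa X Y m n" and "b \<equiv> Fb X Y m n k l" and "c \<equiv> Fc X Y m n k l" and "d \<equiv> Fb X Y k l m n" and "e \<equiv> Fa X Y k l"
  shows "a * e - 4 * b * d + 3 * c\<^sup>2 = 36"
    and "a * c * e + 2 * b * c * d - a * d\<^sup>2 - e * b\<^sup>2 - c ^ 3 = - 1377"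
proof -
  obtain \<rho> :: real where r: "\<rho> ^ 3 - 16 * \<rho> = 816" "991 / 100 < \<rho>" "\<rho> < 992 / 100" by (rule resolvent_root)
  have "real_of_int (3 * Y\<^sup>2) = real_of_int (4 * X ^ 3 - 4 * X + 51)" using curve by simp
  then have curve': "3 * (real_of_int Y)\<^sup>2 = 4 * (of_int X) ^ 3 - 4 * of_int X + 51" by simp
  obtain s t u where s: "s > 0" "s\<^sup>2 = 3 * (4 * of_int X + \<rho>)" "t + u = \<rho> - 2 * of_int X" "s * (u - t) = - 12 * of_int Y" "t * u = 4 - 3 * (of_int X)\<^sup>2"
    using quartic_factorisation[OF curve' _ r(1)] X r by auto
  note R = real_coefficients[OF s(2-5) det]
  note I = product_invariants[OF R(1-5)[folded a_def b_def c_def d_def e_def] R(6-8)[symmetric]]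
  have dd: "(3 * u - s\<^sup>2 / 4) * (3 * t - s\<^sup>2 / 4) = - (27 * \<rho>\<^sup>2 - 576) / 16" using det_product[OF s(2,3,5)] .
  have "real_of_int (a * e - 4 * b * d + 3 * c\<^sup>2) = 36"
    using I(1) unfolding dd by (simp add: field_simps power2_eq_square)
  then show "a * e - 4 * b * d + 3 * c\<^sup>2 = 36" by linarith
  have "9 / 2 * \<rho> * (3 * u - s\<^sup>2 / 4) * (3 * t - s\<^sup>2 / 4) / 6 - (9 / 2 * \<rho>) ^ 3 / 216 = - (27 / 16) * (\<rho> ^ 3 - 16 * \<rho>)"
    unfolding mult.assoc dd by (simp add: field_simps power2_eq_square power3_eq_cube)
  then have "real_of_int (a * c * e + 2 * b * c * d - a * d\<^sup>2 - e * b\<^sup>2 - c ^ 3) = - 1377"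
    using I(2) unfolding r by simp
  then show "a * c * e + 2 * b * c * d - a * d\<^sup>2 - e * b\<^sup>2 - c ^ 3 = - 1377" by linarith
qed

text \<open>With P = E q1 and R' = q2 at the reduced vector, E a = P R' while P + 55 R' is bounded.
  The upper bound for a is the inequality of the two means; the lower bound uses that the square J
  of the Jacobian is nonnegative, which keeps P from being very negative. The Hessian is 3/4 \<rho>
  a - J / 4, so a bound for J encloses it.\<close>

lemma reduced_quartic:
  fixes X Y :: int
  assumes curve: "3 * Y\<^sup>2 = 4 * X ^ 3 - 4 * X + 51" and X: "X \<ge> 0" and Y: "Y > 0"
  obtains m n k l :: int where "m * l - n * k = 1" "- 8 < Fa X Y m n" "Fa X Y m n < 36"
    "Fa X Y m n > 0 \<Longrightarrow> 100 * Fh X Y m n \<le> 744 * Fa X Y m n"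
    "Fa X Y m n > 0 \<Longrightarrow> 10000 * Fh X Y m n \<ge> 74325 * Fa X Y m n - 2095000"
proof -
  obtain \<rho> :: real where r: "\<rho> ^ 3 - 16 * \<rho> = 816" "991 / 100 < \<rho>" "\<rho> < 992 / 100" by (rule resolvent_root)
  have r2: "982 / 10 < \<rho>\<^sup>2" "\<rho>\<^sup>2 < 9841 / 100"
  proof -
    have "(991 / 100)\<^sup>2 < \<rho>\<^sup>2" "\<rho>\<^sup>2 < (992 / 100)\<^sup>2" using r by (intro power_strict_mono; simp)+
    then show "982 / 10 < \<rho>\<^sup>2" "\<rho>\<^sup>2 < 9841 / 100" by (simp_all add: power2_eq_square)
  qed
  have "real_of_int (3 * Y\<^sup>2) = real_of_int (4 * X ^ 3 - 4 * X + 51)" using curve by simp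
  then have curve': "3 * (real_of_int Y)\<^sup>2 = 4 * (of_int X) ^ 3 - 4 * of_int X + 51" by simp
  obtain s t u where s: "s > 0" "s\<^sup>2 = 3 * (4 * of_int X + \<rho>)" "t + u = \<rho> - 2 * of_int X" "s * (u - t) = - 12 * of_int Y" "t * u = 4 - 3 * (of_int X)\<^sup>2"
    using quartic_factorisation[OF curve' _ r(1)] X r by auto
  define E d1 where "E = 3 * t - s\<^sup>2 / 4" and "d1 = 3 * u - s\<^sup>2 / 4"
  define ep be where "ep = (27 * \<rho>\<^sup>2 - 576) / 16" and "be = 9 / 2 * \<rho>"
  have ep: "1296 / 10 < ep" "ep < 1301 / 10" using r2 by (simp_all add: ep_def)
  have be: "445 / 10 < be" "be < 4464 / 100" using r by (simp_all add: be_def)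
  have dd: "d1 * E = - ep" using det_product[OF s(2,3,5)] unfolding d1_def E_def ep_def by (simp only: minus_divide_left)
  \<comment> \<open>The sign of Y decides which quadratic factor is definite: for positive Y it is
    the second.\<close>
  have "s * (u - t) < 0" using s(4) Y by simp
  then have "u < t" using s(1) by (simp add: mult_less_0_iff)
  then have "d1 < E" by (simp add: E_def d1_def)
  have E0: "E > 0"
  proof (rule ccontr)
    assume "\<not> E > 0"
    then have "E \<le> 0" "d1 \<le> 0" using \<open>d1 < E\<close> by auto
    then have "d1 * E \<ge> 0" by (rule mult_nonpos_nonpos[rotated])
    then show False using dd ep by simp
  qed
  \<comment> \<open>The form is q1 q2 with q2 positive definite; we reduce E q1 + 55 q2, where E is the determinant of q2.
    The weight 55 makes it positive definite and keeps the resulting bounds on Fa small.\<close>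
  define kap where "kap = 3025 + 55 * be - ep"
  have kap: "5300 < kap" "kap < 5351" using ep be by (simp_all add: kap_def)
  define A B C where "A = 3 * E + 165" and "B = (55 - E) * s" and "C = E * u + 55 * t"
  have "A * C - B\<^sup>2 / 4 = E * (d1 * E) + 55 * E * (3 * (t + u) + s\<^sup>2 / 2) + 3025 * E"
    by (simp add: A_def B_def C_def d1_def E_def field_simps power2_eq_square)
  also have "3 * (t + u) + s\<^sup>2 / 2 = be" unfolding s(2,3) be_def by (simp add: field_simps)
  finally have det: "A * C - B\<^sup>2 / 4 = E * kap" unfolding dd by (simp add: kap_def algebra_simps)
  have A0: "A > 0" using E0 by (simp add: A_def)
  have AC: "A * C - B\<^sup>2 / 4 > 0" unfolding det using E0 kap by simp
  obtain m n k l :: int where lk: "m * l - n * k = 1"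
    and red: "3 * (A * (of_int m)\<^sup>2 + B * of_int m * of_int n + C * (of_int n)\<^sup>2)\<^sup>2 \<le> 4 * (A * C - B\<^sup>2 / 4)"
    by (rule reduced_basis[OF A0 AC])
  define al1 al2 where "al1 = 3 * (of_int m)\<^sup>2 - s * of_int m * of_int n + u * (of_int n)\<^sup>2" and "al2 = 3 * (of_int m)\<^sup>2 + s * of_int m * of_int n + t * (of_int n)\<^sup>2"
  define be1 be2 where "be1 = 6 * of_int m * of_int k - s * (of_int m * of_int l + of_int n * of_int k) + 2 * u * of_int n * of_int l" and "be2 = 6 * of_int m * of_int k + s * (of_int m * of_int l + of_int n * of_int k) + 2 * t * of_int n * of_int l"
  note R = real_coefficients[OF s(2-5) lk]
  note I = product_invariants[OF R(1-5) R(6-8)[symmetric], folded al1_def al2_def be1_def be2_def]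
  define a h where "a = real_of_int (Fa X Y m n)" and "h = real_of_int (Fh X Y m n)"
  define P R' where "P = E * al1" and "R' = al2"
  define J where "J = (al1 * be2 - be1 * al2)\<^sup>2 / 4"
  have a: "a = al1 * al2" using R(1) by (simp add: a_def al1_def al2_def)
  have Ea: "E * a = P * R'" by (simp add: a P_def R'_def)
  have J0: "J \<ge> 0" by (simp add: J_def)
  have "J = - E * al1\<^sup>2 + be * al1 * al2 - d1 * al2\<^sup>2" using I(4) by (simp add: J_def E_def d1_def be_def)
  then have "E * J = E * (- E * al1\<^sup>2 + be * al1 * al2 - d1 * al2\<^sup>2)" by simp
  also have "\<dots> = - P\<^sup>2 + be * (P * R') - (d1 * E) * R'\<^sup>2" by (simp add: P_def R'_def power2_eq_square algebra_simps)
  finally have EJ: "E * J = - P\<^sup>2 + be * (P * R') + ep * R'\<^sup>2" unfolding dd by simp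
  have hJ: "h = 3 / 4 * \<rho> * a - J / 4"
  proof -
    have "real_of_int (Fa X Y m n * Fc X Y m n k l - (Fb X Y m n k l)\<^sup>2) = h"
      unfolding Fh_eq lk by (simp add: h_def)
    then show ?thesis using I(3) by (simp add: J_def a_def)
  qed
  have Rpos: "R' > 0"
  proof -
    have "12 * R' = (6 * of_int m + s * of_int n)\<^sup>2 + 4 * E * (of_int n)\<^sup>2"
      by (simp add: R'_def al2_def E_def power2_eq_square field_simps)
    moreover have "(6 * of_int m + s * of_int n)\<^sup>2 + 4 * E * (of_int n)\<^sup>2 > 0"
    proof (cases "n = 0")
      case True
      then have "m \<noteq> 0" using lk by auto
      then show ?thesis using True by simp
    next
      case False
      then have "4 * E * (real_of_int n)\<^sup>2 > 0" using E0 by simp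
      then show ?thesis by (meson add_nonneg_pos zero_le_power2)
    qed
    ultimately show ?thesis by linarith
  qed
  define Q where "Q = P + 55 * R'"
  have "A * (of_int m)\<^sup>2 + B * of_int m * of_int n + C * (of_int n)\<^sup>2 = Q"
    by (simp add: Q_def P_def R'_def al1_def al2_def A_def B_def C_def algebra_simps)
  then have Q2: "3 * Q\<^sup>2 \<le> 4 * (E * kap)" using red unfolding det by simp
  have upper: "a < 36"
  proof -
    have "220 * (P * R') \<le> Q\<^sup>2"
    proof -
      have "Q\<^sup>2 - 220 * (P * R') = (P - 55 * R')\<^sup>2" by (simp add: Q_def power2_eq_square algebra_simps)
      then show ?thesis using zero_le_power2[of "P - 55 * R'"] by linarith
    qed
    then have "660 * (E * a) \<le> 4 * (E * kap)" unfolding Ea using Q2 by linarith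
    then have "E * (660 * a) \<le> E * (4 * kap)" by (simp add: algebra_simps)
    then have "660 * a \<le> 4 * kap" using E0 by simp
    then show ?thesis using kap by linarith
  qed
  have lower: "a > - 8"
  proof (rule ccontr)
    assume "\<not> a > - 8"
    then have a8: "a \<le> - 8" by simp
    then have "E * a < 0" using E0 by (simp add: mult_pos_neg)
    then have P0: "P < 0" unfolding Ea using Rpos by (simp add: mult_less_0_iff)
    define p where "p = - P"
    have p0: "p > 0" using P0 by (simp add: p_def)
    have "E * J \<ge> 0" using E0 J0 by simp
    then have "p\<^sup>2 + be * p * R' \<le> ep * R' * R'" unfolding EJ by (simp add: p_def power2_eq_square)
    then have "be * p * R' \<le> ep * R' * R'" using zero_le_power2[of p] by linarith
    then have "be * p \<le> ep * R'" using Rpos by simp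
    moreover have "445 / 10 * p \<le> be * p" using be p0 by simp
    moreover have "ep * R' \<le> 1301 / 10 * R'" using ep Rpos by simp
    ultimately have pR: "p \<le> 293 / 100 * R'" using Rpos by linarith
    then have "Q \<ge> 52 * R'" using Rpos by (simp add: Q_def p_def)
    then have "Q\<^sup>2 \<ge> (52 * R')\<^sup>2" using Rpos by (intro power_mono) auto
    then have "3 * (2704 * R'\<^sup>2) \<le> 4 * (E * kap)" using Q2 by (simp add: power_mult_distrib)
    also have "\<dots> \<le> 4 * (E * 5351)" using E0 kap by simp
    finally have R2: "8112 * R'\<^sup>2 \<le> 21404 * E" by simp
    have "p * R' \<le> 293 / 100 * R' * R'" using pR Rpos by (intro mult_right_mono) auto
    then have "p * R' \<le> 293 / 100 * R'\<^sup>2" by (simp add: power2_eq_square)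
    moreover have "p * R' = - (E * a)" unfolding Ea by (simp add: p_def)
    moreover have "E * a \<le> E * (- 8)" using a8 E0 by (intro mult_left_mono) auto
    ultimately show False using R2 E0 by linarith
  qed
  \<comment> \<open>E J is the indefinite form -P^2 + be P R' + ep R'^2 with discriminant Lam. On a
    line where P + 55 R' is constant it has a maximum, and the difference from that maximum is a
    square, up to a constant factor.\<close>
  have Jb: "J / 4 \<le> 2095 / 10"
  proof -
    define Lam where "Lam = be\<^sup>2 + 4 * ep"
    have "Lam * Q\<^sup>2 - 4 * kap * (E * J) = ((be + 110) * P - (55 * be - 2 * ep) * R')\<^sup>2"
      unfolding EJ Lam_def kap_def Q_def by (simp add: power2_eq_square algebra_simps)
    then have "4 * kap * (E * J) \<le> Lam * Q\<^sup>2" using zero_le_power2[of "(be + 110) * P - (55 * be - 2 * ep) * R'"] by linarith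
    moreover have "Lam * (3 * Q\<^sup>2) \<le> Lam * (4 * (E * kap))" using Q2 ep by (intro mult_left_mono) (auto simp: Lam_def)
    ultimately have "12 * kap * (E * J) \<le> Lam * (4 * (E * kap))" by linarith
    then have "(E * kap) * (12 * J) \<le> (E * kap) * (4 * Lam)" by (simp add: algebra_simps)
    moreover have "E * kap > 0" using E0 kap by simp
    ultimately have "12 * J \<le> 4 * Lam" by (simp only: mult_le_cancel_left_pos)
    moreover have "Lam = 27 * \<rho>\<^sup>2 - 144" by (simp add: Lam_def be_def ep_def power2_eq_square field_simps)
    ultimately show ?thesis using r2 by linarith
  qed
  show thesis
  proof (rule that[OF lk])
    show "- 8 < Fa X Y m n" "Fa X Y m n < 36" using lower upper by (simp_all add: a_def)
    assume "Fa X Y m n > 0"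
    then have a0: "a > 0" by (simp add: a_def)
    have "3 / 4 * \<rho> * a \<le> 744 / 100 * a" using r a0 by (intro mult_right_mono) auto
    then have "100 * h \<le> 744 * a" using hJ J0 by linarith
    then have "real_of_int (100 * Fh X Y m n) \<le> real_of_int (744 * Fa X Y m n)" by (simp add: a_def h_def)
    then show "100 * Fh X Y m n \<le> 744 * Fa X Y m n" by linarith
    have "74325 / 10000 * a \<le> 3 / 4 * \<rho> * a" using r a0 by (intro mult_right_mono) auto
    then have "10000 * h \<ge> 74325 * a - 2095000" using hJ Jb by linarith
    then have "real_of_int (10000 * Fh X Y m n) \<ge> real_of_int (74325 * Fa X Y m n - 2095000)" by (simp add: a_def h_def)
    then show "10000 * Fh X Y m n \<ge> 74325 * Fa X Y m n - 2095000" by linarith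
  qed
qed

section \<open>Integral points on the cubic\<close>

definition square_residues :: "int \<Rightarrow> int \<Rightarrow> bool" where
  "square_residues q x \<longleftrightarrow> list_ex (\<lambda>r. (x - r * r) mod q = 0) [0..q - 1]"

lemma square_residuesI:
  assumes "x = g\<^sup>2" "q > 0"
  shows "square_residues q x"
proof -
  have "[g\<^sup>2 = (g mod q)\<^sup>2] (mod q)" by (intro cong_pow) (simp add: cong_def)
  then have "(x - (g mod q) * (g mod q)) mod q = 0"
    using assms(1) by (simp add: cong_iff_dvd_diff power2_eq_square)
  moreover have "g mod q \<in> {0..q - 1}" using assms(2) by simp
  ultimately show ?thesis unfolding square_residues_def list_ex_iff set_upto by (intro bexI)
qed

text \<open>Here x is the right side of the syzygy for Hessian value 3 h, divided by 9, so it has to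
  be a square. In the ranges that the reduction allows, these moduli leave only the few values of h
  listed below.\<close>

definition sieve :: "int \<Rightarrow> int \<Rightarrow> bool" where
  "sieve a h \<longleftrightarrow> (let x = - 12 * h ^ 3 + 12 * a\<^sup>2 * h + 153 * a ^ 3 in
     list_all (\<lambda>q. square_residues q x) [7, 5, 11, 29, 37, 13, 16])"

lemma sieveI:
  assumes "- 12 * h ^ 3 + 12 * a\<^sup>2 * h + 153 * a ^ 3 = g\<^sup>2"
  shows "sieve a h"
  unfolding sieve_def Let_def using square_residuesI[OF assms] by simp

lemma sieve_1: "list_all (\<lambda>h. sieve 1 h \<longrightarrow> h \<in> {-3, -2, 2}) [-68..2]"
  by code_simp

lemma sieve_4: "list_all (\<lambda>h. sieve 4 h \<longrightarrow> h \<in> {-12, -8, 8}) [-60..9]"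
  by code_simp

lemma sieve_13: "list_all (\<lambda>h. \<not> sieve 13 h) [-38..32]"
  by code_simp

lemma sieve_16: "list_all (\<lambda>h. sieve 16 h \<longrightarrow> h \<in> {-3, 32}) [-31..39]"
  by code_simp

lemma sieve_25: "list_all (\<lambda>h. sieve 25 h \<longrightarrow> h \<in> {13, 50}) [-8..62]"
  by code_simp

lemma sieve_28: "list_all (\<lambda>h. \<not> sieve 28 h) [-1..69]"
  by code_simp

lemma list_all_upto: "list_all P [i..j] \<Longrightarrow> i \<le> x \<Longrightarrow> x \<le> j \<Longrightarrow> P x"
  by (simp add: list_all_iff)

section \<open>Covariants of the form and its behaviour modulo 2, 3 and 4\<close>

lemma Fb_shift: "Fb X Y m n (k - r * m) (l - r * n) = Fb X Y m n k l - r * Fa X Y m n"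
  by (simp add: Fa_def Fb_def algebra_simps power2_eq_square power3_eq_cube power4_eq_xxxx)

lemma Fc_commute: "Fc X Y k l m n = Fc X Y m n k l"
  by (simp add: Fc_def algebra_simps)

text \<open>The classical syzygy G^2 = -4 H^3 + I a^2 H - J a^3 between the leading coefficients of
  a quartic, its Hessian and its sextic covariant.\<close>

lemma quartic_syzygy:
  fixes a b c d e :: int
  assumes "a * e - 4 * b * d + 3 * c\<^sup>2 = 36" "a * c * e + 2 * b * c * d - a * d\<^sup>2 - e * b\<^sup>2 - c ^ 3 = - 1377"
    and h: "h = a * c - b\<^sup>2"
  shows "(a\<^sup>2 * d - 3 * a * b * c + 2 * b ^ 3)\<^sup>2 = - 4 * h ^ 3 + 36 * a\<^sup>2 * h + 1377 * a ^ 3"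
proof -
  have "(a\<^sup>2 * d - 3 * a * b * c + 2 * b ^ 3)\<^sup>2 = - 4 * h ^ 3 + (a * e - 4 * b * d + 3 * c\<^sup>2) * a\<^sup>2 * h
      - (a * c * e + 2 * b * c * d - a * d\<^sup>2 - e * b\<^sup>2 - c ^ 3) * a ^ 3"
    unfolding h by (simp add: algebra_simps power2_eq_square power3_eq_cube)
  then show ?thesis unfolding assms by simp
qed

text \<open>Modulo 4 the form is the square of m^2 + X n^2.\<close>

lemma Fa_mod_4: "Fa X Y m n mod 4 \<in> {0, 1}"
proof -
  have "Fa X Y m n = (m\<^sup>2 + X * n\<^sup>2)\<^sup>2 + 4 * (2 * m ^ 4 - 5 * X * m\<^sup>2 * n\<^sup>2 - 3 * Y * m * n ^ 3 + (1 - X\<^sup>2) * n ^ 4)"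
    by (simp add: Fa_def algebra_simps power2_eq_square power3_eq_cube power4_eq_xxxx)
  then have "Fa X Y m n mod 4 = (m\<^sup>2 + X * n\<^sup>2)\<^sup>2 mod 4" by (simp only: mod_mult_self2)
  moreover have "t\<^sup>2 mod 4 \<in> {0, 1}" for t :: int
  proof (cases "even t")
    case True
    then obtain s where "t = 2 * s" by blast
    then show ?thesis by (simp add: power_mult_distrib)
  next
    case False
    then obtain s where "t = 2 * s + 1" by (rule oddE)
    then have "t\<^sup>2 = 1 + 4 * (s\<^sup>2 + s)" by (simp add: power2_eq_square algebra_simps)
    then have "t\<^sup>2 mod 4 = 1" by (simp only: mod_mult_self2) simp
    then show ?thesis by simp
  qed
  ultimately show ?thesis by simp
qed

lemma fourth_power_mod_3: "\<not> 3 dvd n \<Longrightarrow> \<exists>t. n ^ 4 = 1 + 3 * t" for n :: int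
proof -
  assume "\<not> 3 dvd n"
  then have "n mod 3 = 1 \<or> n mod 3 = 2" by presburger
  then have "[n ^ 4 = 1] (mod 3)"
    using cong_pow[of n "n mod 3" 3 4] by (auto simp: cong_def)
  then show ?thesis by (metis cong_iff_lin cong_sym)
qed

text \<open>The congruence h = -X modulo 3 carries a condition on X over to the Hessian; X mod 3 = 2
  would correspond to h mod 3 = 1.\<close>

lemma F_mod_3_coprime:
  assumes "\<not> 3 dvd n"
  shows "Fa X Y m n mod 3 = 1" "\<exists>h. Fh X Y m n = 3 * h \<and> 3 dvd h + X"
proof -
  obtain t where t: "n ^ 4 = 1 + 3 * t" using fourth_power_mod_3[OF assms] by blast
  have "Fa X Y m n = 1 + 3 * (3 * m ^ 4 - 6 * X * m\<^sup>2 * n\<^sup>2 - 4 * Y * m * n ^ 3 + (1 - X\<^sup>2) * n ^ 4 + t)"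
    unfolding Fa_def using t by (simp add: algebra_simps)
  then show "Fa X Y m n mod 3 = 1" by (simp only: mod_mult_self2) simp
  define h where "h = - 9 * X * m ^ 4 - 18 * Y * m ^ 3 * n + (12 - 18 * X\<^sup>2) * m\<^sup>2 * n\<^sup>2
     - 6 * X * Y * m * n ^ 3 + (3 * X ^ 3 - 4 * X - 3 * Y\<^sup>2) * n ^ 4"
  have "Fh X Y m n = 3 * h" by (simp add: Fh_def h_def algebra_simps)
  moreover have "h + X = 3 * (- 3 * X * m ^ 4 - 6 * Y * m ^ 3 * n + (4 - 6 * X\<^sup>2) * m\<^sup>2 * n\<^sup>2
     - 2 * X * Y * m * n ^ 3 + (X ^ 3 - X - Y\<^sup>2) * n ^ 4 - X * t)"
    unfolding h_def using t by (simp add: algebra_simps)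
  then have "3 dvd h + X" by (metis dvd_triv_left)
  ultimately show "\<exists>h. Fh X Y m n = 3 * h \<and> 3 dvd h + X" by blast
qed

lemma F_mod_3_dvd:
  assumes n: "3 dvd n" and m: "\<not> 3 dvd m"
  shows "9 dvd Fa X Y m n" "Fa X Y m n \<noteq> 0" "\<exists>h. Fh X Y m n = 27 * h \<and> 3 dvd h + X"
proof -
  obtain s where s: "n = 3 * s" using n by blast
  obtain t where t: "m ^ 4 = 1 + 3 * t" using fourth_power_mod_3[OF m] by blast
  have a: "Fa X Y m n = 9 * (1 + 3 * (t - 6 * X * m\<^sup>2 * s\<^sup>2 - 12 * Y * m * s ^ 3 + 3 * (4 - 3 * X\<^sup>2) * s ^ 4))"
    unfolding Fa_def using t by (simp add: s power_mult_distrib algebra_simps)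
  then show "9 dvd Fa X Y m n" by (metis dvd_triv_left)
  show "Fa X Y m n \<noteq> 0" unfolding a by presburger
  define h where "h = - X * m ^ 4 - 6 * Y * m ^ 3 * s + (12 - 18 * X\<^sup>2) * m\<^sup>2 * s\<^sup>2
     - 18 * X * Y * m * s ^ 3 + 3 * (9 * X ^ 3 - 12 * X - 9 * Y\<^sup>2) * s ^ 4"
  have "Fh X Y m n = 27 * h" by (simp add: Fh_def h_def s power_mult_distrib algebra_simps)
  moreover have "h + X = 3 * (- X * t - 2 * Y * m ^ 3 * s + (4 - 6 * X\<^sup>2) * m\<^sup>2 * s\<^sup>2
     - 6 * X * Y * m * s ^ 3 + (9 * X ^ 3 - 12 * X - 9 * Y\<^sup>2) * s ^ 4)"
    unfolding h_def using t by (simp add: algebra_simps)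
  then have "3 dvd h + X" by (metis dvd_triv_left)
  ultimately show "\<exists>h. Fh X Y m n = 27 * h \<and> 3 dvd h + X" by blast
qed

text \<open>Modulo 2 the Hessian is n^4 here. Its purpose is to force X to be odd: a = 1 contradicts
  a mod 16 = 9, and for a = 9 the evenness of n is what \<open>thue_A\<close> asks for.\<close>

lemma F_even:
  assumes X: "even X" and Y: "odd Y" and h: "even (Fh X Y m n)"
  shows "even n" "odd (Fa X Y m n) \<Longrightarrow> Fa X Y m n mod 16 = 9"
proof -
  show n: "even n"
  proof (rule ccontr)
    assume "odd n"
    then have "odd (Fh X Y m n)" using X Y by (simp add: Fh_def)
    then show False using h by simp
  qed
  assume odd: "odd (Fa X Y m n)"
  then have "odd m" using X n by (auto simp: Fa_def)
  obtain x s where xs: "X = 2 * x" "n = 2 * s" using X n by (auto elim!: evenE)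
  obtain q where q: "m = 2 * q + 1" using \<open>odd m\<close> by (rule oddE)
  have "even (q * (q + 1))" by simp
  then obtain w where w: "q * (q + 1) = 2 * w" by blast
  have "m\<^sup>2 = 1 + 8 * w" using w by (simp add: q power2_eq_square algebra_simps)
  then have "m ^ 4 = (1 + 8 * w)\<^sup>2" by (metis power2_eq_square power4_eq_xxxx mult.assoc)
  then have m4: "m ^ 4 = 1 + 16 * (w + 4 * w\<^sup>2)" by (simp add: power2_eq_square algebra_simps)
  have "Fa X Y m n = 9 + 16 * (9 * (w + 4 * w\<^sup>2) - 9 * x * m\<^sup>2 * s\<^sup>2 - 6 * Y * m * s ^ 3 + (4 - 12 * x\<^sup>2) * s ^ 4)"
    unfolding Fa_def m4 by (simp add: xs power_mult_distrib algebra_simps)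
  then show "Fa X Y m n mod 16 = 9" by (simp only: mod_mult_self2) simp
qed

text \<open>The bounds and the congruences modulo 3 and 4 leave a in {1, 4, 13, 16, 25, 28} if 3
  does not divide n, and a = 9 otherwise. Each a admits few Hessian values. Those not excluded
  locally either give the residue and parity of X directly or fix the reduced form up to a sign, and
  its Thue equation settles the case; X = 3 comes from trivial solutions.\<close>

theorem cubic_integral_points:
  fixes X Y :: int
  assumes curve0: "3 * Y\<^sup>2 = 4 * X ^ 3 - 4 * X + 51" and X1: "X \<ge> 1" and X2: "X mod 3 \<noteq> 2"
  shows "X = 3 \<or> X mod 3 = 1 \<and> odd X"
proof -
  define Z where "Z = \<bar>Y\<bar>"
  have curve: "3 * Z\<^sup>2 = 4 * X ^ 3 - 4 * X + 51" using curve0 by (simp add: Z_def)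
  have oddZ: "odd Z"
  proof
    assume "even Z"
    then have "even (3 * Z\<^sup>2)" by simp
    then show False unfolding curve by simp
  qed
  then have Z0: "Z > 0" by (auto simp: Z_def)
  have X0: "X \<ge> 0" using X1 by simp
  obtain m n k0 l0 where det0: "m * l0 - n * k0 = 1"
    and a_lo: "- 8 < Fa X Z m n" and a_hi: "Fa X Z m n < 36"
    and h_hi: "Fa X Z m n > 0 \<Longrightarrow> 100 * Fh X Z m n \<le> 744 * Fa X Z m n"
    and h_lo: "Fa X Z m n > 0 \<Longrightarrow> 10000 * Fh X Z m n \<ge> 74325 * Fa X Z m n - 2095000"
    by (rule reduced_quartic[OF curve X0 Z0]) blast
  define a where "a = Fa X Z m n"
  define h where "h = Fh X Z m n"
  have forms: "a * Fc X Z m n k l - (Fb X Z m n k l)\<^sup>2 = h"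
    "a * Fa X Z k l - 4 * Fb X Z m n k l * Fb X Z k l m n + 3 * (Fc X Z m n k l)\<^sup>2 = 36"
    "(a\<^sup>2 * Fb X Z k l m n - 3 * a * Fb X Z m n k l * Fc X Z m n k l + 2 * Fb X Z m n k l ^ 3)\<^sup>2 = - 4 * h ^ 3 + 36 * a\<^sup>2 * h + 1377 * a ^ 3"
    "a * l ^ 4 - 4 * Fb X Z m n k l * l ^ 3 * n + 6 * Fc X Z m n k l * l\<^sup>2 * n\<^sup>2 - 4 * Fb X Z k l m n * l * n ^ 3 + Fa X Z k l * n ^ 4 = 9"
    if det: "m * l - n * k = 1" for k l
  proof -
    show 1: "a * Fc X Z m n k l - (Fb X Z m n k l)\<^sup>2 = h" using Fh_eq[of X Z m n k l] unfolding det a_def h_def by simp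
    note I = F_invariants[OF curve X0 det, folded a_def]
    show "a * Fa X Z k l - 4 * Fb X Z m n k l * Fb X Z k l m n + 3 * (Fc X Z m n k l)\<^sup>2 = 36" by (rule I(1))
    show "(a\<^sup>2 * Fb X Z k l m n - 3 * a * Fb X Z m n k l * Fc X Z m n k l + 2 * Fb X Z m n k l ^ 3)\<^sup>2 = - 4 * h ^ 3 + 36 * a\<^sup>2 * h + 1377 * a ^ 3"
      by (rule quartic_syzygy[OF I 1[symmetric]])
    show "a * l ^ 4 - 4 * Fb X Z m n k l * l ^ 3 * n + 6 * Fc X Z m n k l * l\<^sup>2 * n\<^sup>2 - 4 * Fb X Z k l m n * l * n ^ 3 + Fa X Z k l * n ^ 4 = 9"
      unfolding a_def by (rule Fa_recovers[OF det])
  qed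
  \<comment> \<open>Subtracting r times the first column from the second keeps a and h and changes b
    by r a, so b matters only modulo a.\<close>
  have shift: "\<exists>k l. m * l - n * k = 1 \<and> Fb X Z m n k l = Fb X Z m n k0 l0 - r * a" for r
    using det0 Fb_shift[of X Z m n k0 r l0]
    by (intro exI[of _ "k0 - r * m"] exI[of _ "l0 - r * n"]) (simp add: a_def algebra_simps)
  have amod: "a mod 4 \<in> {0, 1}" unfolding a_def by (rule Fa_mod_4)
  define b0 c0 d0 e0 where bcde0: "b0 = Fb X Z m n k0 l0" "c0 = Fc X Z m n k0 l0" "d0 = Fb X Z k0 l0 m n" "e0 = Fa X Z k0 l0"
  note S0 = forms[OF det0, folded bcde0]
  have n0: "h = - 27 * X" if "n = 0"
  proof -
    have "m * l0 = 1" using det0 that by simp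
    then have "\<bar>m\<bar> = 1" using abs_zmult_eq_1[of m l0] by simp
    then have "m ^ 4 = 1" by (metis even_numeral power_even_abs power_one)
    then show ?thesis using that by (simp add: h_def Fh_def)
  qed
  show ?thesis
  proof (cases "3 dvd n")
    case False
    have a3: "a mod 3 = 1" using F_mod_3_coprime(1)[OF False] by (simp add: a_def)
    obtain g where g: "h = 3 * g" "3 dvd g + X" using F_mod_3_coprime(2)[OF False] unfolding h_def by blast
    have "(a\<^sup>2 * d0 - 3 * a * b0 * c0 + 2 * b0 ^ 3)\<^sup>2 = 9 * (- 12 * g ^ 3 + 12 * a\<^sup>2 * g + 153 * a ^ 3)"
      unfolding S0(3) g by (simp add: power_mult_distrib)
    moreover obtain f where f: "a\<^sup>2 * d0 - 3 * a * b0 * c0 + 2 * b0 ^ 3 = 3 * f"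
    proof -
      have "3 dvd (a\<^sup>2 * d0 - 3 * a * b0 * c0 + 2 * b0 ^ 3)\<^sup>2" unfolding calculation by simp
      then have "3 dvd a\<^sup>2 * d0 - 3 * a * b0 * c0 + 2 * b0 ^ 3" using prime_dvd_power[of "3::int"] by simp
      then show thesis using that by blast
    qed
    ultimately have f2: "- 12 * g ^ 3 + 12 * a\<^sup>2 * g + 153 * a ^ 3 = f\<^sup>2" by (simp add: power_mult_distrib)
    have sv: "sieve a g" by (rule sieveI[OF f2])
    have g1: "g mod 3 \<noteq> 1" using g(2) X2 by presburger
    have small: "list_all (\<lambda>a. a mod 3 = 1 \<longrightarrow> a mod 4 \<in> {0, 1} \<longrightarrow> a \<in> {1, 4, 13, 16, 25, 28}) [- 7..35::int]" by code_simp
    have "- 7 \<le> a" "a \<le> 35" using a_lo a_hi unfolding a_def[symmetric] by simp_all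
    then have "a \<in> {1, 4, 13, 16, 25, 28}" using list_all_upto[OF small, of a] a3 amod by (simp only: simp_thms)
    then have "a = 1 \<or> a = 4 \<or> a = 13 \<or> a = 16 \<or> a = 25 \<or> a = 28" by simp
    moreover have hb: "100 * (3 * g) \<le> 744 * a \<and> 10000 * (3 * g) \<ge> 74325 * a - 2095000" if "a > 0"
      using h_hi h_lo that unfolding a_def[symmetric] h_def[symmetric] g by blast
    ultimately consider "a = 1" "g = -3 \<or> g = 2" | "a = 4" | "a = 16" "g = -3 \<or> g = 32" | "a = 25" "g = 50"
    proof (elim disjE)
      assume a: "a = 1"
      then have gr: "-68 \<le> g" "g \<le> 2" using hb by auto
      have "g \<in> {-3, -2, 2}" using list_all_upto[OF sieve_1 gr] sv a by simp
      then show thesis using that(1) a g1 by auto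
    next
      assume a: "a = 13"
      then have gr: "-38 \<le> g" "g \<le> 32" using hb by auto
      show thesis using list_all_upto[OF sieve_13 gr] sv a by simp
    next
      assume a: "a = 16"
      then have gr: "-31 \<le> g" "g \<le> 39" using hb by auto
      have "g \<in> {-3, 32}" using list_all_upto[OF sieve_16 gr] sv a by simp
      then show thesis using that(3) a by auto
    next
      assume a: "a = 25"
      then have gr: "-8 \<le> g" "g \<le> 62" using hb by auto
      have "g \<in> {13, 50}" using list_all_upto[OF sieve_25 gr] sv a by simp
      then show thesis using that(4) a g1 by auto
    next
      assume a: "a = 28"
      then have gr: "-1 \<le> g" "g \<le> 69" using hb by auto
      show thesis using list_all_upto[OF sieve_28 gr] sv a by simp
    qed (use that in blast)
    then show ?thesis
    proof cases
      case 1
      show ?thesis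
      proof (cases "g = -3")
        case True
        \<comment> \<open>As a = 1, the shift achieves b = 0, and the form becomes (1, 0, -9, d,
          -207) with d = 63 or d = -63. Its value 9 at (l, -n) forces 3 to divide l; division by 9
          then gives the equation of \<open>thue_C\<close>.\<close>
        obtain k l where kl: "m * l - n * k = 1" "Fb X Z m n k l = 0" using shift[of b0] 1(1) bcde0 by auto
        define c d e where cde: "c = Fc X Z m n k l" "d = Fb X Z k l m n" "e = Fa X Z k l"
        note S = forms[OF kl(1), unfolded kl(2) 1(1) g(1) True, folded cde]
        have c: "c = - 9" using S(1) by simp
        have e: "e = - 207" using S(2) by (simp add: c)
        have "d\<^sup>2 = 63\<^sup>2" using S(3) by simp
        then have d: "d = 63 \<or> d = - 63" by (simp only: power2_eq_iff)
        have eq: "l ^ 4 - 54 * l\<^sup>2 * n\<^sup>2 - 4 * d * l * n ^ 3 - 207 * n ^ 4 = 9" using S(4) by (simp add: c e)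
        obtain d' where d': "d = 3 * d'" "d' = 21 \<or> d' = - 21" using d that[of 21] that[of "- 21"] by auto
        have "l ^ 4 = 3 * (3 + 18 * l\<^sup>2 * n\<^sup>2 + 4 * d' * l * n ^ 3 + 69 * n ^ 4)" using eq by (simp add: d'(1) algebra_simps)
        then have "3 dvd l ^ 4" by (metis dvd_triv_left)
        then have "3 dvd l" using prime_dvd_power[of "3::int"] by simp
        then obtain w where w: "l = 3 * w" by blast
        have "9 * w ^ 4 - 54 * w\<^sup>2 * n\<^sup>2 - 4 * d' * w * n ^ 3 - 23 * n ^ 4 = 1"
          using eq unfolding w d'(1) by (simp add: power_mult_distrib)
        then have False using d'(2) thue_C[of w n] thue_C[of w "- n"] by auto
        then show ?thesis ..
      next
        case False
        then have g2: "g = 2" using 1(2) by simp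
        have "X mod 3 = 1" using g(2) g2 by presburger
        moreover have "odd X"
        proof
          assume "even X"
          moreover have "even (Fh X Z m n)" "odd (Fa X Z m n)" using g g2 1(1) by (auto simp: h_def a_def)
          ultimately have "Fa X Z m n mod 16 = 9" using F_even oddZ by blast
          then show False using 1(1) by (simp add: a_def)
        qed
        ultimately show ?thesis by simp
      qed
    next
      case 2
      \<comment> \<open>For g = -12, -8, 8 the sieved number is a genuine square, namely 168^2,
        120^2 and 72^2, so no further modulus could help. Instead b and c are even, which makes f
        divisible by 16 and f^2 by 256.\<close>
      have "even (3 * c0\<^sup>2)"
      proof -
        have "3 * c0\<^sup>2 = 2 * (18 - 2 * e0 + 2 * b0 * d0)" using S0(2) 2 by simp
        then show ?thesis by (metis dvd_triv_left)
      qed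
      then obtain c where c: "c0 = 2 * c" by (auto elim!: evenE)
      have "b0\<^sup>2 = 2 * (2 * c0) - 3 * g" using S0(1) 2 g by simp
      have sg: "g = -12 \<or> g = -8 \<or> g = 8"
      proof -
        have gr: "-60 \<le> g" "g \<le> 9" using hb 2 by auto
        show ?thesis using list_all_upto[OF sieve_4 gr] sv 2 by simp
      qed
      then have "even (b0\<^sup>2)" using \<open>b0\<^sup>2 = 2 * (2 * c0) - 3 * g\<close> by auto
      then obtain b where b: "b0 = 2 * b" by (auto elim!: evenE)
      have "3 * f = 16 * d0 - 12 * b0 * c0 + 2 * b0 ^ 3" using f 2 by simp
      then have "3 * f = 16 * (d0 - 3 * b * c + b ^ 3)" by (simp add: b c power_mult_distrib)
      then have "f mod 16 = 0" by presburger
      then obtain f' where "f = 16 * f'" by blast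
      then have "f\<^sup>2 = 256 * f'\<^sup>2" by (simp add: power_mult_distrib)
      then have "256 dvd - 12 * g ^ 3 + 12 * a\<^sup>2 * g + 153 * a ^ 3" unfolding f2 by simp
      then have False using sg 2 by auto
      then show ?thesis ..
    next
      case 3
      show ?thesis
      proof (cases "g = -3")
        case True
        have "b0\<^sup>2 = 16 * c0 + 9" using S0(1) 3(1) g True by simp
        \<comment> \<open>This shift brings b into -7..8, a full set of residues modulo 16.\<close>
        define r where "r = (b0 + 7) div 16"
        obtain k l where kl: "m * l - n * k = 1" "Fb X Z m n k l = b0 - r * 16" using shift[of r] 3(1) bcde0 by auto
        define b c d e where bcde: "b = Fb X Z m n k l" "c = Fc X Z m n k l" "d = Fb X Z k l m n" "e = Fa X Z k l"
        note S = forms[OF kl(1), unfolded 3(1) g(1) True, folded bcde]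
        have br: "- 7 \<le> b" "b \<le> 8" using kl(2) unfolding bcde(1)[symmetric] r_def by presburger+
        then have "b \<in> {-7, -6, -5, -4, -3, -2, -1, 0, 1, 2, 3, 4, 5, 6, 7, 8}" by (simp, presburger)
        moreover have bc: "b\<^sup>2 = 16 * c + 9" using S(1) by simp
        ultimately have "(b = 3 \<and> c = 0) \<or> (b = -3 \<and> c = 0) \<or> (b = 5 \<and> c = 1) \<or> (b = -5 \<and> c = 1)"
          unfolding insert_iff empty_iff by (elim disjE) (simp_all, presburger+)
        moreover have "(256 * d - 48 * b * c + 2 * b ^ 3)\<^sup>2 = 2358\<^sup>2" using S(3) by simp
        then have "256 * d - 48 * b * c + 2 * b ^ 3 = 2358 \<or> 256 * d - 48 * b * c + 2 * b ^ 3 = - 2358" by (simp only: power2_eq_iff)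
        ultimately have bcd: "(b = 3 \<and> d = 9 \<or> b = - 3 \<and> d = - 9) \<and> c = 0" by (elim disjE conjE) (simp_all, presburger+)
        then have e: "e = 9" using S(2) by auto
        obtain y where y: "y = n \<or> y = - n" "16 * l ^ 4 - 12 * l ^ 3 * y - 36 * l * y ^ 3 + 9 * y ^ 4 = 9"
        proof (cases "b = 3")
          case True
          then have d9: "d = 9" "c = 0" using bcd by auto
          show thesis using S(4) unfolding True d9 e by (intro that[of n]) simp_all
        next
          case False
          then have d9: "b = - 3" "d = - 9" "c = 0" using bcd by auto
          show thesis using S(4) unfolding d9 e by (intro that[of "- n"]) simp_all
        qed
        have "l ^ 4 = 3 * (3 - 5 * l ^ 4 + 4 * l ^ 3 * y + 12 * l * y ^ 3 - 3 * y ^ 4)" using y(2) by (simp add: algebra_simps)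
        then have "3 dvd l ^ 4" by (metis dvd_triv_left)
        then have "3 dvd l" using prime_dvd_power[of "3::int"] by simp
        then obtain w where w: "l = 3 * w" by blast
        have w1: "144 * w ^ 4 - 36 * w ^ 3 * y - 12 * w * y ^ 3 + y ^ 4 = 1"
          using y(2) unfolding w by (simp add: power_mult_distrib)
        \<comment> \<open>The equation belongs to a form equivalent to that of
          \<open>thue_B\<close>; the substitution is m = y - 3 w, k = -w.\<close>
        have "(y - 3 * w) ^ 4 - 54 * (y - 3 * w)\<^sup>2 * (- w)\<^sup>2 + 252 * (y - 3 * w) * (- w) ^ 3 - 207 * (- w) ^ 4
            = 144 * w ^ 4 - 36 * w ^ 3 * y - 12 * w * y ^ 3 + y ^ 4"
          by (simp add: algebra_simps power2_eq_square power3_eq_cube power4_eq_xxxx)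
        then have "- w = 0" using thue_B[of "y - 3 * w" "- w"] w1 by simp
        then have "l = 0" using w by simp
        then have "n * k = - 1" using kl(1) by simp
        then have "\<bar>k\<bar> = 1" using abs_zmult_eq_1[of k n] by (simp add: mult.commute)
        then have k4: "k ^ 4 = 1" by (metis even_numeral power_even_abs power_one)
        \<comment> \<open>Now the second column is (1, 0) up to sign, and the Hessian is -27 X
          there. Computing it with the columns exchanged gives X = 3, that is y = 4.\<close>
        have "Fa X Z k l * Fc X Z k l m n - (Fb X Z k l m n)\<^sup>2 = Fh X Z k l * (k * n - l * m)\<^sup>2" by (rule Fh_eq)
        then have "e * c - d\<^sup>2 = Fh X Z k l * (k * n - l * m)\<^sup>2" by (simp add: bcde Fc_commute[of X Z k l])
        moreover have "(k * n - l * m)\<^sup>2 = 1" using \<open>l = 0\<close> \<open>n * k = - 1\<close> by (simp add: mult.commute)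
        moreover have "Fh X Z k l = - 27 * X" using \<open>l = 0\<close> k4 by (simp add: Fh_def)
        ultimately have "X = 3" using bcd e by auto
        then show ?thesis ..
      next
        case False
        then have g32: "g = 32" using 3(2) by simp
        \<comment> \<open>This value also makes the sieved number a square, 576^2. The obstruction
          is again 2-adic: b is divisible by 8 and c is even, and the first invariant then fails
          modulo 16.\<close>
        have b2: "b0\<^sup>2 = 16 * (c0 - 6)" using S0(1) 3(1) g g32 by simp
        then have "even (b0\<^sup>2)" by simp
        then obtain b1 where b1: "b0 = 2 * b1" by (auto elim!: evenE)
        have "b1\<^sup>2 = 4 * (c0 - 6)" using b2 by (simp add: b1 power_mult_distrib)
        then have "even (b1\<^sup>2)" by simp
        then obtain b where b: "b1 = 2 * b" by (auto elim!: evenE)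
        have c: "c0 = 6 + b\<^sup>2" using \<open>b1\<^sup>2 = 4 * (c0 - 6)\<close> by (simp add: b power_mult_distrib)
        have i: "16 * e0 - 16 * b * d0 + 3 * c0\<^sup>2 = 36" using S0(2) 3(1) by (simp add: b1 b)
        then have "3 * c0\<^sup>2 = 4 * (9 - 4 * e0 + 4 * b * d0)" by (simp add: algebra_simps)
        then have "even (3 * c0\<^sup>2)" by simp
        then have "even c0" by simp
        then have "even (b\<^sup>2)" using c by simp
        then obtain b' where b': "b = 2 * b'" by (auto elim!: evenE)
        have "c0 = 2 * (3 + 2 * b'\<^sup>2)" using c by (simp add: b' power_mult_distrib)
        then have "3 * c0\<^sup>2 = 12 + 16 * (9 * b'\<^sup>2 + 3 * (b'\<^sup>2)\<^sup>2 + 6)" by (simp add: power2_eq_square algebra_simps)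
        then have "16 * (e0 - b * d0 + 9 * b'\<^sup>2 + 3 * (b'\<^sup>2)\<^sup>2 + 6) = 24" using i by (simp add: algebra_simps)
        then have "16 dvd (24::int)" by (metis dvd_triv_left)
        then have False by simp
        then show ?thesis ..
      qed
    next
      case 4
      \<comment> \<open>5 divides b, and the first invariant becomes 3 c^2 = 1 modulo 5, although 2
        is no square modulo 5.\<close>
      have "b0\<^sup>2 = 25 * (c0 - 6)" using S0(1) 4 g by simp
      then have "5 dvd b0\<^sup>2" by simp
      then have "5 dvd b0" using prime_dvd_power[of "5::int"] by simp
      then obtain b where b: "b0 = 5 * b" by blast
      have "25 * e0 - 20 * b * d0 + 3 * c0\<^sup>2 = 36" using S0(2) 4 by (simp add: b)
      then have "3 * c0\<^sup>2 = 1 + 5 * (7 - 5 * e0 + 4 * b * d0)" by (simp add: algebra_simps)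
      then have c5: "(3 * c0\<^sup>2) mod 5 = 1" by (simp only: mod_mult_self2) simp
      have "c0 mod 5 = 0 \<or> c0 mod 5 = 1 \<or> c0 mod 5 = 2 \<or> c0 mod 5 = 3 \<or> c0 mod 5 = 4" by presburger
      moreover have "[c0 = c0 mod 5] (mod 5)" by (simp add: cong_def)
      then have "[3 * c0\<^sup>2 = 3 * (c0 mod 5)\<^sup>2] (mod 5)" by (intro cong_mult cong_refl cong_pow)
      ultimately have False using c5 by (auto simp: cong_def)
      then show ?thesis ..
    qed
  next
    case True
    have m3: "\<not> 3 dvd m"
    proof
      assume "3 dvd m"
      then have "3 dvd m * l0 - n * k0" using True by simp
      then show False unfolding det0 by simp
    qed
    note F3 = F_mod_3_dvd[OF True m3, of X Z, folded a_def h_def]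
    obtain g where g: "h = 27 * g" "3 dvd g + X" using F3(3) by blast
    have g1: "g mod 3 \<noteq> 1" using g(2) X2 by presburger
    have a9: "a = 9"
    proof -
      obtain q where q: "a = 9 * q" using F3(1) by blast
      have "q = 1 \<or> q = 2 \<or> q = 3" using a_lo a_hi F3(2) unfolding a_def[symmetric] q by presburger
      then show ?thesis using amod q by auto
    qed
    have "100 * (27 * g) \<le> 744 * 9 \<and> 10000 * (27 * g) \<ge> 74325 * 9 - 2095000"
      using h_hi h_lo unfolding a_def[symmetric] h_def[symmetric] g a9 by simp
    then have gr: "- 5 \<le> g" "g \<le> 2" by linarith+
    have "(81 * d0 - 27 * b0 * c0 + 2 * b0 ^ 3)\<^sup>2 = 729 * (1377 - 108 * (g ^ 3 - g))"
      using S0(3) by (simp add: a9 g power_mult_distrib)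
    have "b0\<^sup>2 = 9 * c0 - 27 * g" using S0(1) a9 g by simp
    then have "3 dvd b0\<^sup>2" by simp
    then have "3 dvd b0" using prime_dvd_power[of "3::int"] by simp
    then obtain b where b: "b0 = 3 * b" by blast
    have c: "c0 = b\<^sup>2 + 3 * g" using \<open>b0\<^sup>2 = 9 * c0 - 27 * g\<close> by (simp add: b power_mult_distrib)
    define f where "f = 3 * d0 - 3 * b * c0 + 2 * b ^ 3"
    have "81 * d0 - 27 * b0 * c0 + 2 * b0 ^ 3 = 27 * f" by (simp add: f_def b power_mult_distrib)
    then have f2: "f\<^sup>2 = 1377 - 108 * (g ^ 3 - g)"
      using \<open>(81 * d0 - 27 * b0 * c0 + 2 * b0 ^ 3)\<^sup>2 = 729 * (1377 - 108 * (g ^ 3 - g))\<close> by (simp add: power_mult_distrib)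
    have g_cases: "g = -3 \<or> g = 2"
    proof -
      have "g = -5 \<or> g = -4 \<or> g = -3 \<or> g = -2 \<or> g = -1 \<or> g = 0 \<or> g = 1 \<or> g = 2" using gr by presburger
      moreover have "f\<^sup>2 \<noteq> 14337" "f\<^sup>2 \<noteq> 7857" "f\<^sup>2 \<noteq> 1377"
      proof -
        have ns: "x\<^sup>2 \<noteq> t" if "r\<^sup>2 < t" "t < (r + 1)\<^sup>2" "r \<ge> 0" for x t r :: int
        proof
          assume "x\<^sup>2 = t"
          then have "r\<^sup>2 < \<bar>x\<bar>\<^sup>2" "\<bar>x\<bar>\<^sup>2 < (r + 1)\<^sup>2" using that by simp_all
          then have "r < \<bar>x\<bar>" "\<bar>x\<bar> < r + 1" using that(3) power2_less_imp_less[of r "\<bar>x\<bar>"] power2_less_imp_less[of "\<bar>x\<bar>" "r + 1"] by simp_all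
          then show False by simp
        qed
        show "f\<^sup>2 \<noteq> 14337" by (rule ns[of 119]) simp_all
        show "f\<^sup>2 \<noteq> 7857" by (rule ns[of 88]) simp_all
        show "f\<^sup>2 \<noteq> 1377" by (rule ns[of 37]) simp_all
      qed
      ultimately show ?thesis using f2 g1 by (elim disjE) simp_all
    qed
    have f3: "3 dvd f"
    proof -
      have "f\<^sup>2 = 63\<^sup>2 \<or> f\<^sup>2 = 27\<^sup>2" using f2 g_cases by auto
      then show ?thesis by (auto simp only: power2_eq_iff) simp_all
    qed
    \<comment> \<open>Since a = 9, the shift can reach b = 0 only if 9 divides \<open>b0\<close> = 3
      b.\<close>
    have "3 dvd b"
    proof -
      have "2 * b ^ 3 = f - 3 * (d0 - b * c0)" by (simp add: f_def algebra_simps)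
      then have "3 dvd 2 * b ^ 3" using f3 by simp
      then have "3 dvd b ^ 3" by presburger
      then show ?thesis using prime_dvd_power[of "3::int"] by simp
    qed
    then obtain r where "b = 3 * r" by blast
    then have r: "b0 = 9 * r" using b by simp
    obtain k l where kl: "m * l - n * k = 1" "Fb X Z m n k l = 0" using shift[of r] a9 bcde0 r by auto
    obtain s where s: "n = 3 * s" using True by blast
    define c1 d e where cde: "c1 = Fc X Z m n k l" "d = Fb X Z k l m n" "e = Fa X Z k l"
    note S = forms[OF kl(1), unfolded kl(2) a9 g(1), folded cde]
    have c1: "c1 = 3 * g" using S(1) by simp
    show ?thesis
    proof (cases "g = -3")
      case True
      have e: "e = - 23" using S(2) by (simp add: c1 True)
      have "d\<^sup>2 = 21\<^sup>2" using S(3) True by simp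
      then have d: "d = 21 \<or> d = - 21" by (simp only: power2_eq_iff)
      have "9 * l ^ 4 - 54 * l\<^sup>2 * n\<^sup>2 - 4 * d * l * n ^ 3 - 23 * n ^ 4 = 9" using S(4) by (simp add: c1 e True)
      then have eq: "l ^ 4 - 54 * l\<^sup>2 * s\<^sup>2 - 12 * d * l * s ^ 3 - 207 * s ^ 4 = 1"
        by (simp add: s power_mult_distrib)
      \<comment> \<open>The trivial solution does occur here: h = -27 X and h = -81 give X =
        3.\<close>
      have "s = 0" using d eq thue_B[of l s] thue_B[of l "- s"] by auto
      then have "h = - 27 * X" using n0 s by simp
      then show ?thesis using g True by simp
    next
      case False
      then have g2: "g = 2" using g_cases by simp
      have "X mod 3 = 1" using g(2) g2 by presburger
      moreover have "odd X"
      proof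
        assume "even X"
        moreover have "even (Fh X Z m n)" using g g2 by (simp add: h_def)
        ultimately have "even n" using F_even(1) oddZ by blast
        then have "even s" using s by simp
        have e: "e = - 8" using S(2) by (simp add: c1 g2)
        have "d\<^sup>2 = 9\<^sup>2" using S(3) g2 by simp
        then have d: "d = 9 \<or> d = - 9" by (simp only: power2_eq_iff)
        have "9 * l ^ 4 + 36 * l\<^sup>2 * n\<^sup>2 - 4 * d * l * n ^ 3 - 8 * n ^ 4 = 9" using S(4) by (simp add: c1 e g2)
        then have eq: "l ^ 4 + 36 * l\<^sup>2 * s\<^sup>2 - 12 * d * l * s ^ 3 - 72 * s ^ 4 = 1"
          by (simp add: s power_mult_distrib)
        \<comment> \<open>The trivial solution would mean h = 54 = -27 X, hence X = -2, outside the
          range considered.\<close>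
        have "s = 0" using d eq \<open>even s\<close> thue_A[of l s] thue_A[of l "- s"] by auto
        then have "h = - 27 * X" using n0 s by simp
        then show False using g g2 X1 by simp
      qed
      ultimately show ?thesis by simp
    qed
  qed
qed

section \<open>The four equations\<close>

lemma prime_power_eq_prime_power:
  fixes p q a k :: nat
  assumes "prime p" "prime q" "a \<ge> 1" "p ^ a = q ^ k"
  shows "p = q \<and> a = k"
proof -
  have "p dvd q ^ k" using assms(3,4) by (metis dvd_power less_le_trans zero_less_one)
  then have "p dvd q" using assms(1) prime_dvd_power by blast
  then have "p = q" using assms(1,2) primes_dvd_imp_eq by blast
  then show ?thesis using assms(4) prime_gt_1_nat[OF assms(1)] by simp
qed

lemma dvd_prime_power_cases:
  fixes q r b :: nat
  assumes "prime q" "prime r" "r dvd q ^ b"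
  shows "q = r"
  using assms prime_dvd_power primes_dvd_imp_eq by blast

text \<open>As 2^12 is 1 modulo 5, 7 and 13, only b mod 12 matters, and for each odd residue one of
  these moduli admits no Y.\<close>

lemma odd_power_of_two_off_curve:
  fixes Y :: int and b :: nat
  assumes "3 * Y\<^sup>2 = 4 * (2 ^ b * (2 ^ b - 1) * (2 ^ b - 2)) + 51" and "odd b"
  shows False
proof -
  let ?g = "\<lambda>y. 4 * (y * (y - 1) * (y - 2)) + 51 :: int"
  have ex: "list_all (\<lambda>r. \<not> list_all (\<lambda>N. list_ex (\<lambda>s. (3 * s\<^sup>2 - ?g (2 ^ r)) mod N = 0) [0..N - 1]) [5, 7, 13]) [1, 3, 5, 7, 9, 11 :: nat]"
    by code_simp
  have mem: "b mod 12 \<in> set [1, 3, 5, 7, 9, 11]"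
  proof -
    have "odd (b mod 12)" using assms(2) by (simp add: dvd_mod_iff)
    moreover have "b mod 12 < 12" by simp
    ultimately show ?thesis by (simp, presburger)
  qed
  have "list_ex (\<lambda>s. (3 * s\<^sup>2 - ?g (2 ^ (b mod 12))) mod N = 0) [0..N - 1]" if "N \<in> set [5, 7, 13]" for N :: int
  proof -
    have N: "[2 ^ 12 = 1] (mod N)" "N > 0" using that by (auto simp: cong_def)
    have "(2::int) ^ b = (2 ^ 12) ^ (b div 12) * 2 ^ (b mod 12)" by (simp only: power_mult[symmetric] power_add[symmetric] mult_div_mod_eq)
    moreover have "[(2 ^ 12) ^ (b div 12) * 2 ^ (b mod 12) = 1 ^ (b div 12) * 2 ^ (b mod 12)] (mod N)"
      by (intro cong_mult cong_pow N cong_refl)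
    ultimately have "[2 ^ b = 2 ^ (b mod 12)] (mod N)" by simp
    then have "[?g (2 ^ b) = ?g (2 ^ (b mod 12))] (mod N)"
      by (intro cong_add cong_mult cong_diff cong_refl)
    moreover have "[Y mod N = Y] (mod N)" by (simp add: cong_def)
    then have "[3 * (Y mod N)\<^sup>2 = 3 * Y\<^sup>2] (mod N)" by (intro cong_mult cong_pow cong_refl)
    ultimately have "[3 * (Y mod N)\<^sup>2 = ?g (2 ^ (b mod 12))] (mod N)" using assms(1) cong_trans by metis
    then have "(3 * (Y mod N)\<^sup>2 - ?g (2 ^ (b mod 12))) mod N = 0" by (simp only: cong_iff_dvd_diff dvd_eq_mod_eq_0)
    moreover have "Y mod N \<in> {0..N - 1}" using N by simp
    ultimately show ?thesis unfolding list_ex_iff set_upto by (intro bexI)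
  qed
  then have "list_all (\<lambda>N. list_ex (\<lambda>s. (3 * s\<^sup>2 - ?g (2 ^ (b mod 12))) mod N = 0) [0..N - 1]) [5, 7, 13]"
    unfolding list_all_iff by blast
  then show False using ex mem unfolding list_all_iff[of _ "[1, 3, 5, 7, 9, 11 :: nat]"] by blast
qed

text \<open>If 3 divides y, then y is a power of 3, and 9 dividing y would make x (x - 1) congruent
  to 1 modulo 3, which is impossible. Otherwise X = y - 1 is not 2 modulo 3, the hypothesis under
  which the integral points were studied.\<close>

lemma quadratic_minus_cubic:
  fixes q b y :: nat and x :: int
  assumes q: "prime q" and y: "y = q ^ b" and y3: "y \<ge> 3" and x2: "x \<ge> 2"
    and eq: "3 * (x * (x - 1)) - int y * (int y - 1) * (int y - 2) = 12"
  shows "x = 3 \<and> y = 3 \<or> x = 4 \<and> y = 4"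
proof (cases "3 dvd y")
  case True
  then have q3: "q = 3" using dvd_prime_power_cases[OF q] unfolding y by simp
  have "b \<noteq> 0" using y3 y by (intro notI) simp
  have "b < 2"
  proof (rule ccontr)
    assume "\<not> b < 2"
    then have "(3::int) ^ 2 dvd 3 ^ b" by (intro le_imp_power_dvd) simp
    then obtain w where w: "int y = 9 * w" using y q3 by auto
    have "3 * (x * (x - 1) - 4) = 3 * (3 * (w * (int y - 1) * (int y - 2)))" using eq unfolding w by (simp add: algebra_simps)
    then have "x * (x - 1) - 4 = 3 * (w * (int y - 1) * (int y - 2))" by (simp only: mult_cancel_left) simp
    then have "3 dvd x * (x - 1) - 4" by (metis dvd_triv_left)
    moreover have "x mod 3 = 0 \<or> x mod 3 = 1 \<or> x mod 3 = 2" by presburger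
    moreover have "[x * (x - 1) - 4 = (x mod 3) * (x mod 3 - 1) - 4] (mod 3)"
      by (intro cong_mult cong_diff cong_refl) (simp_all add: cong_def)
    ultimately show False by (auto simp: cong_def dvd_eq_mod_eq_0)
  qed
  then have y: "y = 3" using \<open>b \<noteq> 0\<close> y q3 by (cases b) auto
  have "(x - 3) * (x + 2) = 0" using eq unfolding y by (simp add: algebra_simps)
  then show ?thesis using y x2 by auto
next
  case False
  define X where "X = int y - 1"
  have curve: "3 * (2 * x - 1)\<^sup>2 = 4 * X ^ 3 - 4 * X + 51"
    using eq unfolding X_def by (simp add: algebra_simps power2_eq_square power3_eq_cube)
  have "X \<ge> 1" using y3 by (simp add: X_def)
  moreover have "X mod 3 \<noteq> 2"
  proof
    assume "X mod 3 = 2"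
    then have "3 dvd int y" unfolding X_def by presburger
    then show False using False by presburger
  qed
  ultimately consider "X = 3" | "X mod 3 = 1" "odd X" using cubic_integral_points[OF curve] by blast
  then show ?thesis
  proof cases
    case 1
    then have y: "y = 4" by (simp add: X_def)
    have "(x - 4) * (x + 3) = 0" using eq unfolding y by (simp add: algebra_simps)
    then show ?thesis using y x2 by auto
  next
    case 2
    have "even y" using 2(2) by (simp add: X_def)
    then have q2: "q = 2" using dvd_prime_power_cases[OF q two_is_prime_nat] unfolding y by blast
    have "int y mod 3 = 2" using 2(1) unfolding X_def by presburger
    have "odd b"
    proof
      assume "even b"
      then obtain w where "b = 2 * w" by blast
      then have "int y = 4 ^ w" by (simp add: y q2 power_mult)
      moreover have "[4 ^ w = 1 ^ w] (mod (3::int))" by (intro cong_pow) (simp add: cong_def)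
      ultimately show False using \<open>int y mod 3 = 2\<close> by (simp add: cong_def)
    qed
    moreover have "3 * (2 * x - 1)\<^sup>2 = 4 * (2 ^ b * (2 ^ b - 1) * (2 ^ b - 2)) + 51"
    proof -
      have "int y = 2 ^ b" by (simp add: y q2)
      then show ?thesis using eq by (simp add: algebra_simps power2_eq_square)
    qed
    ultimately have False using odd_power_of_two_off_curve by blast
    then show ?thesis ..
  qed
qed

theorem theorem1p3:
  shows "gap_two_solutions 2 3 = {(2, 2, 2, 2), (3, 3, 1, 1)} \<and>
         gap_two_solutions 3 2 = {} \<and>
         gap_two_solutions 2 4 = {(3, 2, 1, 2)} \<and>
         gap_two_solutions 4 2 = {(5, 3, 1, 1)}"
proof (intro conjI)
  have pp3: "p = 3 \<and> a = 1" if "prime p" "a \<ge> 1" "p ^ a = 3" for p a :: nat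
    using prime_power_eq_prime_power[OF that(1) _ that(2), of 3 1] that(3) by simp
  have pp4: "p = 2 \<and> a = 2" if "prime p" "a \<ge> 1" "p ^ a = 4" for p a :: nat
    using prime_power_eq_prime_power[OF that(1) two_is_prime_nat that(2), of 2] that(3) by simp
  have pp5: "p = 5 \<and> a = 1" if "prime p" "a \<ge> 1" "p ^ a = 5" for p a :: nat
    using prime_power_eq_prime_power[OF that(1) _ that(2), of 5 1] that(3) by simp
  have binomials: "(4::nat) choose 2 = 6" "(4::nat) choose 3 = 4" "(3::nat) choose 2 = 3" "(3::nat) choose 3 = 1"
      "(4::nat) choose 4 = 1" "(5::nat) choose 4 = 5"
    by code_simp+
  show "gap_two_solutions 2 3 = {(2, 2, 2, 2), (3, 3, 1, 1)}"
  proof (intro equalityI subsetI)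
    fix s assume "s \<in> gap_two_solutions 2 3"
    then obtain p q a b where s: "s = (p, q, a, b)" and pq: "prime p" "prime q" "a \<ge> 1" "b \<ge> 1"
      and ge: "p ^ a \<ge> 2" "q ^ b \<ge> 3" and eq: "int (p ^ a choose 2) - int (q ^ b choose 3) = 2"
      unfolding gap_two_solutions_def by blast
    have "int (p ^ a) \<ge> 2" using ge(1) by linarith
    moreover have "3 * (int (p ^ a) * (int (p ^ a) - 1)) - int (q ^ b) * (int (q ^ b) - 1) * (int (q ^ b) - 2) = 12"
      using int_choose_2[of "p ^ a"] int_choose_3[of "q ^ b"] eq by linarith
    ultimately have "int (p ^ a) = 3 \<and> q ^ b = 3 \<or> int (p ^ a) = 4 \<and> q ^ b = 4"
      by (rule quadratic_minus_cubic[OF pq(2) refl ge(2)])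
    then have "p ^ a = 3 \<and> q ^ b = 3 \<or> p ^ a = 4 \<and> q ^ b = 4" by linarith
    then show "s \<in> {(2, 2, 2, 2), (3, 3, 1, 1)}"
      using pp3[OF pq(1,3)] pp3[OF pq(2,4)] pp4[OF pq(1,3)] pp4[OF pq(2,4)] s by auto
  qed (auto simp: gap_two_solutions_def binomials)
  show "gap_two_solutions 3 2 = {}"
  proof (rule equals0I)
    fix s assume "s \<in> gap_two_solutions 3 2"
    then obtain p q a b where pq: "prime p" "prime q" "a \<ge> 1" "b \<ge> 1"
      and ge: "p ^ a \<ge> 3" "q ^ b \<ge> 2" and eq: "int (p ^ a choose 3) - int (q ^ b choose 2) = 2"
      unfolding gap_two_solutions_def by blast
    have "int (p ^ a) * (int (p ^ a) - 1) * (int (p ^ a) - 2) = 3 * (int (q ^ b) * (int (q ^ b) - 1)) + 12"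
      using int_choose_3[of "p ^ a"] int_choose_2[of "q ^ b"] eq by linarith
    then show False by (rule cubic_minus_quadratic[OF pq(1) refl ge(1)])
  qed
  show "gap_two_solutions 2 4 = {(3, 2, 1, 2)}"
  proof (intro equalityI subsetI)
    fix s assume "s \<in> gap_two_solutions 2 4"
    then obtain p q a b where s: "s = (p, q, a, b)" and pq: "prime p" "prime q" "a \<ge> 1" "b \<ge> 1"
      and ge: "p ^ a \<ge> 2" "q ^ b \<ge> 4" and eq: "int (p ^ a choose 2) - int (q ^ b choose 4) = 2"
      unfolding gap_two_solutions_def by blast
    have "int (p ^ a) \<ge> 2" "int (q ^ b) \<ge> 4" using ge by linarith+
    moreover have "12 * int (p ^ a) * (int (p ^ a) - 1) - int (q ^ b) * (int (q ^ b) - 1) * (int (q ^ b) - 2) * (int (q ^ b) - 3) = 48"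
      using int_choose_2[of "p ^ a"] int_choose_4[of "q ^ b"] eq unfolding mult.assoc[of 12] by linarith
    ultimately have "int (p ^ a) = 3 \<and> int (q ^ b) = 4" by (rule quadratic_minus_quartic)
    then have "p ^ a = 3" "q ^ b = 4" by linarith+
    then show "s \<in> {(3, 2, 1, 2)}" using pp3[OF pq(1,3)] pp4[OF pq(2,4)] s by simp
  qed (auto simp: gap_two_solutions_def binomials)
  show "gap_two_solutions 4 2 = {(5, 3, 1, 1)}"
  proof (intro equalityI subsetI)
    fix s assume "s \<in> gap_two_solutions 4 2"
    then obtain p q a b where s: "s = (p, q, a, b)" and pq: "prime p" "prime q" "a \<ge> 1" "b \<ge> 1"
      and ge: "p ^ a \<ge> 4" "q ^ b \<ge> 2" and eq: "int (p ^ a choose 4) - int (q ^ b choose 2) = 2"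
      unfolding gap_two_solutions_def by blast
    define x y where xy: "x = int (p ^ a)" "y = int (q ^ b)"
    have ge': "x \<ge> 4" "y \<ge> 2" using ge unfolding xy by linarith+
    have "12 * y * (y - 1) = x * (x - 1) * (x - 2) * (x - 3) - 48"
      using int_choose_4[of "p ^ a"] int_choose_2[of "q ^ b"] eq unfolding xy mult.assoc[of 12] by linarith
    also have "\<dots> = (x\<^sup>2 - 3 * x - 6) * (x\<^sup>2 - 3 * x + 8)" by (simp add: algebra_simps power2_eq_square)
    finally have "12 * y * (y - 1) = (x\<^sup>2 - 3 * x - 6) * (x\<^sup>2 - 3 * x + 8)" .
    moreover have "prime (int q)" "y = int q ^ b" using pq by (simp_all add: xy)
    ultimately have "x = 5 \<and> y = 3" using quartic_minus_quadratic ge' by blast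
    then have "p ^ a = 5" "q ^ b = 3" unfolding xy by linarith+
    then show "s \<in> {(5, 3, 1, 1)}" using pp5[OF pq(1,3)] pp3[OF pq(2,4)] s by simp
  qed (auto simp: gap_two_solutions_def binomials)
qed

end
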